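(* Let $\Gamma\le SL_2(K)$ be a subgroup commensurable with $SL_2(\mathcal{O}_K)$, let $\{\mathfrak{c}_1,\ldots,\mathfrak{c}_h\}\subseteq\mathbb{P}^1(K)$ be a complete set of representatives of the $\Gamma$-orbits on $\mathbb{P}^1(K)$ (the relative $\Gamma$-cusps), let $T\subseteq\Pi_1$ be a discrete subset, let $A_1(s),\ldots,A_h(s)$ be holomorphic functions on $\Pi_1\setminus T$, and let $\gamma_1,\ldots,\gamma_h\in SL_2(K)$ satisfy $\gamma_i\infty=\mathfrak{c}_i$ for all $i$. Then there exists at most one function $G$ satisfying the following four properties: (1) $G:\mathfrak{h}^g\times(\Pi_1\setminus T)\to\mathbb{C}$, $(z,s)\mapsto G(z,s)$, is smooth in $(z,s)$, and $s\mapsto G(z,s)$ is holomorphic on $\Pi_1\setminus T$; (2) there is a weight $p=(p_j)_{j=1}^g\in\mathbb{Z}^g$ such that for every $s$ the function $z\mapsto G(z,s)$ is modular of unitary weight $p$ relative to $\Gamma$, i.e. $G|_{\{p\},\gamma}(\cdot,s)=G(\cdot,s)$ for all $\gamma\in\Gamma$; (3) for each $j\in\{1,\ldots,g\}$, $\Delta_{j,p_j}G(z,s)=s(1-s)G(z,s)$; (4) for each $1\le i\le h$ and each fixed $s\in\Pi_1\setminus T$, $\big|G|_{\{p\},\gamma_i}(z,s)-A_i(s)\operatorname{Norm}(y)^s\big|=O(\operatorname{Norm}(y)^{1-s})$ as $\operatorname{Norm}(y)\to\infty$.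
   Context: $K$ is a totally real number field of degree $g$ over $\mathbb{Q}$ with real embeddings $\sigma_1,\ldots,\sigma_g$ and ring of integers $\mathcal{O}_K$. $\mathfrak{h}^g$ is the product of $g$ copies of the upper half-plane; write $z=(z_j)=x+iy$ with $x,y\in\mathbb{R}^g$, $\operatorname{Norm}(y)=\prod_j y_j$. $\Pi_1=\{s\in\mathbb{C}:\operatorname{Re}(s)>1\}$. $SL_2(K)$ acts on $\mathfrak{h}^g$ by $\gamma z=(\sigma_j(\gamma)z_j)_j$ (Möbius transformations) and on $\mathbb{P}^1(K)$ by Möbius transformations; $\infty=[1:0]$. For $\gamma=\begin{pmatrix}a&b\\c&d\end{pmatrix}$, $j(\gamma,z)=(\sigma_j(c)z_j+\sigma_j(d))_{j}$. For $p\in\mathbb{Z}^g$ and $w\in(\mathbb{C}^\times)^g$, $\omega_p(w)=\prod_j (w_j/|w_j|)^{p_j}$. The slash action is $f|_{\{p\},\gamma}(z)=\omega_p(j(\gamma,z))^{-1}f(\gamma z)$ (applied in the variable $z$). The weight-$p_j$ partial Laplacian in the $j$-th variable is $\Delta_{j,p_j}=-y_j^2\left(\frac{\partial^2}{\partial x_j^2}+\frac{\partial^2}{\partial y_j^2}\right)+ip_jy_j\frac{\partial}{\partial x_j}$. Two subgroups are commensurable if their intersection has finite index in each.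
   Formalization: The weight p is fixed in advance, so uniqueness is among functions G of the same given weight; if the weight in (2) could vary with G, the Eisenstein series of weights 0 and 2 for SL_2(Z) would both satisfy (1)–(4). *)

theory Defs
  imports
    "HOL-Analysis.Analysis"
    "HOL-Algebra.Coset"
    "HOL-Library.Landau_Symbols"
    "HOL-Computational_Algebra.Polynomial"
begin

section \<open>Totally real number fields\<close>

text \<open>The field \<open>K\<close> is a type \<open>'k\<close> of characteristic zero, regarded as a vector space
  over \<open>\<rat>\<close>.\<close>

definition rat_scale :: "rat \<Rightarrow> 'k::field_char_0 \<Rightarrow> 'k"
  where "rat_scale q x = of_rat q * x"

interpretation rat_vs: vector_space "rat_scale :: rat \<Rightarrow> 'k::field_char_0 \<Rightarrow> 'k"
  by unfold_locales (simp_all add: rat_scale_def algebra_simps of_rat_add of_rat_mult)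

definition number_field :: "'k::field_char_0 itself \<Rightarrow> bool"
  where "number_field _ \<longleftrightarrow>
    (\<exists>B :: 'k set. finite B \<and> module.span rat_scale B = UNIV)"

definition field_degree :: "'k::field_char_0 itself \<Rightarrow> nat"
  where "field_degree _ = vector_space.dim rat_scale (UNIV :: 'k set)"

definition field_embedding :: "('a::field \<Rightarrow> 'b::field) \<Rightarrow> bool"
  where "field_embedding \<tau> \<longleftrightarrow>
    \<tau> 1 = 1 \<and> (\<forall>x y. \<tau> (x + y) = \<tau> x + \<tau> y) \<and> (\<forall>x y. \<tau> (x * y) = \<tau> x * \<tau> y)"

definition totally_real :: "'k::field_char_0 itself \<Rightarrow> bool"
  where "totally_real _ \<longleftrightarrow>
    (\<forall>\<tau> :: 'k \<Rightarrow> complex. field_embedding \<tau> \<longrightarrow> range \<tau> \<subseteq> \<real>)"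

definition ring_of_integers :: "'k::field_char_0 set"
  where "ring_of_integers = {x. algebraic_int x}"

section \<open>\<open>SL\<^sub>2\<close> and commensurability\<close>

definition SL2 :: "'k::field set \<Rightarrow> ('k^2^2) monoid"
  where "SL2 R = \<lparr>carrier = {A. det A = 1 \<and> (\<forall>i j. A $ i $ j \<in> R)}, mult = (**), one = mat 1\<rparr>"

definition finite_index_in :: "('a, 'b) monoid_scheme \<Rightarrow> 'a set \<Rightarrow> 'a set \<Rightarrow> bool"
  where "finite_index_in G U H \<longleftrightarrow> finite (rcosets\<^bsub>G\<lparr>carrier := H\<rparr>\<^esub> U)"

definition commensurable :: "('a, 'b) monoid_scheme \<Rightarrow> 'a set \<Rightarrow> 'a set \<Rightarrow> bool"
  where "commensurable G H H' \<longleftrightarrow>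
    finite_index_in G (H \<inter> H') H \<and> finite_index_in G (H \<inter> H') H'"

section \<open>The projective line\<close>

text \<open>Points of \<open>\<bbbP>\<^sup>1(K)\<close> are the lines through the origin in \<open>K\<^sup>2\<close>; the point \<open>[x : y]\<close> is the
  line spanned by \<open>(x, y)\<close>, and the Moebius action is induced by the linear action on \<open>K\<^sup>2\<close>.\<close>

definition proj_point :: "'k::field \<Rightarrow> 'k \<Rightarrow> ('k^2) set"
  where "proj_point x y = vec.span {vector [x, y]}"

definition proj_line :: "('k::field^2) set set"
  where "proj_line = {proj_point x y | x y. (x, y) \<noteq> (0, 0)}"

definition proj_infinity :: "('k::field^2) set"
  where "proj_infinity = proj_point 1 0"

definition proj_act :: "'k::field^2^2 \<Rightarrow> ('k^2) set \<Rightarrow> ('k^2) set"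
  where "proj_act A L = (\<lambda>v. A *v v) ` L"

definition cusp_representatives :: "('k::field^2^2) set \<Rightarrow> nat \<Rightarrow> (nat \<Rightarrow> ('k^2) set) \<Rightarrow> bool"
  where "cusp_representatives \<Gamma> h c \<longleftrightarrow>
    (\<forall>i\<in>{1..h}. c i \<in> proj_line) \<and>
    (\<forall>L\<in>proj_line. \<exists>!i. i \<in> {1..h} \<and> (\<exists>\<gamma>\<in>\<Gamma>. proj_act \<gamma> (c i) = L))"

section \<open>Functions on a product of upper half-planes\<close>

definition upper_half_space :: "(complex^'n) set"
  where "upper_half_space = {z. \<forall>j. Im (z $ j) > 0}"

definition Norm_Im :: "complex^'n \<Rightarrow> real"
  where "Norm_Im z = (\<Prod>j\<in>UNIV. Im (z $ j))"

definition aut_factor :: "('n \<Rightarrow> 'k \<Rightarrow> real) \<Rightarrow> 'k^2^2 \<Rightarrow> complex^'n \<Rightarrow> complex^'n"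
  where "aut_factor \<sigma> \<gamma> z =
    (\<chi> j. of_real (\<sigma> j (\<gamma> $ 2 $ 1)) * z $ j + of_real (\<sigma> j (\<gamma> $ 2 $ 2)))"

definition moebius_act :: "('n \<Rightarrow> 'k \<Rightarrow> real) \<Rightarrow> 'k^2^2 \<Rightarrow> complex^'n \<Rightarrow> complex^'n"
  where "moebius_act \<sigma> \<gamma> z =
    (\<chi> j. (of_real (\<sigma> j (\<gamma> $ 1 $ 1)) * z $ j + of_real (\<sigma> j (\<gamma> $ 1 $ 2))) /
          (of_real (\<sigma> j (\<gamma> $ 2 $ 1)) * z $ j + of_real (\<sigma> j (\<gamma> $ 2 $ 2))))"

definition unitary_char :: "int^'n \<Rightarrow> complex^'n \<Rightarrow> complex"
  where "unitary_char p w = (\<Prod>j\<in>UNIV. (w $ j / of_real (cmod (w $ j))) powi (p $ j))"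

definition slash ::
    "('n \<Rightarrow> 'k \<Rightarrow> real) \<Rightarrow> int^'n \<Rightarrow> 'k^2^2 \<Rightarrow> (complex^'n \<Rightarrow> complex) \<Rightarrow> complex^'n \<Rightarrow> complex"
  where "slash \<sigma> p \<gamma> f z =
    inverse (unitary_char p (aut_factor \<sigma> \<gamma> z)) * f (moebius_act \<sigma> \<gamma> z)"

definition partial_x :: "'n \<Rightarrow> (complex^'n \<Rightarrow> complex) \<Rightarrow> complex^'n \<Rightarrow> complex"
  where "partial_x j f z = vector_derivative (\<lambda>t::real. f (z + t *\<^sub>R axis j 1)) (at 0)"

definition partial_y :: "'n \<Rightarrow> (complex^'n \<Rightarrow> complex) \<Rightarrow> complex^'n \<Rightarrow> complex"
  where "partial_y j f z = vector_derivative (\<lambda>t::real. f (z + t *\<^sub>R axis j \<i>)) (at 0)"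

definition laplacian :: "'n \<Rightarrow> int \<Rightarrow> (complex^'n \<Rightarrow> complex) \<Rightarrow> complex^'n \<Rightarrow> complex"
  where "laplacian j k f z =
    - of_real ((Im (z $ j))\<^sup>2) * (partial_x j (partial_x j f) z + partial_y j (partial_y j f) z)
    + \<i> * of_int k * of_real (Im (z $ j)) * partial_x j f z"

text \<open>The filter \<open>Norm(y) \<rightarrow> \<infinity>\<close> on the product of upper half-planes: uniform in \<open>x\<close> and in all
  \<open>y\<close> with the given norm.\<close>

definition Norm_to_infinity :: "(complex^'n) filter"
  where "Norm_to_infinity = inf (filtercomap Norm_Im at_top) (principal upper_half_space)"

definition Pi_1 :: "complex set"
  where "Pi_1 = {s. Re s > 1}"

section \<open>Smoothness\<close>

text \<open>\<open>C_on k U f\<close> says that \<open>f\<close> is of class \<open>C\<^sup>k\<close> in the real sense; it is meant for open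
  subsets \<open>U\<close> of a finite-dimensional space. A function on an arbitrary set is smooth if it
  locally extends to a smooth function on an open set.\<close>

primrec C_on ::
    "nat \<Rightarrow> 'a::real_normed_vector set \<Rightarrow> ('a \<Rightarrow> 'b::real_normed_vector) \<Rightarrow> bool"
  where
    "C_on 0 U f \<longleftrightarrow> continuous_on U f"
  | "C_on (Suc k) U f \<longleftrightarrow> (\<forall>x\<in>U. f differentiable (at x)) \<and>
       (\<forall>v. C_on k U (\<lambda>x. frechet_derivative f (at x) v))"

definition smooth_on ::
    "'a::real_normed_vector set \<Rightarrow> ('a \<Rightarrow> 'b::real_normed_vector) \<Rightarrow> bool"
  where "smooth_on S f \<longleftrightarrow>
    (\<forall>x\<in>S. \<exists>U F. open U \<and> x \<in> U \<and> (\<forall>k. C_on k U F) \<and> (\<forall>y\<in>U \<inter> S. F y = f y))"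

end

theory Submission
  imports "Jordan_Normal_Form.Char_Poly" "HOL-Complex_Analysis.Conformal_Mappings" Defs
begin

text \<open>Let \<open>F\<close> be the difference of two such functions. For fixed \<open>s\<close> the function \<open>|F|\<close> is
  \<open>\<Gamma>\<close>-invariant and bounded near every cusp, hence bounded: if no vector \<open>(c, d)\<close> of integers
  makes the norm of \<open>(cz + d) / sqrt y\<close> small, the pigeonhole principle yields two
  \<open>K\<close>-independent vectors that are short at every place, their determinant lies in a finite set,
  and therefore \<open>z\<close> can be moved into a fixed compact set by \<open>SL\<^sub>2\<close> over the integers.

  In a single variable \<open>z\<^sub>j\<close> the function \<open>u = |F|\<^sup>2\<close> satisfies
  \<open>y\<^sup>2 (u\<^sub>x\<^sub>x + u\<^sub>y\<^sub>y) \<ge> 2 u\<close> as soon as \<open>Re (s (s - 1)) \<ge> 1 + p\<^sub>j\<^sup>2 / 4\<close>. Comparing the bounded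
  function \<open>u\<close> with multiples of \<open>(1 + |z\<^sub>j|\<^sup>2) / (2 y\<^sub>j)\<close>, for which equality holds, gives \<open>F = 0\<close> for
  these \<open>s\<close>. The remaining \<open>s\<close> follow by analytic continuation; here \<open>F\<close> may really be nonzero
  at individual \<open>s\<close> a priori, because holomorphic cusp forms give eigenfunctions with
  \<open>s = p\<^sub>j / 2\<close>.\<close>

text \<open>The cusp condition enters only through boundedness: the terms \<open>A i s\<close>
  cancel in F, and Norm(y)^(1-s) stays bounded because Re s > 1. In the variable z_j the equation
  reads y^2 (F_xx + F_yy) = i p_j y F_x - s (1 - s) F, and the Laplacian of u also produces 2 |grad
  F|^2. The first-order term has no sign; completing a square trades it against the gradient at the
  cost of p_j^2 / 2 times u, which is the origin of p_j^2 / 4. Freezing the other variables destroys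
  the action of \<Gamma>, so no compact quotient is left on which u could attain a maximum; the
  barrier restores compactness, since it is unbounded towards every end of the half-plane while u is
  bounded. The other obstacle is \<open>T\<close>. It is discrete in itself but may accumulate at
  points of \<open>Pi_1\<close> outside \<open>T\<close>, so the parameter domain need not be open.
  What survives is that \<open>T\<close> is countable: the domain is still dense in
  \<open>Pi_1\<close> and connected, and the local extensions in the definition of smoothness supply
  the open sets that continuation requires.\<close>

no_notation Matrix.vec_index (infixl "$" 100)

section \<open>Algebraic integers form a ring\<close>

text \<open>The vector of the \<open>f i\<close> is an eigenvector of the integer matrix
  \<open>N\<close>, so \<open>x\<close> is a root of its characteristic polynomial, which is monic
  with integer coefficients.\<close>

lemma algebraic_int_eigenvalue:
  fixes f :: "nat \<Rightarrow> 'a::field_char_0" and N :: "nat \<Rightarrow> nat \<Rightarrow> int"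
  assumes x: "\<And>i. i < n \<Longrightarrow> x * f i = (\<Sum>k<n. of_int (N i k) * f k)"
    and nz: "i0 < n" "f i0 \<noteq> 0"
  shows "algebraic_int x"
proof -
  define A where "A = Matrix.mat n n (\<lambda>(i, k). N i k)"
  have A: "A \<in> carrier_mat n n" by (simp add: A_def)
  let ?A = "map_mat of_int A :: 'a mat"
  have A': "?A \<in> carrier_mat n n" using A by simp
  define v where "v = Matrix.vec n f"
  have v: "v \<in> carrier_vec n" by (simp add: v_def)
  have "Matrix.vec_index v i0 \<noteq> 0" using nz by (simp add: v_def)
  then have "v \<noteq> 0\<^sub>v n" using nz by auto
  moreover have "?A *\<^sub>v v = x \<cdot>\<^sub>v v"
    using A by (intro eq_vecI) (auto simp: v_def A_def scalar_prod_def x atLeast0LessThan)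
  ultimately have "eigenvector ?A v x"
    using v A by (simp add: eigenvector_def)
  then have "eigenvalue ?A x" by (auto simp: eigenvalue_def)
  then have "poly (char_poly ?A) x = 0"
    using eigenvalue_root_char_poly[OF A'] by simp
  then have "poly (map_poly of_int (char_poly A)) x = 0"
    using of_int_hom.char_poly_hom[OF A, where 'a='a] by simp
  moreover have "lead_coeff (char_poly A) = 1"
    using degree_monic_char_poly[OF A] by simp
  ultimately show ?thesis by (auto simp: algebraic_int_altdef_ipoly)
qed

text \<open>Multiplication by \<open>x\<close> preserves the \<int>-module spanned by the family.
  Quantifying over the matrix makes the property pass to sums and products without any relations
  among the \<open>f i\<close>.\<close>

definition int_stable :: "'i set \<Rightarrow> ('i \<Rightarrow> 'a::field_char_0) \<Rightarrow> 'a \<Rightarrow> bool"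
  where "int_stable I f x \<longleftrightarrow>
    (\<exists>N. \<forall>i\<in>I. x * f i = (\<Sum>k\<in>I. of_int (N i k) * f k))"

lemma int_stable_imp_algebraic_int:
  fixes f :: "'i \<Rightarrow> 'a::field_char_0"
  assumes "finite I" and st: "int_stable I f x" and nz: "i0 \<in> I" "f i0 \<noteq> 0"
  shows "algebraic_int x"
proof -
  obtain N where N: "\<And>i. i \<in> I \<Longrightarrow> x * f i = (\<Sum>k\<in>I. of_int (N i k) * f k)"
    using st by (auto simp: int_stable_def)
  obtain e where e: "bij_betw e {..<card I} I"
    using ex_bij_betw_nat_finite[OF \<open>finite I\<close>] by (auto simp: atLeast0LessThan)
  obtain j where j: "j < card I" "e j = i0"
    using e nz by (metis bij_betw_imp_surj_on imageE lessThan_iff)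
  show ?thesis
  proof (rule algebraic_int_eigenvalue[where f="f \<circ> e" and N="\<lambda>i k. N (e i) (e k)"])
    fix i assume "i < card I"
    then have "e i \<in> I" using e by (auto simp: bij_betw_def)
    then have "x * f (e i) = (\<Sum>k\<in>I. of_int (N (e i) k) * f k)" by (rule N)
    also have "\<dots> = (\<Sum>k<card I. of_int (N (e i) (e k)) * f (e k))"
      by (rule sum.reindex_bij_betw[OF e, symmetric])
    finally show "x * (f \<circ> e) i = (\<Sum>k<card I. of_int (N (e i) (e k)) * (f \<circ> e) k)" by simp
  qed (use j nz in auto)
qed

lemma int_stable_add:
  assumes "int_stable I f x" "int_stable I f y"
  shows "int_stable I f (x + y)"
proof -
  obtain N M where "\<forall>i\<in>I. x * f i = (\<Sum>k\<in>I. of_int (N i k) * f k)"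
    "\<forall>i\<in>I. y * f i = (\<Sum>k\<in>I. of_int (M i k) * f k)"
    using assms by (auto simp: int_stable_def)
  then have "\<forall>i\<in>I. (x + y) * f i = (\<Sum>k\<in>I. of_int (N i k + M i k) * f k)"
    by (simp add: distrib_right sum.distrib)
  then show ?thesis
    unfolding int_stable_def by (intro exI[of _ "\<lambda>i k. N i k + M i k"])
qed

lemma int_stable_mult:
  assumes "int_stable I f x" "int_stable I f y"
  shows "int_stable I f (x * y)"
proof -
  obtain N M where N: "\<forall>i\<in>I. x * f i = (\<Sum>k\<in>I. of_int (N i k) * f k)"
    and M: "\<forall>i\<in>I. y * f i = (\<Sum>k\<in>I. of_int (M i k) * f k)"
    using assms by (auto simp: int_stable_def)
  have "x * y * f i = (\<Sum>l\<in>I. of_int (\<Sum>k\<in>I. M i k * N k l) * f l)" if "i \<in> I" for i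
  proof -
    have "x * y * f i = (\<Sum>k\<in>I. of_int (M i k) * (x * f k))"
      using M that by (simp add: mult.assoc sum_distrib_left mult.left_commute)
    also have "\<dots> = (\<Sum>k\<in>I. \<Sum>l\<in>I. of_int (M i k * N k l) * f l)"
      using N by (intro sum.cong) (auto simp: sum_distrib_left mult.assoc)
    also have "\<dots> = (\<Sum>l\<in>I. of_int (\<Sum>k\<in>I. M i k * N k l) * f l)"
      by (subst sum.swap) (simp add: sum_distrib_right)
    finally show ?thesis .
  qed
  then show ?thesis
    unfolding int_stable_def by (intro exI[of _ "\<lambda>i l. \<Sum>k\<in>I. M i k * N k l"]) blast
qed

lemma algebraic_int_imp_power_relation:
  fixes x :: "'a::field_char_0"
  assumes "algebraic_int x"
  obtains n a where "n > 0" "x ^ n = (\<Sum>i<n. of_int (a i) * x ^ i)"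
proof -
  obtain p where p: "poly (map_poly of_int p) x = 0" "lead_coeff p = 1"
    using assms by (auto simp: algebraic_int_altdef_ipoly)
  define n where "n = degree p"
  have "n > 0"
  proof (rule ccontr)
    assume "\<not> n > 0"
    then have "p = [:1:]" using p(2) by (metis degree_0_id gr0I n_def)
    then show False using p(1) by simp
  qed
  have "(\<Sum>i\<le>n. of_int (coeff p i) * x ^ i) = 0"
    using p(1) by (simp add: poly_altdef n_def coeff_map_poly)
  then have "(\<Sum>i<n. of_int (coeff p i) * x ^ i) + x ^ n = 0"
    using p(2) by (simp add: n_def lessThan_Suc_atMost[symmetric])
  then have "x ^ n = (\<Sum>i<n. of_int (- coeff p i) * x ^ i)"
    by (simp add: sum_negf eq_neg_iff_add_eq_0 add.commute)
  with \<open>n > 0\<close> show thesis by (rule that)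
qed

lemma int_stable_monomials_fst:
  fixes x y :: "'a::field_char_0"
  assumes n: "n > 0" "x ^ n = (\<Sum>i<n. of_int (a i) * x ^ i)"
  shows "int_stable ({..<n} \<times> {..<m}) (\<lambda>(i, j). x ^ i * y ^ j) x"
proof -
  \<comment> \<open>A companion matrix in the first exponent (a shift, with the top power rewritten
    by \<open>a\<close>) and the identity in the second.\<close>
  define N :: "nat \<times> nat \<Rightarrow> nat \<times> nat \<Rightarrow> int" where "N = (\<lambda>(i, j) (k, l).
    if l = j then (if Suc i < n then (if k = Suc i then 1 else 0) else a k) else 0)"
  have "x * (x ^ i * y ^ j) = (\<Sum>(k, l)\<in>{..<n} \<times> {..<m}. of_int (N (i, j) (k, l)) * (x ^ k * y ^ l))"
    if ij: "i < n" "j < m" for i j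
  proof -
    have "(\<Sum>(k, l)\<in>{..<n} \<times> {..<m}. of_int (N (i, j) (k, l)) * (x ^ k * y ^ l))
      = (\<Sum>k<n. \<Sum>l<m. if l = j then
          of_int (if Suc i < n then (if k = Suc i then 1 else 0) else a k) * (x ^ k * y ^ l) else 0)"
      unfolding sum.cartesian_product[symmetric] N_def by (intro sum.cong) auto
    also have "\<dots> = (\<Sum>k<n. of_int (if Suc i < n then (if k = Suc i then 1 else 0) else a k) * (x ^ k * y ^ j))"
      using ij by (simp add: sum.delta)
    also have "\<dots> = x ^ Suc i * y ^ j"
    proof (cases "Suc i < n")
      case True
      then have "(\<Sum>k<n. of_int (if Suc i < n then (if k = Suc i then 1 else 0) else a k) * (x ^ k * y ^ j))
        = (\<Sum>k<n. if k = Suc i then x ^ k * y ^ j else 0)"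
        by (intro sum.cong) auto
      then show ?thesis using True by (simp add: sum.delta)
    next
      case False
      then have "Suc i = n" using ij by simp
      then have "x ^ Suc i * y ^ j = (\<Sum>k<n. of_int (a k) * x ^ k) * y ^ j"
        using n(2) by metis
      then show ?thesis using False by (simp add: sum_distrib_right mult.assoc)
    qed
    finally show ?thesis by (simp add: mult.assoc)
  qed
  then show ?thesis
    unfolding int_stable_def by (intro exI[of _ N]) (auto simp: case_prod_unfold)
qed

lemma int_stable_monomials_snd:
  fixes x y :: "'a::field_char_0"
  assumes m: "m > 0" "y ^ m = (\<Sum>i<m. of_int (a i) * y ^ i)"
  shows "int_stable ({..<n} \<times> {..<m}) (\<lambda>(i, j). x ^ i * y ^ j) y"
proof -
  obtain N where N: "\<forall>i\<in>{..<m} \<times> {..<n}. y * (case i of (i, j) \<Rightarrow> y ^ i * x ^ j)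
      = (\<Sum>k\<in>{..<m} \<times> {..<n}. of_int (N i k) * (case k of (i, j) \<Rightarrow> y ^ i * x ^ j))"
    using int_stable_monomials_fst[OF m, of n x] unfolding int_stable_def by blast
  have bij: "bij_betw prod.swap ({..<n} \<times> {..<m}) ({..<m} \<times> {..<n})"
    by (auto simp: bij_betw_def inj_on_def)
  have "y * (x ^ i * y ^ j) = (\<Sum>k\<in>{..<n} \<times> {..<m}.
      of_int (N (j, i) (prod.swap k)) * (case k of (i, j) \<Rightarrow> x ^ i * y ^ j))"
    if "i < n" "j < m" for i j
  proof -
    have "y * (x ^ i * y ^ j) = (\<Sum>k\<in>{..<m} \<times> {..<n}.
        of_int (N (j, i) k) * (case k of (i, j) \<Rightarrow> y ^ i * x ^ j))"
      using bspec[OF N, of "(j, i)"] that by (simp add: mult.commute)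
    also have "\<dots> = (\<Sum>k\<in>{..<n} \<times> {..<m}.
        of_int (N (j, i) (prod.swap k)) * (case prod.swap k of (i, j) \<Rightarrow> y ^ i * x ^ j))"
      by (rule sum.reindex_bij_betw[OF bij, symmetric])
    finally show ?thesis by (simp add: case_prod_unfold mult.commute)
  qed
  then show ?thesis
    unfolding int_stable_def
    by (intro exI[of _ "\<lambda>i k. N (prod.swap i) (prod.swap k)"]) auto
qed

text \<open>The monomials in both elements form one family that each of them stabilises, so
  \<open>int_stable_add\<close> and \<open>int_stable_mult\<close> apply to the pair. Positivity of
  \<open>n\<close> and \<open>m\<close> keeps the monomial 1 in the family, which is the nonzero
  entry an eigenvector must have.\<close>

lemma algebraic_int_common_stable:
  fixes x y :: "'a::field_char_0"
  assumes "algebraic_int x" "algebraic_int y"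
  obtains n m where "n > 0" "m > 0"
    "int_stable ({..<n} \<times> {..<m}) (\<lambda>(i, j). x ^ i * y ^ j) x"
    "int_stable ({..<n} \<times> {..<m}) (\<lambda>(i, j). x ^ i * y ^ j) y"
proof -
  obtain n a where n: "n > 0" "x ^ n = (\<Sum>i<n. of_int (a i) * x ^ i)"
    using algebraic_int_imp_power_relation[OF assms(1)] .
  obtain m b where m: "m > 0" "y ^ m = (\<Sum>i<m. of_int (b i) * y ^ i)"
    using algebraic_int_imp_power_relation[OF assms(2)] .
  show thesis
    using that[OF n(1) m(1) int_stable_monomials_fst[OF n] int_stable_monomials_snd[OF m]] .
qed

lemma
  fixes x y :: "'a::field_char_0"
  assumes "algebraic_int x" "algebraic_int y"
  shows algebraic_int_plus: "algebraic_int (x + y)"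
    and algebraic_int_times: "algebraic_int (x * y)"
proof -
  obtain n m where nm: "n > 0" "m > 0"
    and x: "int_stable ({..<n} \<times> {..<m}) (\<lambda>(i, j). x ^ i * y ^ j) x"
    and y: "int_stable ({..<n} \<times> {..<m}) (\<lambda>(i, j). x ^ i * y ^ j) y"
    using algebraic_int_common_stable[OF assms] .
  show "algebraic_int (x + y)"
    by (rule int_stable_imp_algebraic_int[OF _ int_stable_add[OF x y], of "(0, 0)"])
      (use nm in auto)
  show "algebraic_int (x * y)"
    by (rule int_stable_imp_algebraic_int[OF _ int_stable_mult[OF x y], of "(0, 0)"])
      (use nm in auto)
qed

lemma algebraic_int_diff:
  fixes x y :: "'a::field_char_0"
  shows "algebraic_int x \<Longrightarrow> algebraic_int y \<Longrightarrow> algebraic_int (x - y)"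
  using algebraic_int_plus[of x "- y"] by auto

lemma algebraic_int_sum:
  fixes f :: "'i \<Rightarrow> 'a::field_char_0"
  shows "(\<And>i. i \<in> I \<Longrightarrow> algebraic_int (f i)) \<Longrightarrow> algebraic_int (\<Sum>i\<in>I. f i)"
  by (induction I rule: infinite_finite_induct) (auto intro: algebraic_int_plus)

lemma algebraic_int_prod:
  fixes f :: "'i \<Rightarrow> 'a::field_char_0"
  shows "(\<And>i. i \<in> I \<Longrightarrow> algebraic_int (f i)) \<Longrightarrow> algebraic_int (\<Prod>i\<in>I. f i)"
  by (induction I rule: infinite_finite_induct)
    (auto intro: algebraic_int_times int_imp_algebraic_int)

section \<open>Lattices in totally real fields\<close>

lemma rat_quotient:
  fixes q :: rat
  obtains a b :: int where "q = of_int a / of_int b" "b > 0"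
proof (cases "quotient_of q")
  case (Pair a b)
  then show thesis using that quotient_of_div quotient_of_denom_pos by blast
qed

lemma rat_common_denominator:
  assumes "finite (Q :: rat set)"
  obtains m :: nat where "m > 0" "\<And>q. q \<in> Q \<Longrightarrow> of_nat m * q \<in> \<int>"
proof -
  have "\<exists>m::nat. m > 0 \<and> (\<forall>q\<in>Q. of_nat m * q \<in> \<int>)"
    using assms
  proof (induction Q rule: finite_induct)
    case empty
    show ?case by (intro exI[of _ 1]) simp
  next
    case (insert x Q)
    then obtain m :: nat where m: "m > 0" "\<forall>q\<in>Q. of_nat m * q \<in> \<int>" by blast
    obtain a b where x: "x = of_int a / of_int b" "b > 0" by (rule rat_quotient)
    have "of_nat (m * nat b) * x = of_int (int m * a)"
      using x by simp
    then have "of_nat (m * nat b) * x \<in> \<int>" by (metis Ints_of_int)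
    moreover have "of_nat (m * nat b) * q \<in> \<int>" if "q \<in> Q" for q
    proof -
      have "of_nat (m * nat b) * q = of_int b * (of_nat m * q)" using x(2) by simp
      then show ?thesis using m(2) that by (metis Ints_mult Ints_of_int)
    qed
    ultimately show ?case
      using m(1) x(2) by (intro exI[of _ "m * nat b"]) auto
  qed
  then show thesis using that by blast
qed

lemma algebraic_int_of_nat: "algebraic_int (of_nat n :: 'a::field_char_0)"
  by (rule int_imp_algebraic_int) simp

lemma algebraic_int_of_int: "algebraic_int (of_int n :: 'a::field_char_0)"
  by (rule int_imp_algebraic_int) simp

text \<open>Multiplication by \<open>x\<close> has a rational matrix with respect to
  \<open>b\<close>; a common denominator \<open>m\<close> of its entries makes the matrix of
  \<open>of_nat m * x\<close> integral.\<close>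

lemma ex_multiple_algebraic_int:
  fixes b :: "'n::finite \<Rightarrow> 'k::field_char_0" and x :: 'k
  assumes span: "\<And>x. \<exists>q :: 'n \<Rightarrow> rat. x = (\<Sum>i\<in>UNIV. of_rat (q i) * b i)"
  obtains m :: nat where "m > 0" "algebraic_int (of_nat m * x)"
proof -
  have "\<exists>A :: 'n \<Rightarrow> 'n \<Rightarrow> rat. \<forall>i. x * b i = (\<Sum>k\<in>UNIV. of_rat (A i k) * b k)"
    using span by (intro choice allI)
  then obtain A :: "'n \<Rightarrow> 'n \<Rightarrow> rat"
    where A: "\<And>i. x * b i = (\<Sum>k\<in>UNIV. of_rat (A i k) * b k)" by blast
  obtain m :: nat where m: "m > 0"
    "\<And>q. q \<in> (\<lambda>(i, k). A i k) ` UNIV \<Longrightarrow> of_nat m * q \<in> \<int>"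
    using rat_common_denominator[of "(\<lambda>(i, k). A i k) ` UNIV"] by (metis finite finite_imageI)
  have "\<forall>i k. \<exists>c. of_nat m * A i k = of_int c"
    using m(2) by (auto simp: image_iff elim: Ints_cases)
  then obtain N where N: "\<And>i k. of_nat m * A i k = of_int (N i k)" by metis
  have N': "of_nat m * of_rat (A i k) = (of_int (N i k) :: 'k)" for i k
    by (metis N of_rat_mult of_rat_of_int_eq of_rat_of_nat_eq)
  have "of_nat m * x * b i = (\<Sum>k\<in>UNIV. of_int (N i k) * b k)" for i
    by (simp add: mult.assoc A sum_distrib_left N'[symmetric])
  then have st: "int_stable UNIV b (of_nat m * x)" unfolding int_stable_def by blast
  obtain i where i: "b i \<noteq> 0"
  proof (rule ccontr)
    assume "\<not> thesis"
    then have "\<And>i. b i = 0" using that by blast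
    then show False using span[of 1] by simp
  qed
  show thesis
    using that[OF m(1) int_stable_imp_algebraic_int[OF _ st _ i]] by simp
qed

text \<open>A \<rat>-basis is rescaled entry by entry, so its \<int>-span is in general smaller than
  the ring of integers. Indexing it by the type that also indexes the embeddings makes the embedding
  matrix square.\<close>

lemma number_field_integral_basis:
  assumes "number_field TYPE('k::field_char_0)" "field_degree TYPE('k::field_char_0) = CARD('n::finite)"
  obtains b :: "'n::finite \<Rightarrow> 'k::field_char_0" where
    "\<And>x. \<exists>q :: 'n::finite \<Rightarrow> rat. x = (\<Sum>i\<in>UNIV. of_rat (q i) * b i)"
    "\<And>i. algebraic_int (b i)"
proof -
  obtain S :: "'k set" where S: "finite S" "rat_vs.span S = UNIV"
    using assms(1) unfolding number_field_def by blast
  obtain B :: "'k set" where B: "rat_vs.independent B" "rat_vs.span B = UNIV"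
    "card B = rat_vs.dim (UNIV :: 'k set)"
    using rat_vs.basis_exists[of "UNIV :: 'k set"] by (metis top.extremum_uniqueI)
  have "finite B"
    using rat_vs.independent_span_bound[OF S(1) B(1)] S(2) by simp
  have "card B = card (UNIV :: 'n set)"
    using assms(2) B(3) by (simp add: field_degree_def)
  then obtain b0 where b0: "bij_betw b0 (UNIV :: 'n set) B"
    using \<open>finite B\<close> by (metis finite finite_same_card_bij)
  have span0: "\<exists>q :: 'n \<Rightarrow> rat. x = (\<Sum>i\<in>UNIV. of_rat (q i) * b0 i)" for x
  proof -
    obtain u where u: "x = (\<Sum>v\<in>B. rat_scale (u v) v)"
      using rat_vs.span_finite[OF \<open>finite B\<close>] B(2) by auto
    also have "\<dots> = (\<Sum>i\<in>UNIV. rat_scale (u (b0 i)) (b0 i))"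
      by (rule sum.reindex_bij_betw[OF b0, symmetric])
    finally show ?thesis
      by (intro exI[of _ "\<lambda>i. u (b0 i)"]) (simp add: rat_scale_def)
  qed
  have "\<forall>i. \<exists>m::nat. m > 0 \<and> algebraic_int (of_nat m * b0 i)"
    using ex_multiple_algebraic_int[OF span0] by metis
  then obtain m :: "'n \<Rightarrow> nat" where m: "\<And>i. m i > 0" "\<And>i. algebraic_int (of_nat (m i) * b0 i)"
    by metis
  show thesis
  proof (rule that[of "\<lambda>i. of_nat (m i) * b0 i"])
    fix x
    obtain q where q: "x = (\<Sum>i\<in>UNIV. of_rat (q i) * b0 i)" using span0 by blast
    show "\<exists>q :: 'n \<Rightarrow> rat. x = (\<Sum>i\<in>UNIV. of_rat (q i) * (of_nat (m i) * b0 i))"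
      by (intro exI[of _ "\<lambda>i. q i / of_nat (m i)"])
        (use m(1) in \<open>simp add: q of_rat_divide less_imp_neq[symmetric]\<close>)
  qed (rule m(2))
qed

text \<open>Artin's argument: the relation at \<open>y * x\<close> minus \<open>\<sigma> i y\<close>
  times the relation at \<open>x\<close> eliminates the embedding \<open>i\<close> and multiplies
  each other coefficient by \<open>\<sigma> j y - \<sigma> i y\<close>, nonzero for a suitable
  \<open>y\<close>.\<close>

lemma dedekind_independence:
  fixes \<sigma> :: "'j \<Rightarrow> 'k::field \<Rightarrow> 'a::field"
  assumes emb: "\<And>j. j \<in> J \<Longrightarrow> field_embedding (\<sigma> j)" and "inj_on \<sigma> J" "finite J"
    and "\<And>x. (\<Sum>j\<in>J. r j * \<sigma> j x) = 0" and "j \<in> J"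
  shows "r j = 0"
  using \<open>finite J\<close> assms(1,2,4,5)
proof (induction J arbitrary: r j rule: finite_induct)
  case empty
  then show ?case by simp
next
  case (insert i J)
  have *: "r j = 0" if "j \<in> J" for j
  proof -
    have "\<sigma> j \<noteq> \<sigma> i" using insert.prems(2) insert.hyps(2) that by (auto simp: inj_on_def)
    then obtain y where y: "\<sigma> j y \<noteq> \<sigma> i y" by auto
    have "(\<Sum>j\<in>J. (r j * (\<sigma> j y - \<sigma> i y)) * \<sigma> j x) = 0" for x
    proof -
      have "(\<Sum>j\<in>insert i J. (r j * (\<sigma> j y - \<sigma> i y)) * \<sigma> j x)
        = (\<Sum>j\<in>insert i J. r j * \<sigma> j (y * x) - \<sigma> i y * (r j * \<sigma> j x))"
        using insert.prems(1) by (intro sum.cong) (auto simp: field_embedding_def algebra_simps)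
      also have "\<dots> = (\<Sum>j\<in>insert i J. r j * \<sigma> j (y * x)) - \<sigma> i y * (\<Sum>j\<in>insert i J. r j * \<sigma> j x)"
        by (simp only: sum_subtractf sum_distrib_left)
      also have "\<dots> = 0" by (simp only: insert.prems(3)) simp
      finally show ?thesis using insert.hyps by simp
    qed
    then have "r j * (\<sigma> j y - \<sigma> i y) = 0"
      using insert.IH[of "\<lambda>j. r j * (\<sigma> j y - \<sigma> i y)" j] insert.prems(1,2) that
      by (metis inj_on_insert insertI2)
    then show ?thesis using y by simp
  qed
  then have "r i * \<sigma> i 1 = 0"
    using insert.prems(3)[of 1] insert.hyps by simp
  then have "r i = 0" using insert.prems(1)[of i] by (simp add: field_embedding_def)
  then show ?case using * insert.prems(4) by blast
qed

section \<open>Algebra of field embeddings\<close>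

lemma field_embedding_simps:
  fixes \<tau> :: "'k::field_char_0 \<Rightarrow> 'a::field_char_0"
  assumes "field_embedding \<tau>"
  shows "\<tau> 0 = 0" "\<tau> 1 = 1" "\<tau> (x + y) = \<tau> x + \<tau> y" "\<tau> (x * y) = \<tau> x * \<tau> y"
    "\<tau> (- x) = - \<tau> x" "\<tau> (x - y) = \<tau> x - \<tau> y" "\<tau> (of_nat n) = of_nat n"
    "\<tau> (of_int k) = of_int k" "\<tau> (of_rat q) = of_rat q" "\<tau> x = 0 \<longleftrightarrow> x = 0"
    "\<tau> (x ^ n) = \<tau> x ^ n"
proof -
  show one: "\<tau> 1 = 1" and add: "\<tau> (x + y) = \<tau> x + \<tau> y" and mult: "\<tau> (x * y) = \<tau> x * \<tau> y" for x y
    using assms by (auto simp: field_embedding_def)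
  show z: "\<tau> 0 = 0" using add[of 0 0] by simp
  show neg: "\<tau> (- x) = - \<tau> x" for x
    using add[of x "- x"] z by (simp add: eq_neg_iff_add_eq_0 add.commute)
  show diff: "\<tau> (x - y) = \<tau> x - \<tau> y" for x y using add[of x "- y"] neg[of y] by simp
  show nat: "\<tau> (of_nat n) = of_nat n" for n by (induction n) (simp_all add: z one add)
  show int: "\<tau> (of_int k) = of_int k" for k 
  proof -
    have "(of_int k :: 'k) = of_nat (nat k) - of_nat (nat (- k))"
      "(of_int k :: 'a) = of_nat (nat k) - of_nat (nat (- k))"
      by (cases "k \<ge> 0"; simp)+
    then show ?thesis by (simp add: diff nat)
  qed
  show iff: "\<tau> x = 0 \<longleftrightarrow> x = 0" for x
  proof (cases "x = 0")
    case False
    then have "\<tau> x * \<tau> (inverse x) = 1" using mult[of x "inverse x"] one by simp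
    then show ?thesis using False by auto
  qed (simp add: z)
  show "\<tau> (x ^ n) = \<tau> x ^ n" by (induction n) (simp_all add: one mult)
  show "\<tau> (of_rat q) = of_rat q"
  proof -
    obtain a b where q: "q = of_int a / of_int b" "b > 0" by (rule rat_quotient)
    have k: "of_int b * of_rat q = (of_int a :: 'k)" and a: "of_int b * of_rat q = (of_int a :: 'a)"
      using q by (simp_all add: of_rat_divide)
    have "of_int b * \<tau> (of_rat q) = of_int b * of_rat q"
      using arg_cong[OF k, of \<tau>] by (simp only: mult int a)
    then show ?thesis using q(2) by simp
  qed
qed

lemma field_embedding_sum:
  fixes \<tau> :: "'k::field_char_0 \<Rightarrow> 'a::field_char_0"
  assumes "field_embedding \<tau>"
  shows "\<tau> (\<Sum>i\<in>I. f i) = (\<Sum>i\<in>I. \<tau> (f i))"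
  by (induction I rule: infinite_finite_induct) (simp_all add: field_embedding_simps[OF assms])

lemma field_embedding_algebraic_int:
  fixes \<tau> :: "'k::field_char_0 \<Rightarrow> 'a::field_char_0"
  assumes "field_embedding \<tau>" "algebraic_int x"
  shows "algebraic_int (\<tau> x)"
proof -
  obtain p where p: "poly (map_poly of_int p) x = 0" "lead_coeff p = 1"
    using assms(2) by (auto simp: algebraic_int_altdef_ipoly)
  have "poly (map_poly of_int p) (\<tau> x) = \<tau> (poly (map_poly of_int p) x)"
    by (simp add: poly_altdef coeff_map_poly field_embedding_sum[OF assms(1)]
        field_embedding_simps[OF assms(1)])
  then show ?thesis
    using p field_embedding_simps(1)[OF assms(1)] by (auto simp: algebraic_int_altdef_ipoly)
qed

locale totally_real_basis =
  fixes \<sigma> :: "'n::finite \<Rightarrow> 'k::field_char_0 \<Rightarrow> real" and b :: "'n \<Rightarrow> 'k"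
  assumes emb: "field_embedding (\<sigma> j)"
    and inj_\<sigma>: "inj \<sigma>"
    and span: "\<exists>q :: 'n \<Rightarrow> rat. x = (\<Sum>i\<in>UNIV. of_rat (q i) * b i)"
    and b_int: "algebraic_int (b i)"
begin

lemmas \<sigma>_simps [simp] = field_embedding_simps[OF emb]
lemmas \<sigma>_sum = field_embedding_sum[OF emb]

definition emb_mat :: "real^'n^'n"
  where "emb_mat = (\<chi> i j. \<sigma> j (b i))"

text \<open>A kernel vector is a linear relation between the embeddings on the \<open>b i\<close>,
  hence by \<rat>-linearity on the whole field, and distinct embeddings are independent.\<close>

lemma invertible_emb_mat: "invertible emb_mat"
proof -
  have "v = 0" if "emb_mat *v v = 0" for v
  proof -
    have *: "(\<Sum>j\<in>UNIV. v $ j * \<sigma> j (b i)) = 0" for i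
      using that by (simp add: emb_mat_def matrix_vector_mult_def vec_eq_iff mult.commute)
    have "(\<Sum>j\<in>UNIV. v $ j * \<sigma> j x) = 0" for x
    proof -
      obtain q where q: "x = (\<Sum>i\<in>UNIV. of_rat (q i) * b i)" using span by blast
      have "(\<Sum>j\<in>UNIV. v $ j * \<sigma> j x) = (\<Sum>j\<in>UNIV. \<Sum>i\<in>UNIV. of_rat (q i) * (v $ j * \<sigma> j (b i)))"
        by (simp add: q \<sigma>_sum sum_distrib_left mult.left_commute)
      also have "\<dots> = (\<Sum>i\<in>UNIV. of_rat (q i) * (\<Sum>j\<in>UNIV. v $ j * \<sigma> j (b i)))"
        by (subst sum.swap) (simp add: sum_distrib_left)
      finally show ?thesis by (simp add: *)
    qed
    then have "v $ j = 0" for j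
      by (intro dedekind_independence[OF emb inj_\<sigma> finite _ UNIV_I, of "\<lambda>j. v $ j"])
    then show ?thesis by (simp add: vec_eq_iff)
  qed
  then show ?thesis
    using matrix_left_invertible_ker[of emb_mat] invertible_left_inverse by blast
qed

text \<open>This product is the field norm. The embedding matrix diagonalises multiplication by
  \<open>x\<close>, so the product of the conjugates is the determinant of the rational matrix of
  that map.\<close>

lemma prod_\<sigma>_rational: "(\<Prod>j\<in>UNIV. \<sigma> j x) \<in> \<rat>"
proof -
  have "\<exists>A :: 'n \<Rightarrow> 'n \<Rightarrow> rat. \<forall>i. x * b i = (\<Sum>k\<in>UNIV. of_rat (A i k) * b k)"
    using span by (intro choice allI)
  then obtain A :: "'n \<Rightarrow> 'n \<Rightarrow> rat"
    where A: "\<And>i. x * b i = (\<Sum>k\<in>UNIV. of_rat (A i k) * b k)" by blast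
  define AM :: "real^'n^'n" where "AM = (\<chi> i k. of_rat (A i k))"
  define DM :: "real^'n^'n" where "DM = (\<chi> i j. if i = j then \<sigma> j x else 0)"
  have "(emb_mat ** DM) $ i $ j = (AM ** emb_mat) $ i $ j" for i j
  proof -
    have "(emb_mat ** DM) $ i $ j = \<sigma> j (x * b i)"
      by (simp add: matrix_matrix_mult_def emb_mat_def DM_def if_distrib[of "\<lambda>t. _ * t"] cong: if_cong)
    then show ?thesis
      by (simp add: A \<sigma>_sum matrix_matrix_mult_def emb_mat_def AM_def del: \<sigma>_simps(4))
         (simp add: mult.commute)
  qed
  then have "emb_mat ** DM = AM ** emb_mat" by (simp add: vec_eq_iff)
  then have "det emb_mat * det DM = det AM * det emb_mat" by (metis det_mul)
  moreover have "det emb_mat \<noteq> 0" using invertible_emb_mat invertible_det_nz by blast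
  ultimately have "det DM = det AM" by simp
  moreover have "det DM = (\<Prod>j\<in>UNIV. \<sigma> j x)"
    by (subst det_diagonal) (auto simp: DM_def)
  moreover have "det AM \<in> \<rat>"
    unfolding det_def AM_def by (intro Rats_sum Rats_mult Rats_prod) auto
  ultimately show ?thesis by simp
qed

text \<open>The norm is rational and an algebraic integer, hence an integer, and it is nonzero. In
  \<open>Norm_Im_ge_of_small_form\<close> this bounds the multiplier \<open>\<mu>\<close> of a
  cusp.\<close>

lemma prod_\<sigma>_ge_1:
  assumes "algebraic_int x" "x \<noteq> 0"
  shows "(\<Prod>j\<in>UNIV. \<bar>\<sigma> j x\<bar>) \<ge> 1"
proof -
  have "algebraic_int (\<Prod>j\<in>UNIV. \<sigma> j x)"
    using field_embedding_algebraic_int[OF emb assms(1)] by (rule algebraic_int_prod)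
  then have "(\<Prod>j\<in>UNIV. \<sigma> j x) \<in> \<int>"
    using prod_\<sigma>_rational by (rule rational_algebraic_int_is_int)
  then have "\<bar>\<Prod>j\<in>UNIV. \<sigma> j x\<bar> \<ge> 1"
    using assms(2) by (intro Ints_nonzero_abs_ge1) simp_all
  then show ?thesis by (simp add: abs_prod)
qed

definition lattice :: "'k set"
  where "lattice = range (\<lambda>k :: 'n \<Rightarrow> int. \<Sum>i\<in>UNIV. of_int (k i) * b i)"

lemma lattice_algebraic_int: "x \<in> lattice \<Longrightarrow> algebraic_int x"
  by (auto simp: lattice_def intro!: algebraic_int_sum algebraic_int_times b_int algebraic_int_of_int)

lemma lattice_diff:
  assumes "x \<in> lattice" "y \<in> lattice"
  shows "x - y \<in> lattice"
proof -
  obtain k l where "x = (\<Sum>i\<in>UNIV. of_int (k i) * b i)" "y = (\<Sum>i\<in>UNIV. of_int (l i) * b i)"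
    using assms by (auto simp: lattice_def)
  then have "x - y = (\<Sum>i\<in>UNIV. of_int (k i - l i) * b i)"
    by (simp add: left_diff_distrib sum_subtractf)
  then show ?thesis unfolding lattice_def by (rule range_eqI[of _ _ "\<lambda>i. k i - l i"])
qed

text \<open>The inverse of the embedding matrix recovers the coordinates. The bound is homogeneous
  in \<open>B\<close>, so it yields finiteness of bounded parts of the lattice and, with
  \<open>B = 0\<close>, injectivity of the coordinates.\<close>

lemma coordinates_bounded:
  obtains C where "C > 0"
    "\<forall>(q :: 'n \<Rightarrow> real) B i. (\<forall>j. \<bar>\<Sum>i\<in>UNIV. q i * \<sigma> j (b i)\<bar> \<le> B) \<longrightarrow> \<bar>q i\<bar> \<le> C * B"
proof -
  obtain V :: "real^'n^'n" where V: "emb_mat ** V = mat 1"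
    using invertible_emb_mat by (auto simp: invertible_def)
  define C where "C = 1 + (\<Sum>j\<in>UNIV. \<Sum>i\<in>UNIV. \<bar>V $ j $ i\<bar>)"
  have C: "C > 0" unfolding C_def by (intro add_pos_nonneg sum_nonneg) auto
  have "\<bar>q i\<bar> \<le> C * B" if B: "\<And>j. \<bar>\<Sum>i\<in>UNIV. q i * \<sigma> j (b i)\<bar> \<le> B" for q :: "'n \<Rightarrow> real" and B i
  proof -
    have B0: "B \<ge> 0" using B by (meson abs_ge_zero order_trans)
    have "(\<Sum>j\<in>UNIV. (\<Sum>l\<in>UNIV. q l * \<sigma> j (b l)) * V $ j $ i)
        = (\<Sum>l\<in>UNIV. q l * (\<Sum>j\<in>UNIV. \<sigma> j (b l) * V $ j $ i))"
      by (simp add: sum_distrib_left sum_distrib_right mult.assoc) (rule sum.swap)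
    also have "\<dots> = (\<Sum>l\<in>UNIV. q l * (emb_mat ** V) $ l $ i)"
      by (simp add: matrix_matrix_mult_def emb_mat_def)
    also have "\<dots> = q i" by (simp add: V mat_def if_distrib[of "\<lambda>t. _ * t"] cong: if_cong)
    finally have "\<bar>q i\<bar> = \<bar>\<Sum>j\<in>UNIV. (\<Sum>l\<in>UNIV. q l * \<sigma> j (b l)) * V $ j $ i\<bar>" by simp
    also have "\<dots> \<le> (\<Sum>j\<in>UNIV. \<bar>\<Sum>l\<in>UNIV. q l * \<sigma> j (b l)\<bar> * \<bar>V $ j $ i\<bar>)"
      by (rule order_trans[OF sum_abs]) (simp add: abs_mult)
    also have "\<dots> \<le> (\<Sum>j\<in>UNIV. B * (\<Sum>i\<in>UNIV. \<bar>V $ j $ i\<bar>))"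
      by (intro sum_mono mult_mono B member_le_sum B0) auto
    also have "\<dots> \<le> C * B"
      using B0 by (simp add: C_def sum_distrib_left[symmetric] algebra_simps)
    finally show ?thesis .
  qed
  then show thesis using that C by blast
qed

lemma \<sigma>_coordinates:
  "\<sigma> j (\<Sum>i\<in>UNIV. of_int (k i) * b i) = (\<Sum>i\<in>UNIV. of_int (k i) * \<sigma> j (b i))"
  by (simp add: \<sigma>_sum)

lemma finite_lattice_bounded:
  "finite {x \<in> lattice. \<forall>j. \<bar>\<sigma> j x\<bar> \<le> B}"
proof -
  obtain C where C: "C > 0" "\<forall>(q :: 'n \<Rightarrow> real) B i.
      (\<forall>j. \<bar>\<Sum>i\<in>UNIV. q i * \<sigma> j (b i)\<bar> \<le> B) \<longrightarrow> \<bar>q i\<bar> \<le> C * B"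
    by (rule coordinates_bounded)
  define S where "S = PiE (UNIV :: 'n set) (\<lambda>i. {-\<lceil>C * B\<rceil>..\<lceil>C * B\<rceil>})"
  have "{x \<in> lattice. \<forall>j. \<bar>\<sigma> j x\<bar> \<le> B} \<subseteq> (\<lambda>k. \<Sum>i\<in>UNIV. of_int (k i) * b i) ` S"
  proof safe
    fix x assume x: "x \<in> lattice" and bd: "\<forall>j. \<bar>\<sigma> j x\<bar> \<le> B"
    obtain k where k: "x = (\<Sum>i\<in>UNIV. of_int (k i) * b i)" using x by (auto simp: lattice_def)
    have "\<bar>real_of_int (k i)\<bar> \<le> C * B" for i
      using bd by (intro C(2)[rule_format]) (simp add: k \<sigma>_sum)
    then have "k i \<in> {-\<lceil>C * B\<rceil>..\<lceil>C * B\<rceil>}" for i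
      by (smt (verit) atLeastAtMost_iff le_of_int_ceiling of_int_le_iff of_int_minus)
    then have "k \<in> S" by (auto simp: S_def)
    then show "x \<in> (\<lambda>k. \<Sum>i\<in>UNIV. of_int (k i) * b i) ` S" using k by blast
  qed
  moreover have "finite S" unfolding S_def by (intro finite_PiE) auto
  ultimately show ?thesis by (meson finite_imageI finite_subset)
qed

lemma lattice_coordinates_inj:
  "inj (\<lambda>k :: 'n \<Rightarrow> int. \<Sum>i\<in>UNIV. of_int (k i) * b i)"
proof (rule injI)
  fix k l :: "'n \<Rightarrow> int"
  assume eq: "(\<Sum>i\<in>UNIV. of_int (k i) * b i) = (\<Sum>i\<in>UNIV. of_int (l i) * b i)"
  obtain C where C: "C > 0" "\<forall>(q :: 'n \<Rightarrow> real) B i.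
      (\<forall>j. \<bar>\<Sum>i\<in>UNIV. q i * \<sigma> j (b i)\<bar> \<le> B) \<longrightarrow> \<bar>q i\<bar> \<le> C * B"
    by (rule coordinates_bounded)
  have "(\<Sum>i\<in>UNIV. of_int (k i - l i) * \<sigma> j (b i)) = 0" for j
    using arg_cong[OF eq, of "\<sigma> j"] by (simp add: \<sigma>_sum left_diff_distrib sum_subtractf)
  then have "\<bar>real_of_int (k i - l i)\<bar> \<le> C * 0" for i
    by (intro C(2)[rule_format]) simp
  then show "k = l" by auto
qed

lemma ex_multiple_lattice:
  obtains m :: nat where "m > 0" "of_nat m * x \<in> lattice"
proof -
  obtain q :: "'n \<Rightarrow> rat" where q: "x = (\<Sum>i\<in>UNIV. of_rat (q i) * b i)" using span by blast
  obtain m :: nat where m: "m > 0" "\<And>c. c \<in> q ` UNIV \<Longrightarrow> of_nat m * c \<in> \<int>"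
    using rat_common_denominator[of "q ` UNIV"] by (metis finite finite_imageI)
  have "\<forall>i. \<exists>c. of_nat m * q i = of_int c"
    using m(2) by (auto elim: Ints_cases)
  then obtain k where k: "\<And>i. of_nat m * q i = of_int (k i)" by metis
  have "of_nat m * of_rat (q i) = (of_int (k i) :: 'k)" for i
    by (metis k of_rat_mult of_rat_of_int_eq of_rat_of_nat_eq)
  then have "of_nat m * x = (\<Sum>i\<in>UNIV. of_int (k i) * b i)"
    by (simp add: q sum_distrib_left mult.assoc[symmetric])
  then show thesis using that m(1) by (auto simp: lattice_def)
qed

lemma lattice_0: "0 \<in> lattice"
  unfolding lattice_def by (rule range_eqI[of _ _ "\<lambda>_. 0"]) simp

lemma lattice_add: "x \<in> lattice \<Longrightarrow> y \<in> lattice \<Longrightarrow> x + y \<in> lattice"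
  using lattice_diff[of x "0 - y"] lattice_diff[OF lattice_0, of y] by simp

lemma lattice_of_int_mult:
  assumes "x \<in> lattice"
  shows "of_int c * x \<in> lattice"
proof -
  obtain k where "x = (\<Sum>i\<in>UNIV. of_int (k i) * b i)"
    using assms by (auto simp: lattice_def)
  then have "of_int c * x = (\<Sum>i\<in>UNIV. of_int (c * k i) * b i)"
    by (simp add: sum_distrib_left mult.assoc)
  then show ?thesis unfolding lattice_def by (rule range_eqI[of _ _ "\<lambda>i. c * k i"])
qed

lemma lattice_sum: "(\<And>i. i \<in> I \<Longrightarrow> f i \<in> lattice) \<Longrightarrow> (\<Sum>i\<in>I. f i) \<in> lattice"
  by (induction I rule: infinite_finite_induct) (auto intro: lattice_0 lattice_add)

text \<open>The lattice need not be closed under multiplication, but the finitely many products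
  \<open>b i * b k\<close> have a common denominator, and bilinearity does the rest.\<close>

lemma lattice_mult:
  obtains D :: nat where "D > 0" "\<And>x y. x \<in> lattice \<Longrightarrow> y \<in> lattice \<Longrightarrow> of_nat D * (x * y) \<in> lattice"
proof -
  have "\<forall>p. \<exists>m::nat. m > 0 \<and> of_nat m * (b (fst p) * b (snd p)) \<in> lattice"
    using ex_multiple_lattice by metis
  then obtain m :: "'n \<times> 'n \<Rightarrow> nat" where m: "\<And>p. m p > 0"
    "\<And>p. of_nat (m p) * (b (fst p) * b (snd p)) \<in> lattice" by metis
  define D where "D = prod m UNIV"
  have D: "D > 0" using m(1) by (simp add: D_def prod_pos)
  have bb: "of_nat D * (b i * b k) \<in> lattice" for i k
  proof -
    have "m (i, k) dvd D" unfolding D_def by (intro dvd_prodI) auto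
    then obtain c where "D = m (i, k) * c" by (rule dvdE)
    then have "of_nat D * (b i * b k) = of_int (int c) * (of_nat (m (i, k)) * (b i * b k))"
      by (simp add: mult_ac)
    also have "\<dots> \<in> lattice" using m(2)[of "(i, k)"] by (intro lattice_of_int_mult) simp
    finally show ?thesis .
  qed
  have "of_nat D * (x * y) \<in> lattice" if xy: "x \<in> lattice" "y \<in> lattice" for x y
  proof -
    obtain k l where kl: "x = (\<Sum>i\<in>UNIV. of_int (k i) * b i)" "y = (\<Sum>i\<in>UNIV. of_int (l i) * b i)"
      using xy by (auto simp: lattice_def)
    have "of_nat D * (x * y) = (\<Sum>i\<in>UNIV. \<Sum>j\<in>UNIV. of_int (k i * l j) * (of_nat D * (b i * b j)))"
      unfolding kl sum_product by (simp only: sum_distrib_left) (intro sum.cong refl, simp add: mult_ac)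
    also have "\<dots> \<in> lattice" by (intro lattice_sum lattice_of_int_mult bb)
    finally show ?thesis .
  qed
  with D show thesis using that by blast
qed

end

section \<open>Short vectors\<close>

lemma card_floor_interval:
  fixes u v :: real
  assumes "u \<le> v"
  shows "real (card {\<lfloor>u\<rfloor>..\<lfloor>v\<rfloor>}) \<le> v - u + 2"
proof -
  have "\<lfloor>u\<rfloor> \<le> \<lfloor>v\<rfloor>" using assms by (rule floor_mono)
  then have "real (card {\<lfloor>u\<rfloor>..\<lfloor>v\<rfloor>}) = of_int \<lfloor>v\<rfloor> - of_int \<lfloor>u\<rfloor> + 1" by simp
  then show ?thesis by linarith
qed

lemma floor_mem_interval:
  fixes t a w :: real
  assumes "\<bar>t - a\<bar> \<le> w"
  shows "\<lfloor>t\<rfloor> \<in> {\<lfloor>a - w\<rfloor>..\<lfloor>a + w\<rfloor>}"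
  using assms unfolding atLeastAtMost_iff by (intro conjI floor_mono) linarith+

lemma card_le_fibres:
  assumes "finite A" "finite B" "f ` A \<subseteq> B"
    and "\<And>y. y \<in> B \<Longrightarrow> real (card {x \<in> A. f x = y}) \<le> m"
  shows "real (card A) \<le> m * real (card B)"
proof -
  have "card A = (\<Sum>y\<in>B. card {x \<in> A. f x = y})"
    using sum.group[OF assms(1,2,3), of "\<lambda>_. 1::nat"] by simp
  then have "real (card A) = (\<Sum>y\<in>B. real (card {x \<in> A. f x = y}))" by simp
  also have "\<dots> \<le> (\<Sum>y\<in>B. m)" by (intro sum_mono assms(4))
  finally show ?thesis by (simp add: mult.commute)
qed

text \<open>The shear by \<open>x\<close> does not affect the leading term of the number of cells of side \<open>r\<close>
  met by the image of a large box.\<close>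

lemma card_sheared_cells:
  fixes x y r B :: real
  assumes "y > 0" "r > 0" "B \<ge> 2 * r / sqrt y" "B \<ge> (2 * \<bar>x\<bar> / y + 2) * (sqrt y * r)"
  obtains Q where "finite Q" "real (card Q) \<le> 9 * B\<^sup>2 / r\<^sup>2"
    "\<And>c d. \<bar>c\<bar> \<le> B \<Longrightarrow> \<bar>d\<bar> \<le> B \<Longrightarrow>
      (\<lfloor>c * sqrt y / r\<rfloor>, \<lfloor>(c * x + d) / (sqrt y * r)\<rfloor>) \<in> Q"
proof -
  define s where "s = sqrt y"
  have s: "s > 0" "y = s * s" using assms(1) by (auto simp: s_def)
  have "2 * r / s > 0" using s assms(2) by simp
  then have B: "B > 0" using assms(3) unfolding s_def by linarith
  \<comment> \<open>Half the range of the second coordinate once the cell index \<open>a\<close> of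
    the first is known: an error below 1 in the first coordinate is sheared into at most |x| / y,
    and \<open>d\<close> contributes at most B / (s r).\<close>
  define W where "W = \<bar>x\<bar> / y + B / (s * r)"
  have W0: "W \<ge> 0" using B s assms by (auto simp: W_def)
  define Q where "Q = (SIGMA a:{\<lfloor>- (B * s / r)\<rfloor>..\<lfloor>B * s / r\<rfloor>}.
    {\<lfloor>of_int a * x / y - W\<rfloor>..\<lfloor>of_int a * x / y + W\<rfloor>})"
  have fin: "finite Q" by (simp add: Q_def)
  have "real (card Q) = (\<Sum>a\<in>{\<lfloor>- (B * s / r)\<rfloor>..\<lfloor>B * s / r\<rfloor>}.
      real (card {\<lfloor>of_int a * x / y - W\<rfloor>..\<lfloor>of_int a * x / y + W\<rfloor>}))"
    by (simp add: Q_def del: card_atLeastAtMost_int)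
  also have "\<dots> \<le> (\<Sum>a\<in>{\<lfloor>- (B * s / r)\<rfloor>..\<lfloor>B * s / r\<rfloor>}. 2 * W + 2)"
  proof (intro sum_mono)
    fix a :: int
    have "real (card {\<lfloor>of_int a * x / y - W\<rfloor>..\<lfloor>of_int a * x / y + W\<rfloor>})
      \<le> (of_int a * x / y + W) - (of_int a * x / y - W) + 2"
      by (rule card_floor_interval) (use W0 in simp)
    then show "real (card {\<lfloor>of_int a * x / y - W\<rfloor>..\<lfloor>of_int a * x / y + W\<rfloor>}) \<le> 2 * W + 2" by simp
  qed
  also have "\<dots> = real (card {\<lfloor>- (B * s / r)\<rfloor>..\<lfloor>B * s / r\<rfloor>}) * (2 * W + 2)"
    by (simp only: sum_constant)
  also have "\<dots> \<le> (2 * (B * s / r) + 2) * (2 * W + 2)"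
  proof (intro mult_right_mono)
    have "real (card {\<lfloor>- (B * s / r)\<rfloor>..\<lfloor>B * s / r\<rfloor>}) \<le> B * s / r - - (B * s / r) + 2"
      by (rule card_floor_interval) (use B s assms in \<open>auto intro: order_trans[of _ 0]\<close>)
    then show "real (card {\<lfloor>- (B * s / r)\<rfloor>..\<lfloor>B * s / r\<rfloor>}) \<le> 2 * (B * s / r) + 2" by simp
  qed (use W0 in simp)
  \<comment> \<open>The two lower bounds on \<open>B\<close> absorb the rounding terms, turning each
    factor 2 into 3. In the product of the main terms \<open>x\<close> and \<open>y\<close> have
    disappeared.\<close>
  also have "\<dots> \<le> (3 * (B * s / r)) * (3 * (B / (s * r)))"
  proof (intro mult_mono)
    have "2 \<le> B * s / r" using assms(2,3) s by (simp add: s_def[symmetric] field_simps)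
    then show "2 * (B * s / r) + 2 \<le> 3 * (B * s / r)" by simp
    have "2 * \<bar>x\<bar> / y + 2 \<le> B / (s * r)"
      using assms(2,4) s(1) by (subst pos_le_divide_eq) (auto simp: s_def[symmetric])
    then show "2 * W + 2 \<le> 3 * (B / (s * r))" unfolding W_def by argo
    show "0 \<le> 3 * (B * s / r)" "0 \<le> 2 * W + 2" using B s assms W0 by auto
  qed
  also have "\<dots> = 9 * B\<^sup>2 / r\<^sup>2" using s assms(2) by (simp add: field_simps power2_eq_square)
  finally have card: "real (card Q) \<le> 9 * B\<^sup>2 / r\<^sup>2" .
  have "(\<lfloor>c * sqrt y / r\<rfloor>, \<lfloor>(c * x + d) / (sqrt y * r)\<rfloor>) \<in> Q" if cd: "\<bar>c\<bar> \<le> B" "\<bar>d\<bar> \<le> B" for c d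
  proof -
    define a where "a = \<lfloor>c * s / r\<rfloor>"
    have "\<bar>c * s / r\<bar> \<le> B * s / r"
      using cd s assms by (simp add: abs_mult divide_right_mono mult_right_mono)
    then have a: "a \<in> {\<lfloor>- (B * s / r)\<rfloor>..\<lfloor>B * s / r\<rfloor>}"
      unfolding a_def atLeastAtMost_iff by (intro conjI floor_mono) linarith+
    have e1: "(c * x + d) / (s * r) = (c * s / r) * (x / y) + d / (s * r)"
      using s assms(2) by (simp add: field_simps)
    have "\<bar>(c * s / r - of_int a) * (x / y)\<bar> \<le> 1 * \<bar>x / y\<bar>"
      unfolding abs_mult by (intro mult_right_mono) (auto simp: a_def, linarith)
    moreover have "\<bar>d / (s * r)\<bar> \<le> B / (s * r)"
      using cd s assms by (simp add: divide_right_mono)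
    ultimately have "\<bar>(c * x + d) / (s * r) - of_int a * x / y\<bar> \<le> W"
    proof -
      have "(c * x + d) / (s * r) - of_int a * x / y = (c * s / r - of_int a) * (x / y) + d / (s * r)"
        unfolding e1 by (simp add: left_diff_distrib diff_divide_distrib)
      moreover have "1 * \<bar>x / y\<bar> = \<bar>x\<bar> / y" using assms(1) by simp
      moreover have "\<bar>(c * s / r - of_int a) * (x / y) + d / (s * r)\<bar> \<le> 1 * \<bar>x / y\<bar> + B / (s * r)"
        by (rule order_trans[OF abs_triangle_ineq add_mono]) fact+
      ultimately show ?thesis unfolding W_def by (simp only:)
    qed
    then have "\<lfloor>(c * x + d) / (s * r)\<rfloor> \<in> {\<lfloor>of_int a * x / y - W\<rfloor>..\<lfloor>of_int a * x / y + W\<rfloor>}"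
      by (rule floor_mem_interval)
    then show ?thesis using a unfolding Q_def by (auto simp: a_def s_def)
  qed
  with fin card show thesis by (rule that)
qed

text \<open>If \<open>v\<close> is the bottom row of a matrix of determinant 1, the squared modulus
  is the inverse of the imaginary part of the image of \<open>z\<close> at the place
  \<open>j\<close>. Dividing by the square root makes the real-linear map from (c, d) to the real
  and imaginary parts have determinant of modulus 1, so cell counts do not depend on
  \<open>z\<close>.\<close>

definition unit_form :: "('n \<Rightarrow> 'k \<Rightarrow> real) \<Rightarrow> complex^'n \<Rightarrow> 'k \<times> 'k \<Rightarrow> 'n \<Rightarrow> complex"
  where "unit_form \<sigma> z v j =
    (of_real (\<sigma> j (fst v)) * z $ j + of_real (\<sigma> j (snd v))) / of_real (sqrt (Im (z $ j)))"

context totally_real_basis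
begin

lemma unit_form_diff: "unit_form \<sigma> z (v - w) j = unit_form \<sigma> z v j - unit_form \<sigma> z w j"
  by (simp add: unit_form_def diff_divide_distrib[symmetric] algebra_simps)

lemma unit_form_scale:
  "unit_form \<sigma> z (l * c, l * d) j = of_real (\<sigma> j l) * unit_form \<sigma> z (c, d) j"
  by (simp add: unit_form_def algebra_simps)

lemma lattice_pair_diff:
  "v \<in> lattice \<times> lattice \<Longrightarrow> w \<in> lattice \<times> lattice \<Longrightarrow> v - w \<in> lattice \<times> lattice"
  by (simp add: mem_Times_iff lattice_diff)

text \<open>All differences lie on one line over the field, which has only \<open>CARD('n)\<close>
  real dimensions. Hence \<open>r\<close> enters with half the exponent that describes a full cell;
  this gap drives the pigeonhole argument in \<open>ex_short_basis\<close>.\<close>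

lemma card_short_collinear:
  assumes \<tau>: "\<tau> > 0" and r: "r > 0"
    and thick: "\<And>v. v \<in> lattice \<times> lattice \<Longrightarrow> v \<noteq> 0 \<Longrightarrow>
      \<exists>j. cmod (unit_form \<sigma> z v j) \<ge> \<tau>"
    and V: "finite V" "V \<subseteq> lattice \<times> lattice"
    and short: "\<And>v w j. v \<in> V \<Longrightarrow> w \<in> V \<Longrightarrow> cmod (unit_form \<sigma> z (v - w) j) \<le> r"
    and collinear: "\<And>v w u. v \<in> V \<Longrightarrow> w \<in> V \<Longrightarrow> u \<in> V \<Longrightarrow>
      fst (w - u) * snd (v - u) = fst (v - u) * snd (w - u)"
  shows "real (card V) \<le> (2 * r / \<tau> + 2) ^ CARD('n)"
proof (cases "\<exists>u\<in>V. \<exists>w\<in>V. w \<noteq> u")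
  case False
  have "real (card V) \<le> 1"
  proof (cases "V = {}")
    case False
    then obtain u where "V = {u}" using \<open>\<not> (\<exists>u\<in>V. \<exists>w\<in>V. w \<noteq> u)\<close> by blast
    then show ?thesis by simp
  qed simp
  also have "1 \<le> (2 * r / \<tau> + 2) ^ CARD('n)"
    using \<tau> r by (intro one_le_power) (simp add: add_nonneg_nonneg add_increasing)
  finally show ?thesis .
next
  case True
  then obtain u w where uw: "u \<in> V" "w \<in> V" "w \<noteq> u" by blast
  have "\<exists>l. v - u = (l * fst (w - u), l * snd (w - u))" if "v \<in> V" for v
  proof (cases "fst (w - u) = 0")
    case False
    show ?thesis
    proof (intro exI)
      show "v - u = (fst (v - u) / fst (w - u) * fst (w - u), fst (v - u) / fst (w - u) * snd (w - u))"
        using False collinear[OF that uw(2,1)] by (simp add: prod_eq_iff field_simps)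
    qed
  next
    case True
    then have nz: "snd (w - u) \<noteq> 0" using uw(3) by (auto simp: prod_eq_iff)
    show ?thesis
    proof (intro exI)
      show "v - u = (snd (v - u) / snd (w - u) * fst (w - u), snd (v - u) / snd (w - u) * snd (w - u))"
        using True nz collinear[OF that uw(2,1)] by (simp add: prod_eq_iff)
    qed
  qed
  then obtain l where l: "\<And>v. v \<in> V \<Longrightarrow> v - u = (l v * fst (w - u), l v * snd (w - u))" by metis
  define n where "n j = cmod (unit_form \<sigma> z (w - u) j)" for j
  \<comment> \<open>Position along the line, measured at each place in units of
    \<open>\<tau>\<close>. Distinct vectors with equal keys would differ by a nonzero lattice vector
    shorter than \<open>\<tau>\<close> at every place.\<close>
  define key where "key v = (\<lambda>j. \<lfloor>\<sigma> j (l v) * n j / \<tau>\<rfloor>)" for v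
  have uf: "unit_form \<sigma> z (v - u) j = of_real (\<sigma> j (l v)) * unit_form \<sigma> z (w - u) j" if "v \<in> V" for v j
    using l[OF that] unit_form_scale[of z "l v" "fst (w - u)" "snd (w - u)" j]
    by (simp only: prod.collapse)
  have "inj_on key V"
  proof (rule inj_onI, rule ccontr)
    fix v v' assume v: "v \<in> V" "v' \<in> V" "key v = key v'" "v \<noteq> v'"
    have "cmod (unit_form \<sigma> z (v - v') j) < \<tau>" for j
    proof -
      have "unit_form \<sigma> z (v - v') j = unit_form \<sigma> z ((v - u) - (v' - u)) j" by simp
      also have "\<dots> = of_real (\<sigma> j (l v) - \<sigma> j (l v')) * unit_form \<sigma> z (w - u) j"
        unfolding unit_form_diff[of z "v - u"] uf[OF v(1)] uf[OF v(2)] by (simp add: algebra_simps)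
      finally have "cmod (unit_form \<sigma> z (v - v') j) = \<bar>\<sigma> j (l v) - \<sigma> j (l v')\<bar> * n j"
        by (simp only: norm_mult n_def norm_of_real)
      also have "\<dots> = \<tau> * \<bar>\<sigma> j (l v) * n j / \<tau> - \<sigma> j (l v') * n j / \<tau>\<bar>"
        using \<tau> by (simp add: n_def abs_mult[symmetric] left_diff_distrib diff_divide_distrib[symmetric]
            abs_divide)
          (simp add: abs_mult left_diff_distrib[symmetric])
      also have "\<bar>\<sigma> j (l v) * n j / \<tau> - \<sigma> j (l v') * n j / \<tau>\<bar> < 1"
        using fun_cong[OF v(3), of j] unfolding key_def by linarith
      finally show ?thesis using \<tau> by simp
    qed
    moreover have "v - v' \<in> lattice \<times> lattice"
      using v V(2) by (intro lattice_pair_diff) auto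
    ultimately show False using thick[of "v - v'"] v(4) by (auto simp: not_le[symmetric])
  qed
  moreover have "key ` V \<subseteq> PiE UNIV (\<lambda>_. {\<lfloor>- (r / \<tau>)\<rfloor>..\<lfloor>r / \<tau>\<rfloor>})"
  proof -
    have "key v j \<in> {\<lfloor>- (r / \<tau>)\<rfloor>..\<lfloor>r / \<tau>\<rfloor>}" if "v \<in> V" for v j
    proof -
      have "\<bar>\<sigma> j (l v) * n j\<bar> = cmod (unit_form \<sigma> z (v - u) j)"
        by (simp add: uf[OF that] n_def norm_mult abs_mult)
      also have "\<dots> \<le> r" using short that uw by blast
      finally have "\<bar>\<sigma> j (l v) * n j / \<tau>\<bar> \<le> r / \<tau>" using \<tau> by (simp add: divide_right_mono)
      then show ?thesis
        unfolding key_def atLeastAtMost_iff by (intro conjI floor_mono) linarith+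
    qed
    then show ?thesis by auto
  qed
  ultimately have "card V \<le> card (PiE (UNIV :: 'n set) (\<lambda>_. {\<lfloor>- (r / \<tau>)\<rfloor>..\<lfloor>r / \<tau>\<rfloor>}))"
    by (intro card_inj_on_le[of key]) (auto intro!: finite_PiE)
  also have "\<dots> = card {\<lfloor>- (r / \<tau>)\<rfloor>..\<lfloor>r / \<tau>\<rfloor>} ^ CARD('n)" by (simp add: card_PiE)
  finally have "real (card V) \<le> real (card {\<lfloor>- (r / \<tau>)\<rfloor>..\<lfloor>r / \<tau>\<rfloor>}) ^ CARD('n)"
    by (metis of_nat_le_iff of_nat_power)
  also have "\<dots> \<le> (2 * r / \<tau> + 2) ^ CARD('n)"
  proof (intro power_mono)
    have "real (card {\<lfloor>- (r / \<tau>)\<rfloor>..\<lfloor>r / \<tau>\<rfloor>}) \<le> r / \<tau> - - (r / \<tau>) + 2"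
      by (rule card_floor_interval) (use \<tau> r in simp)
    then show "real (card {\<lfloor>- (r / \<tau>)\<rfloor>..\<lfloor>r / \<tau>\<rfloor>}) \<le> 2 * r / \<tau> + 2" by simp
  qed simp
  finally show ?thesis .
qed

lemma lattice_box_bound:
  obtains S where "S > 0"
    "\<And>(k :: 'n \<Rightarrow> int) M j. (\<And>i. 0 \<le> k i \<and> k i < int M) \<Longrightarrow>
      \<bar>\<sigma> j (\<Sum>i\<in>UNIV. of_int (k i) * b i)\<bar> \<le> real M * S"
proof -
  define S where "S = 1 + (\<Sum>j\<in>UNIV. \<Sum>i\<in>UNIV. \<bar>\<sigma> j (b i)\<bar>)"
  have S: "S > 0" unfolding S_def by (intro add_pos_nonneg sum_nonneg) auto
  have "\<bar>\<sigma> j (\<Sum>i\<in>UNIV. of_int (k i) * b i)\<bar> \<le> real M * S"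
    if k: "\<And>i. 0 \<le> k i \<and> k i < int M" for k :: "'n \<Rightarrow> int" and M j
  proof -
    have kM: "\<bar>real_of_int (k i)\<bar> \<le> real M" for i using k[of i] by linarith
    have "\<bar>\<sigma> j (\<Sum>i\<in>UNIV. of_int (k i) * b i)\<bar> \<le> (\<Sum>i\<in>UNIV. \<bar>of_int (k i) * \<sigma> j (b i)\<bar>)"
      unfolding \<sigma>_coordinates by (rule sum_abs)
    also have "\<dots> \<le> (\<Sum>i\<in>UNIV. real M * \<bar>\<sigma> j (b i)\<bar>)"
      unfolding abs_mult by (intro sum_mono mult_right_mono kM) auto
    also have "\<dots> = real M * (\<Sum>i\<in>UNIV. \<bar>\<sigma> j (b i)\<bar>)" by (simp add: sum_distrib_left)
    also have "(\<Sum>i\<in>UNIV. \<bar>\<sigma> j (b i)\<bar>) \<le> (\<Sum>j\<in>UNIV. \<Sum>i\<in>UNIV. \<bar>\<sigma> j (b i)\<bar>)"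
      by (rule member_le_sum[of j UNIV "\<lambda>j. \<Sum>i\<in>UNIV. \<bar>\<sigma> j (b i)\<bar>"]) (auto intro: sum_nonneg)
    also have "\<dots> \<le> S" by (simp add: S_def)
    finally show ?thesis by (simp add: mult_left_mono)
  qed
  with S show thesis by (rule that)
qed

lemma card_lattice_box:
  fixes M :: nat
  defines "E \<equiv> (\<lambda>k :: 'n \<Rightarrow> int. \<Sum>i\<in>UNIV. of_int (k i) * b i) ` PiE UNIV (\<lambda>_. {0..<int M})"
  shows "finite E" "card E = M ^ CARD('n)" "E \<subseteq> lattice"
proof -
  show "finite E" unfolding E_def by (intro finite_imageI finite_PiE) auto
  have "card E = card (PiE (UNIV :: 'n set) (\<lambda>_. {0..<int M}))"
    unfolding E_def by (intro card_image inj_on_subset[OF lattice_coordinates_inj]) auto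
  then show "card E = M ^ CARD('n)" by (simp add: card_PiE)
  show "E \<subseteq> lattice" by (auto simp: E_def lattice_def)
qed

text \<open>Write g = \<open>CARD('n)\<close>. A box of M^(2g) lattice pairs meets at most a
  constant times (M / r)^(2g) cells of side \<open>r\<close>. Were the pairs in each cell collinear,
  a cell would hold at most a constant times r^g of them, too few in total once \<open>r\<close> is
  large. So some cell contains three non-collinear pairs, and their differences are the two short
  vectors. The bound is uniform in \<open>z\<close> because \<open>M\<close> cancels.\<close>

lemma ex_short_basis:
  assumes \<epsilon>: "\<epsilon> > 0"
  obtains R where "R > 0"
    "\<And>z. z \<in> upper_half_space \<Longrightarrow>
      (\<And>v. v \<in> lattice \<times> lattice \<Longrightarrow> v \<noteq> 0 \<Longrightarrow> (\<Prod>j\<in>UNIV. (cmod (unit_form \<sigma> z v j))\<^sup>2) > \<epsilon>) \<Longrightarrow>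
      \<exists>v\<in>lattice \<times> lattice. \<exists>w\<in>lattice \<times> lattice. fst v * snd w \<noteq> fst w * snd v \<and>
        (\<forall>j. cmod (unit_form \<sigma> z v j) \<le> R) \<and> (\<forall>j. cmod (unit_form \<sigma> z w j) \<le> R)"
proof -
  obtain S where S: "S > 0" and bound: "\<And>(k :: 'n \<Rightarrow> int) M j. (\<And>i. 0 \<le> k i \<and> k i < int M) \<Longrightarrow>
      \<bar>\<sigma> j (\<Sum>i\<in>UNIV. of_int (k i) * b i)\<bar> \<le> real M * S"
    by (rule lattice_box_bound) blast
  \<comment> \<open>If all moduli were at most \<tau> \<le> 1, the product of their squares would be
    at most \<tau>, hence at most \<epsilon>.\<close>
  define \<tau> where "\<tau> = min 1 \<epsilon>"
  have \<tau>: "\<tau> > 0" "\<tau> \<le> 1" "\<tau> \<le> \<epsilon>" using \<epsilon> by (auto simp: \<tau>_def)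
  \<comment> \<open>Chosen for \<open>r2\<close>, where the growth r^2 of a cell outweighs the
    growth of order r along a line. The summand 1 gives \<open>r \<ge> 1\<close> and makes the
    inequality strict.\<close>
  define r where "r = 9 * S\<^sup>2 * (4 / \<tau> + 2) + 1"
  have r1: "r \<ge> 1" using S \<tau> by (simp add: r_def)
  then have r: "r > 0" by simp
  have r2: "(4 * r / \<tau> + 2) * (9 * S\<^sup>2) < r\<^sup>2"
  proof -
    have "(4 * r / \<tau> + 2) * (9 * S\<^sup>2) \<le> (4 * r / \<tau> + 2 * r) * (9 * S\<^sup>2)"
      using r1 by (intro mult_right_mono) auto
    also have "\<dots> = r * (9 * S\<^sup>2 * (4 / \<tau> + 2))" using \<tau> by (simp add: field_simps)
    also have "\<dots> = r * (r - 1)" by (simp add: r_def)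
    also have "\<dots> < r\<^sup>2" using r by (simp add: power2_eq_square)
    finally show ?thesis .
  qed
  show thesis
  proof (rule that[of "2 * r"])
    fix z :: "complex^'n"
    assume z: "z \<in> upper_half_space"
    assume thick0: "\<And>v. v \<in> lattice \<times> lattice \<Longrightarrow> v \<noteq> 0 \<Longrightarrow> (\<Prod>j\<in>UNIV. (cmod (unit_form \<sigma> z v j))\<^sup>2) > \<epsilon>"
    have y: "Im (z $ j) > 0" for j using z by (simp add: upper_half_space_def)
    have thick: "\<exists>j. cmod (unit_form \<sigma> z v j) \<ge> \<tau>" if "v \<in> lattice \<times> lattice" "v \<noteq> 0" for v
    proof (rule ccontr)
      assume "\<not> (\<exists>j. cmod (unit_form \<sigma> z v j) \<ge> \<tau>)"
      then have "cmod (unit_form \<sigma> z v j) \<le> \<tau>" for j by (meson le_cases)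
      then have "(cmod (unit_form \<sigma> z v j))\<^sup>2 \<le> \<tau> * 1" for j
        unfolding power2_eq_square using \<tau> by (intro mult_mono) (auto intro: order_trans)
      then have "(\<Prod>j\<in>UNIV. (cmod (unit_form \<sigma> z v j))\<^sup>2) \<le> (\<Prod>j\<in>(UNIV :: 'n set). \<tau>)"
        by (intro prod_mono) auto
      also have "\<dots> = \<tau> ^ CARD('n)" by simp
      also have "\<dots> \<le> \<tau> ^ 1" using \<tau> by (intro power_decreasing) (auto simp: Suc_le_eq)
      finally show False using thick0[OF that] \<tau>(3) by simp
    qed
    show "\<exists>v\<in>lattice \<times> lattice. \<exists>w\<in>lattice \<times> lattice. fst v * snd w \<noteq> fst w * snd v \<and>
        (\<forall>j. cmod (unit_form \<sigma> z v j) \<le> 2 * r) \<and> (\<forall>j. cmod (unit_form \<sigma> z w j) \<le> 2 * r)"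
    proof (rule ccontr)
      assume no: "\<not> ?thesis"
      \<comment> \<open>The box size that \<open>card_sheared_cells\<close> requires at the place
        \<open>j\<close>. It depends on \<open>z\<close>, unlike \<open>r\<close>, which alone
        enters the conclusion.\<close>
      define M0 where "M0 j = max (2 * r / sqrt (Im (z $ j)))
        ((2 * \<bar>Re (z $ j)\<bar> / Im (z $ j) + 2) * (sqrt (Im (z $ j)) * r))" for j
      obtain M :: nat where M: "M > 0" "\<And>j. M0 j \<le> real M * S"
      proof -
        obtain M :: nat where "real M > Max (range M0) / S" using reals_Archimedean2 by blast
        then have *: "real M * S > Max (range M0)" using S by (simp add: field_simps)
        have "M0 j \<le> real (Suc M) * S" for j
        proof -
          have "M0 j \<le> Max (range M0)" by (intro Max_ge) auto
          moreover have "real (Suc M) * S = real M * S + S" by (simp add: algebra_simps)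
          ultimately show ?thesis using * S by linarith
        qed
        then show thesis using that[of "Suc M"] by blast
      qed
      define E where "E = (\<lambda>k :: 'n \<Rightarrow> int. \<Sum>i\<in>UNIV. of_int (k i) * b i) ` PiE UNIV (\<lambda>_. {0..<int M})"
      note E = card_lattice_box[of M, folded E_def]
      have Eb: "\<bar>\<sigma> j c\<bar> \<le> real M * S" if "c \<in> E" for c j
        using that by (auto simp: E_def PiE_iff intro!: bound)
      have "\<forall>j. \<exists>Q. finite Q \<and> real (card Q) \<le> 9 * (real M * S)\<^sup>2 / r\<^sup>2 \<and>
        (\<forall>c d. \<bar>c\<bar> \<le> real M * S \<longrightarrow> \<bar>d\<bar> \<le> real M * S \<longrightarrow> (\<lfloor>c * sqrt (Im (z $ j)) / r\<rfloor>,
           \<lfloor>(c * Re (z $ j) + d) / (sqrt (Im (z $ j)) * r)\<rfloor>) \<in> Q)"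
      proof
        fix j
        have "real M * S \<ge> 2 * r / sqrt (Im (z $ j))"
          "real M * S \<ge> (2 * \<bar>Re (z $ j)\<bar> / Im (z $ j) + 2) * (sqrt (Im (z $ j)) * r)"
          using M(2)[of j] by (auto simp: M0_def)
        then show "\<exists>Q. finite Q \<and> real (card Q) \<le> 9 * (real M * S)\<^sup>2 / r\<^sup>2 \<and>
          (\<forall>c d. \<bar>c\<bar> \<le> real M * S \<longrightarrow> \<bar>d\<bar> \<le> real M * S \<longrightarrow> (\<lfloor>c * sqrt (Im (z $ j)) / r\<rfloor>,
             \<lfloor>(c * Re (z $ j) + d) / (sqrt (Im (z $ j)) * r)\<rfloor>) \<in> Q)"
          by (rule card_sheared_cells[OF y r]) blast
      qed
      then obtain Q where Q: "\<And>j. finite (Q j)" "\<And>j. real (card (Q j)) \<le> 9 * (real M * S)\<^sup>2 / r\<^sup>2"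
        "\<And>j c d. \<bar>c\<bar> \<le> real M * S \<Longrightarrow> \<bar>d\<bar> \<le> real M * S \<Longrightarrow> (\<lfloor>c * sqrt (Im (z $ j)) / r\<rfloor>,
           \<lfloor>(c * Re (z $ j) + d) / (sqrt (Im (z $ j)) * r)\<rfloor>) \<in> Q j"
        by metis
      define cell where "cell v = (\<lambda>j. (\<lfloor>Im (unit_form \<sigma> z v j) / r\<rfloor>, \<lfloor>Re (unit_form \<sigma> z v j) / r\<rfloor>))" for v
      have Imu: "Im (unit_form \<sigma> z v j) = \<sigma> j (fst v) * sqrt (Im (z $ j))" for v j
        using y[of j] by (simp add: unit_form_def Im_divide_of_real real_div_sqrt
            times_divide_eq_right[symmetric] del: times_divide_eq_right)
      have Reu: "Re (unit_form \<sigma> z v j) = (\<sigma> j (fst v) * Re (z $ j) + \<sigma> j (snd v)) / sqrt (Im (z $ j))" for v j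
        by (simp add: unit_form_def Re_divide_of_real)
      have "cell ` (E \<times> E) \<subseteq> PiE UNIV Q"
        using Q(3) Eb by (auto simp: cell_def Imu Reu)
      then have "real (card (E \<times> E)) \<le> (2 * (2 * r) / \<tau> + 2) ^ CARD('n) * real (card (PiE UNIV Q))"
      proof (intro card_le_fibres[of _ _ cell])
        fix q
        show "real (card {v \<in> E \<times> E. cell v = q}) \<le> (2 * (2 * r) / \<tau> + 2) ^ CARD('n)"
        proof (rule card_short_collinear[OF \<tau>(1) _ thick])
          show "{v \<in> E \<times> E. cell v = q} \<subseteq> lattice \<times> lattice" using E(3) by auto
          show sh: "cmod (unit_form \<sigma> z (v - w) j) \<le> 2 * r"
            if "v \<in> {v \<in> E \<times> E. cell v = q}" "w \<in> {v \<in> E \<times> E. cell v = q}" for v w j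
          proof -
            have eq: "cell v j = cell w j" using that by simp
            have fl: "\<bar>s - t\<bar> \<le> r" if "\<lfloor>s / r\<rfloor> = \<lfloor>t / r\<rfloor>" for s t
            proof -
              have "\<bar>s / r - t / r\<bar> \<le> 1" using that by linarith
              then show ?thesis using r by (simp add: diff_divide_distrib[symmetric] abs_divide field_simps)
            qed
            have "cmod (unit_form \<sigma> z (v - w) j) \<le> \<bar>Re (unit_form \<sigma> z (v - w) j)\<bar> + \<bar>Im (unit_form \<sigma> z (v - w) j)\<bar>"
              by (rule cmod_le)
            also have "\<dots> \<le> r + r"
              unfolding unit_form_diff minus_complex.simps
              using eq by (intro add_mono fl) (simp_all add: cell_def)
            finally show ?thesis by simp
          qed
          show "fst (w - u) * snd (v - u) = fst (v - u) * snd (w - u)"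
            if v: "v \<in> {v \<in> E \<times> E. cell v = q}" and w: "w \<in> {v \<in> E \<times> E. cell v = q}"
              and u: "u \<in> {v \<in> E \<times> E. cell v = q}" for v w u
          proof (rule ccontr)
            assume ne: "fst (w - u) * snd (v - u) \<noteq> fst (v - u) * snd (w - u)"
            have EE: "x \<in> lattice \<times> lattice" if "x \<in> {v \<in> E \<times> E. cell v = q}" for x
              using that E(3) by auto
            have "\<exists>v\<in>lattice \<times> lattice. \<exists>w\<in>lattice \<times> lattice. fst v * snd w \<noteq> fst w * snd v \<and>
                (\<forall>j. cmod (unit_form \<sigma> z v j) \<le> 2 * r) \<and> (\<forall>j. cmod (unit_form \<sigma> z w j) \<le> 2 * r)"
              using ne sh[OF v u] sh[OF w u]
              by (intro bexI[of _ "w - u"] bexI[of _ "v - u"] lattice_pair_diff EE v w u conjI allI)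
            then show False using no by contradiction
          qed
        qed (use r E in auto)
      qed (use E Q in \<open>auto intro!: finite_PiE\<close>)
      also have "real (card (PiE UNIV Q)) = (\<Prod>j\<in>UNIV. real (card (Q j)))" by (simp add: card_PiE)
      also have "\<dots> \<le> (\<Prod>j\<in>(UNIV::'n set). 9 * (real M * S)\<^sup>2 / r\<^sup>2)"
        using Q(2) by (intro prod_mono) auto
      also have "\<dots> = (9 * (real M * S)\<^sup>2 / r\<^sup>2) ^ CARD('n)" by simp
      finally have "real (card (E \<times> E)) \<le>
          (2 * (2 * r) / \<tau> + 2) ^ CARD('n) * (9 * (real M * S)\<^sup>2 / r\<^sup>2) ^ CARD('n)"
        using r \<tau> by (simp add: mult_left_mono)
      also have "\<dots> = ((4 * r / \<tau> + 2) * (9 * S\<^sup>2) / r\<^sup>2 * (real M)\<^sup>2) ^ CARD('n)"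
        by (simp add: power_mult_distrib[symmetric]) (simp add: field_simps power_mult_distrib)
      also have "\<dots> < ((real M)\<^sup>2) ^ CARD('n)"
      proof (rule power_strict_mono)
        have "(4 * r / \<tau> + 2) * (9 * S\<^sup>2) / r\<^sup>2 < 1" using r2 r by simp
        then have "(4 * r / \<tau> + 2) * (9 * S\<^sup>2) / r\<^sup>2 * (real M)\<^sup>2 < 1 * (real M)\<^sup>2"
          by (rule mult_strict_right_mono) (use M(1) in simp)
        then show "(4 * r / \<tau> + 2) * (9 * S\<^sup>2) / r\<^sup>2 * (real M)\<^sup>2 < (real M)\<^sup>2"
          by (simp only: mult_1)
      qed (use r \<tau> in auto)
      also have "\<dots> = real (card (E \<times> E))"
        using E by (simp add: card_cartesian_product power2_eq_square power_mult_distrib)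
      finally show False by simp
    qed
  qed (use r in simp)
qed

end

section \<open>Compactness of the thick part\<close>

lemma matrix_mult_2:
  fixes A B :: "'a::semiring_1^2^2"
  shows "(A ** B) $ i $ j = A $ i $ 1 * B $ 1 $ j + A $ i $ 2 * B $ 2 $ j"
  by (simp add: matrix_matrix_mult_def sum_2)

lemma SL2_iff:
  "A \<in> carrier (SL2 S) \<longleftrightarrow> A $ 1 $ 1 * A $ 2 $ 2 - A $ 1 $ 2 * A $ 2 $ 1 = 1 \<and> (\<forall>i j. A $ i $ j \<in> S)"
  by (simp add: SL2_def det_2)

definition act_right :: "'k::field \<times> 'k \<Rightarrow> 'k^2^2 \<Rightarrow> 'k \<times> 'k"
  where "act_right v A =
    (fst v * A $ 1 $ 1 + snd v * A $ 2 $ 1, fst v * A $ 1 $ 2 + snd v * A $ 2 $ 2)"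

lemma real_linear_form_nonzero:
  assumes "Im w > 0" "(c, d) \<noteq> (0, 0)"
  shows "of_real c * w + of_real d \<noteq> 0"
  using assms by (auto simp: complex_eq_iff)

lemma Im_moebius:
  fixes a b c d :: real
  shows "Im ((of_real a * w + of_real b) / (of_real c * w + of_real d))
    = (a * d - b * c) * Im w / (cmod (of_real c * w + of_real d))\<^sup>2"
proof -
  have "(cmod (of_real c * w + of_real d))\<^sup>2 = (c * Re w + d)\<^sup>2 + (c * Im w)\<^sup>2"
    by (simp add: cmod_power2)
  then show ?thesis by (simp add: Im_divide) (simp add: algebra_simps)
qed

text \<open>Solve the two forms A, B for w and for 1: \<delta> w = d' A - d B and -\<delta> = c' A -
  c B. The first gives |w| \<le> H sqrt(Im w) \<le> H sqrt |w|, hence |w| \<le> H^2; the second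
  gives 1 \<le> H' sqrt(Im w), hence the lower bound on Im w.\<close>

lemma bounded_by_two_forms:
  fixes c d c' d' R :: real
  assumes \<delta>: "c * d' - c' * d \<noteq> 0" and R: "R > 0"
  obtains a where "a > 0" "\<And>w. Im w > 0 \<Longrightarrow> cmod (of_real c * w + of_real d) \<le> R * sqrt (Im w) \<Longrightarrow>
    cmod (of_real c' * w + of_real d') \<le> R * sqrt (Im w) \<Longrightarrow> cmod w \<le> a \<and> 1 / a \<le> Im w"
proof -
  define \<delta> where "\<delta> = c * d' - c' * d"
  define H where "H = (\<bar>d\<bar> + \<bar>d'\<bar>) * R / \<bar>\<delta>\<bar>"
  define H' where "H' = (\<bar>c\<bar> + \<bar>c'\<bar>) * R / \<bar>\<delta>\<bar>"
  have cc: "\<bar>c\<bar> + \<bar>c'\<bar> > 0" using \<delta> by (auto simp: add_nonneg_eq_0_iff less_le)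
  have H': "H' > 0" using cc \<delta> R by (simp add: H'_def \<delta>_def)
  have "cmod w \<le> H\<^sup>2 + H'\<^sup>2 \<and> 1 / (H\<^sup>2 + H'\<^sup>2) \<le> Im w"
    if w: "Im w > 0" and A: "cmod (of_real c * w + of_real d) \<le> R * sqrt (Im w)"
      and B: "cmod (of_real c' * w + of_real d') \<le> R * sqrt (Im w)" for w
  proof
    let ?A = "of_real c * w + of_real d" and ?B = "of_real c' * w + of_real d'"
    have comb: "cmod (of_real s * ?A - of_real t * ?B) \<le> (\<bar>t\<bar> + \<bar>s\<bar>) * R * sqrt (Im w)" for s t
    proof -
      have "cmod (of_real s * ?A - of_real t * ?B) \<le> \<bar>s\<bar> * cmod ?A + \<bar>t\<bar> * cmod ?B"
        by (rule order_trans[OF norm_triangle_ineq4]) (simp add: norm_mult)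
      also have "\<dots> \<le> \<bar>s\<bar> * (R * sqrt (Im w)) + \<bar>t\<bar> * (R * sqrt (Im w))"
        using A B by (intro add_mono mult_left_mono) auto
      finally show ?thesis by (simp add: algebra_simps)
    qed
    have "of_real d' * ?A - of_real d * ?B = of_real \<delta> * w"
      by (simp add: \<delta>_def algebra_simps)
    then have "\<bar>\<delta>\<bar> * cmod w \<le> (\<bar>d\<bar> + \<bar>d'\<bar>) * R * sqrt (Im w)"
      using comb[of d' d] by (simp add: norm_mult)
    then have "cmod w \<le> H * sqrt (Im w)"
      using \<delta> by (simp add: H_def \<delta>_def[symmetric] field_simps)
    also have "\<dots> \<le> H * sqrt (cmod w)"
      using R by (intro mult_left_mono) (auto simp: H_def abs_Im_le_cmod intro: order_trans[OF abs_ge_self])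
    finally have "sqrt (cmod w) * sqrt (cmod w) \<le> H * sqrt (cmod w)" by simp
    moreover have "sqrt (cmod w) > 0" using w by auto
    ultimately have "sqrt (cmod w) \<le> H" by (rule mult_right_le_imp_le)
    then have "cmod w \<le> H\<^sup>2" by (rule sqrt_le_D)
    then show "cmod w \<le> H\<^sup>2 + H'\<^sup>2" by (simp add: add_increasing2)
    have "of_real c' * ?A - of_real c * ?B = of_real (- \<delta>)"
      by (simp add: \<delta>_def algebra_simps)
    then have "cmod (of_real (- \<delta>)) \<le> (\<bar>c\<bar> + \<bar>c'\<bar>) * R * sqrt (Im w)"
      using comb[of c' c] by (simp only:)
    then have "\<bar>\<delta>\<bar> \<le> (\<bar>c\<bar> + \<bar>c'\<bar>) * R * sqrt (Im w)" by simp
    then have "1 \<le> H' * sqrt (Im w)"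
      using \<delta> by (simp add: H'_def \<delta>_def[symmetric] field_simps)
    then have "1\<^sup>2 \<le> (H' * sqrt (Im w))\<^sup>2" by (rule power_mono) simp
    then have "1 \<le> H'\<^sup>2 * Im w" using w by (simp add: power_mult_distrib)
    also have "\<dots> \<le> (H\<^sup>2 + H'\<^sup>2) * Im w" using w by (intro mult_right_mono) auto
    finally show "1 / (H\<^sup>2 + H'\<^sup>2) \<le> Im w"
      using H' by (simp add: divide_le_eq mult.commute add_nonneg_pos)
  qed
  moreover have "H\<^sup>2 + H'\<^sup>2 > 0" using H' by (simp add: add_nonneg_pos)
  ultimately show thesis using that by blast
qed

lemma finite_representatives:
  assumes "finite (f ` A)"
  obtains R where "finite R" "R \<subseteq> A" "\<And>x. x \<in> A \<Longrightarrow> \<exists>y\<in>R. f y = f x"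
proof -
  obtain R where "R \<subseteq> A" "finite R" "f ` A = f ` R"
    using finite_subset_image[OF assms, of f A] by auto
  then show thesis using that by (metis imageE image_eqI)
qed

context totally_real_basis
begin

lemma linear_form_nonzero:
  assumes "z \<in> upper_half_space" "(c, d) \<noteq> (0, 0)"
  shows "of_real (\<sigma> j c) * z $ j + of_real (\<sigma> j d) \<noteq> 0"
  by (rule real_linear_form_nonzero) (use assms in \<open>auto simp: upper_half_space_def\<close>)

lemma SL2_bottom_row: "A \<in> carrier (SL2 S) \<Longrightarrow> (A $ 2 $ 1, A $ 2 $ 2) \<noteq> (0, 0)"
  by (auto simp: SL2_iff)

lemma aut_factor_nonzero:
  assumes "A \<in> carrier (SL2 S)" "z \<in> upper_half_space"
  shows "aut_factor \<sigma> A z $ j \<noteq> 0"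
  using linear_form_nonzero[OF assms(2) SL2_bottom_row[OF assms(1)]] by (simp add: aut_factor_def)

lemma Im_moebius_act:
  assumes "A \<in> carrier (SL2 S)" "z \<in> upper_half_space"
  shows "Im (moebius_act \<sigma> A z $ j) = Im (z $ j) / (cmod (aut_factor \<sigma> A z $ j))\<^sup>2"
proof -
  have "A $ 1 $ 1 * A $ 2 $ 2 - A $ 1 $ 2 * A $ 2 $ 1 = 1" using assms(1) by (simp add: SL2_iff)
  then have "\<sigma> j (A $ 1 $ 1 * A $ 2 $ 2 - A $ 1 $ 2 * A $ 2 $ 1) = 1" by simp
  moreover have "Im (z $ j) > 0" using assms(2) by (simp add: upper_half_space_def)
  ultimately show ?thesis by (simp add: moebius_act_def Im_moebius aut_factor_def)
qed

lemma moebius_act_upper_half_space: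
  assumes "A \<in> carrier (SL2 S)" "z \<in> upper_half_space"
  shows "moebius_act \<sigma> A z \<in> upper_half_space"
  using assms aut_factor_nonzero[OF assms]
  by (auto simp: upper_half_space_def Im_moebius_act[OF assms])

text \<open>The cocycle relation, stated for an arbitrary row vector so that one identity serves
  numerators, denominators and unit forms.\<close>

lemma linear_form_moebius:
  assumes "A \<in> carrier (SL2 S)" "z \<in> upper_half_space"
  shows "of_real (\<sigma> j (fst v)) * moebius_act \<sigma> A z $ j + of_real (\<sigma> j (snd v))
    = (of_real (\<sigma> j (fst (act_right v A))) * z $ j + of_real (\<sigma> j (snd (act_right v A))))
      / aut_factor \<sigma> A z $ j"
  using aut_factor_nonzero[OF assms, of j]
  by (simp add: moebius_act_def aut_factor_def act_right_def field_simps)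

lemma cmod_unit_form_moebius:
  assumes "A \<in> carrier (SL2 S)" "z \<in> upper_half_space"
  shows "cmod (unit_form \<sigma> (moebius_act \<sigma> A z) v j) = cmod (unit_form \<sigma> z (act_right v A) j)"
proof -
  have y: "Im (z $ j) > 0" using assms(2) by (simp add: upper_half_space_def)
  have n: "cmod (aut_factor \<sigma> A z $ j) > 0" using aut_factor_nonzero[OF assms] by simp
  have "sqrt (Im (moebius_act \<sigma> A z $ j)) = sqrt (Im (z $ j)) / cmod (aut_factor \<sigma> A z $ j)"
    using n by (simp add: Im_moebius_act[OF assms] real_sqrt_divide)
  then show ?thesis
    unfolding unit_form_def linear_form_moebius[OF assms] norm_divide
    using n y by (simp add: norm_divide)
qed

lemma moebius_act_mult:
  assumes "A \<in> carrier (SL2 S)" "B \<in> carrier (SL2 S')" "z \<in> upper_half_space"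
  shows "moebius_act \<sigma> (A ** B) z = moebius_act \<sigma> A (moebius_act \<sigma> B z)"
proof -
  have "moebius_act \<sigma> (A ** B) z $ j = moebius_act \<sigma> A (moebius_act \<sigma> B z) $ j" for j
  proof -
    note lf = linear_form_moebius[OF assms(2,3), of j]
    have nz: "aut_factor \<sigma> B z $ j \<noteq> 0" by (rule aut_factor_nonzero[OF assms(2,3)])
    have "moebius_act \<sigma> A (moebius_act \<sigma> B z) $ j =
      (of_real (\<sigma> j (fst (act_right (A $ 1 $ 1, A $ 1 $ 2) B))) * z $ j
        + of_real (\<sigma> j (snd (act_right (A $ 1 $ 1, A $ 1 $ 2) B)))) /
      (of_real (\<sigma> j (fst (act_right (A $ 2 $ 1, A $ 2 $ 2) B))) * z $ j
        + of_real (\<sigma> j (snd (act_right (A $ 2 $ 1, A $ 2 $ 2) B))))"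
      using lf[of "(A $ 1 $ 1, A $ 1 $ 2)"] lf[of "(A $ 2 $ 1, A $ 2 $ 2)"] nz
      by (simp add: moebius_act_def[of \<sigma> A])
    then show ?thesis by (simp add: moebius_act_def[of \<sigma> "A ** B"] act_right_def matrix_mult_2)
  qed
  then show ?thesis by (simp add: vec_eq_iff)
qed

lemma SL2_mult:
  assumes "A \<in> carrier (SL2 UNIV)" "B \<in> carrier (SL2 UNIV)"
  shows "A ** B \<in> carrier (SL2 UNIV)"
  using assms by (simp add: SL2_def det_mul)

lemma moebius_act_one: "moebius_act \<sigma> (mat 1) z = z"
  by (simp add: moebius_act_def mat_def vec_eq_iff)

text \<open>With V the matrix of rows (p, q), (r, s) and X that of the \<open>x\<close>'s, the
  matrix sought is V^(-1) (V + n X) = 1 + (n / d) adj(V) X. It is integral because n / d is, and its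
  determinant is 1 because V and V + n X both have determinant d.\<close>

lemma congruent_bases:
  fixes x1 x2 x3 x4 :: 'k
  assumes "p * s - q * r = d" "d \<noteq> 0" "algebraic_int (of_nat n / d)"
    and int: "algebraic_int p" "algebraic_int q" "algebraic_int r" "algebraic_int s"
      "algebraic_int x1" "algebraic_int x2" "algebraic_int x3" "algebraic_int x4"
    and det: "(p + of_nat n * x1) * (s + of_nat n * x4) - (q + of_nat n * x2) * (r + of_nat n * x3) = d"
  obtains A where "A \<in> carrier (SL2 ring_of_integers)"
    "act_right (p, q) A = (p + of_nat n * x1, q + of_nat n * x2)"
    "act_right (r, s) A = (r + of_nat n * x3, s + of_nat n * x4)"
proof -
  define e where "e = of_nat n / d"
  have n: "of_nat n = e * (p * s - q * r)" using assms(1,2) by (simp add: e_def)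
  define a11 a12 a21 a22 where defs: "a11 = 1 + e * (s * x1 - q * x3)" "a12 = e * (s * x2 - q * x4)"
    "a21 = e * (p * x3 - r * x1)" "a22 = 1 + e * (p * x4 - r * x2)"
  define A :: "'k^2^2" where "A = vector [vector [a11, a12], vector [a21, a22]]"
  have A: "A $ 1 $ 1 = a11" "A $ 1 $ 2 = a12" "A $ 2 $ 1 = a21" "A $ 2 $ 2 = a22"
    by (simp_all add: A_def)
  have r1: "act_right (p, q) A = (p + of_nat n * x1, q + of_nat n * x2)"
    unfolding n by (simp add: act_right_def A defs algebra_simps)
  have r2: "act_right (r, s) A = (r + of_nat n * x3, s + of_nat n * x4)"
    unfolding n by (simp add: act_right_def A defs algebra_simps)
  have "(a11 * a22 - a12 * a21) * (p * s - q * r)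
    = (p * a11 + q * a21) * (r * a12 + s * a22) - (p * a12 + q * a22) * (r * a11 + s * a21)"
    by (simp add: algebra_simps)
  also have "\<dots> = d" using r1 r2 det by (simp add: act_right_def A)
  finally have "a11 * a22 - a12 * a21 = 1" using assms(1,2) by simp
  moreover have "algebraic_int e" using assms(3) by (simp add: e_def)
  then have "A $ i $ j \<in> ring_of_integers" for i j
    using int exhaust_2[of i] exhaust_2[of j]
    by (auto simp: A defs ring_of_integers_def
        intro!: algebraic_int_plus algebraic_int_times algebraic_int_diff
          algebraic_int_of_nat[of 1, simplified])
  ultimately have "A \<in> carrier (SL2 ring_of_integers)" by (simp add: SL2_iff A)
  then show thesis using that r1 r2 by blast
qed

lemma lattice_congruent:
  assumes "(\<lambda>i. k i mod int n) = (\<lambda>i. l i mod int n)"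
  obtains x where "x \<in> lattice"
    "(\<Sum>i\<in>UNIV. of_int (k i) * b i) = (\<Sum>i\<in>UNIV. of_int (l i) * b i) + of_nat n * x"
proof -
  have "int n dvd k i - l i" for i
    using fun_cong[OF assms, of i] by (simp add: mod_eq_dvd_iff)
  then obtain m where m: "\<And>i. k i - l i = int n * m i" unfolding dvd_def by metis
  have "(of_int (k i) :: 'k) = of_int (l i) + of_nat n * of_int (m i)" for i
  proof -
    have "k i = l i + int n * m i" using m[of i] by simp
    then show ?thesis by simp
  qed
  then have "(\<Sum>i\<in>UNIV. of_int (k i) * b i)
    = (\<Sum>i\<in>UNIV. of_int (l i) * b i) + of_nat n * (\<Sum>i\<in>UNIV. of_int (m i) * b i)"
    by (simp add: distrib_right sum.distrib sum_distrib_left mult.assoc)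
  then show thesis using that[of "\<Sum>i\<in>UNIV. of_int (m i) * b i"] by (auto simp: lattice_def)
qed

lemma finite_bounded_quotients:
  assumes "D > 0"
  shows "finite {d. of_nat D * d \<in> lattice \<and> (\<forall>j. \<bar>\<sigma> j d\<bar> \<le> B)}"
proof -
  have "{d. of_nat D * d \<in> lattice \<and> (\<forall>j. \<bar>\<sigma> j d\<bar> \<le> B)}
      \<subseteq> (\<lambda>x. x / of_nat D) ` {x \<in> lattice. \<forall>j. \<bar>\<sigma> j x\<bar> \<le> real D * B}"
  proof
    fix d assume d: "d \<in> {d. of_nat D * d \<in> lattice \<and> (\<forall>j. \<bar>\<sigma> j d\<bar> \<le> B)}"
    then have "of_nat D * d \<in> {x \<in> lattice. \<forall>j. \<bar>\<sigma> j x\<bar> \<le> real D * B}"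
      by (auto simp: abs_mult mult_left_mono)
    moreover have "d = of_nat D * d / of_nat D" using assms by simp
    ultimately show "d \<in> (\<lambda>x. x / of_nat D) ` {x \<in> lattice. \<forall>j. \<bar>\<sigma> j x\<bar> \<le> real D * B}"
      by (rule rev_image_eqI)
  qed
  then show ?thesis by (rule finite_subset) (intro finite_imageI finite_lattice_bounded)
qed

text \<open>Pairs of the same determinant \<open>d\<close> that are congruent modulo a multiple of \<open>d\<close> differ by
  an element of \<open>SL\<^sub>2\<close> over the integers.\<close>

lemma finite_base_representatives:
  obtains P :: "(('k \<times> 'k) \<times> ('k \<times> 'k)) set" where "finite P"
    "\<And>v w. (v, w) \<in> P \<Longrightarrow> fst v * snd w \<noteq> fst w * snd v"
    "\<And>v w. v \<in> lattice \<times> lattice \<Longrightarrow> w \<in> lattice \<times> lattice \<Longrightarrow> fst v * snd w \<noteq> fst w * snd v \<Longrightarrow>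
      (\<And>j. \<bar>\<sigma> j (fst v * snd w - fst w * snd v)\<bar> \<le> B) \<Longrightarrow>
      \<exists>v0 w0 A. (v0, w0) \<in> P \<and> A \<in> carrier (SL2 ring_of_integers) \<and>
        act_right v0 A = v \<and> act_right w0 A = w"
proof -
  define dt :: "('k \<times> 'k) \<times> ('k \<times> 'k) \<Rightarrow> 'k" where "dt p = fst (fst p) * snd (snd p) - fst (snd p) * snd (fst p)" for p
  obtain D :: nat where D: "D > 0" "\<And>x y. x \<in> lattice \<Longrightarrow> y \<in> lattice \<Longrightarrow> of_nat D * (x * y) \<in> lattice"
    by (rule lattice_mult) blast
  define \<Delta> where "\<Delta> = {d. of_nat D * d \<in> lattice \<and> (\<forall>j. \<bar>\<sigma> j d\<bar> \<le> B)}"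
  have \<Delta>: "finite \<Delta>" unfolding \<Delta>_def by (rule finite_bounded_quotients[OF D(1)])
  have "\<forall>d::'k. \<exists>n::nat. n > 0 \<and> algebraic_int (of_nat n / d)"
  proof
    fix d :: 'k
    obtain n :: nat where "n > 0" "algebraic_int (of_nat n * (1 / d))"
      by (rule ex_multiple_algebraic_int[OF span])
    then show "\<exists>n::nat. n > 0 \<and> algebraic_int (of_nat n / d)" by auto
  qed
  then obtain n :: "'k \<Rightarrow> nat" where n: "\<And>d. n d > 0" "\<And>d. algebraic_int (of_nat (n d) / d)" by metis
  define co where "co = inv_into UNIV (\<lambda>k :: 'n \<Rightarrow> int. \<Sum>i\<in>UNIV. of_int (k i) * b i)"
  have co: "(\<Sum>i\<in>UNIV. of_int (co x i) * b i) = x" if "x \<in> lattice" for x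
    using f_inv_into_f[of x "\<lambda>k :: 'n \<Rightarrow> int. \<Sum>i\<in>UNIV. of_int (k i) * b i" UNIV] that
    by (simp add: co_def lattice_def)
  define rs where "rs d x = (\<lambda>i. co x i mod int (n d))" for d x
  have rs: "rs d x \<in> PiE UNIV (\<lambda>_. {0..<int (n d)})" for d x
    using n(1)[of d] by (auto simp: rs_def)
  \<comment> \<open>The modulus \<open>n d\<close> varies with the determinant \<open>d\<close>, so
    the key records \<open>d\<close> first and then the residues of the four entries. Finitely many
    \<open>d\<close> occur, because after multiplication by \<open>D\<close> they are bounded
    lattice points.\<close>
  define key where "key p = (dt p, rs (dt p) (fst (fst p)), rs (dt p) (snd (fst p)),
      rs (dt p) (fst (snd p)), rs (dt p) (snd (snd p)))" for p
  define X where "X = {p \<in> (lattice \<times> lattice) \<times> (lattice \<times> lattice). dt p \<noteq> 0 \<and> (\<forall>j. \<bar>\<sigma> j (dt p)\<bar> \<le> B)}"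
  have "key ` X \<subseteq> (SIGMA d:\<Delta>. PiE UNIV (\<lambda>_. {0..<int (n d)}) \<times> PiE UNIV (\<lambda>_. {0..<int (n d)})
      \<times> PiE UNIV (\<lambda>_. {0..<int (n d)}) \<times> PiE UNIV (\<lambda>_. {0..<int (n d)}))"
  proof (rule image_subsetI)
    fix p assume p: "p \<in> X"
    have "of_nat D * dt p = of_nat D * (fst (fst p) * snd (snd p)) - of_nat D * (fst (snd p) * snd (fst p))"
      by (simp add: dt_def right_diff_distrib)
    also have "\<dots> \<in> lattice"
      using p by (intro lattice_diff D(2)) (auto simp: X_def mem_Times_iff)
    finally have "dt p \<in> \<Delta>" using p by (simp add: \<Delta>_def X_def)
    then show "key p \<in> (SIGMA d:\<Delta>. PiE UNIV (\<lambda>_. {0..<int (n d)}) \<times> PiE UNIV (\<lambda>_. {0..<int (n d)})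
      \<times> PiE UNIV (\<lambda>_. {0..<int (n d)}) \<times> PiE UNIV (\<lambda>_. {0..<int (n d)}))"
      unfolding key_def by (intro SigmaI rs)
  qed
  then have "finite (key ` X)"
    by (rule finite_subset) (intro finite_SigmaI \<Delta> finite_PiE finite; simp)
  then obtain P where P: "finite P" "P \<subseteq> X" "\<And>p. p \<in> X \<Longrightarrow> \<exists>q\<in>P. key q = key p"
    by (rule finite_representatives) blast
  show thesis
  proof (rule that[OF P(1)])
    fix v w assume "(v, w) \<in> P"
    then show "fst v * snd w \<noteq> fst w * snd v" using P(2) by (auto simp: X_def dt_def)
  next
    fix v w
    assume vw: "v \<in> lattice \<times> lattice" "w \<in> lattice \<times> lattice" "fst v * snd w \<noteq> fst w * snd v"
      "\<And>j. \<bar>\<sigma> j (fst v * snd w - fst w * snd v)\<bar> \<le> B"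
    then have X: "(v, w) \<in> X" by (auto simp: X_def dt_def mem_Times_iff)
    then obtain v0 w0 where vw0: "(v0, w0) \<in> P" and key: "key (v0, w0) = key (v, w)"
      using P(3)[of "(v, w)"] by (metis prod.collapse)
    define d where "d = dt (v, w)"
    have d: "d \<noteq> 0" "dt (v0, w0) = d" using X key by (auto simp: d_def X_def key_def)
    have L: "fst v \<in> lattice" "snd v \<in> lattice" "fst w \<in> lattice" "snd w \<in> lattice"
      "fst v0 \<in> lattice" "snd v0 \<in> lattice" "fst w0 \<in> lattice" "snd w0 \<in> lattice"
      using X vw0 P(2) by (auto simp: X_def mem_Times_iff)
    have cg: "\<exists>e. e \<in> lattice \<and> x = x0 + of_nat (n d) * e"
      if "rs d x = rs d x0" "x \<in> lattice" "x0 \<in> lattice" for x x0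
      using lattice_congruent[OF that(1)[unfolded rs_def]] co[OF that(2)] co[OF that(3)] by metis
    obtain e1 e2 e3 e4 where e: "e1 \<in> lattice" "e2 \<in> lattice" "e3 \<in> lattice" "e4 \<in> lattice"
      "fst v = fst v0 + of_nat (n d) * e1" "snd v = snd v0 + of_nat (n d) * e2"
      "fst w = fst w0 + of_nat (n d) * e3" "snd w = snd w0 + of_nat (n d) * e4"
    proof -
      have "rs d (fst v) = rs d (fst v0)" "rs d (snd v) = rs d (snd v0)"
        "rs d (fst w) = rs d (fst w0)" "rs d (snd w) = rs d (snd w0)"
        using key d(2) by (auto simp: key_def d_def[symmetric])
      then show thesis using that cg L by meson
    qed
    have "fst v0 * snd w0 - snd v0 * fst w0 = d" using d(2) by (simp add: dt_def mult.commute)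
    moreover have "(fst v0 + of_nat (n d) * e1) * (snd w0 + of_nat (n d) * e4)
        - (snd v0 + of_nat (n d) * e2) * (fst w0 + of_nat (n d) * e3) = d"
      unfolding e(5-8)[symmetric] by (simp add: d_def dt_def mult.commute)
    ultimately obtain A where "A \<in> carrier (SL2 ring_of_integers)"
      "act_right (fst v0, snd v0) A = (fst v0 + of_nat (n d) * e1, snd v0 + of_nat (n d) * e2)"
      "act_right (fst w0, snd w0) A = (fst w0 + of_nat (n d) * e3, snd w0 + of_nat (n d) * e4)"
      using congruent_bases[OF _ d(1) n(2)] L(5-8) e(1-4) lattice_algebraic_int by metis
    then show "\<exists>v0 w0 A. (v0, w0) \<in> P \<and> A \<in> carrier (SL2 ring_of_integers) \<and>
        act_right v0 A = v \<and> act_right w0 A = w"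
      using vw0 by (intro exI[of _ v0] exI[of _ w0] exI[of _ A]) (simp add: e(5-8)[symmetric])
  qed
qed

lemma Im_conj_mult_forms:
  fixes c d c' d' :: real
  shows "Im (cnj (of_real c * w + of_real d) * (of_real c' * w + of_real d')) = Im w * (c' * d - c * d')"
  by (simp add: algebra_simps)

text \<open>Up to sign, Im z times the determinant is Im (conj V * W) for the values V, W of the two
  forms, hence at most |V| |W|.\<close>

lemma \<sigma>_det_le:
  assumes z: "z \<in> upper_half_space" and R: "R \<ge> 0"
    and v: "cmod (unit_form \<sigma> z v j) \<le> R" and w: "cmod (unit_form \<sigma> z w j) \<le> R"
  shows "\<bar>\<sigma> j (fst v * snd w - fst w * snd v)\<bar> \<le> R * R"
proof -
  have y: "Im (z $ j) > 0" using z by (simp add: upper_half_space_def)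
  define V where "V = of_real (\<sigma> j (fst v)) * z $ j + of_real (\<sigma> j (snd v))"
  define W where "W = of_real (\<sigma> j (fst w)) * z $ j + of_real (\<sigma> j (snd w))"
  have "cmod V \<le> R * sqrt (Im (z $ j))" "cmod W \<le> R * sqrt (Im (z $ j))"
    using v w y by (simp_all add: unit_form_def V_def W_def norm_divide divide_le_eq)
  then have "cmod V * cmod W \<le> (R * sqrt (Im (z $ j))) * (R * sqrt (Im (z $ j)))"
    using R y by (intro mult_mono) auto
  also have "\<dots> = Im (z $ j) * (R * R)" using y by simp
  finally have "\<bar>Im (cnj V * W)\<bar> \<le> Im (z $ j) * (R * R)"
    using abs_Im_le_cmod[of "cnj V * W"] by (simp add: norm_mult)
  then have "Im (z $ j) * \<bar>\<sigma> j (fst w) * \<sigma> j (snd v) - \<sigma> j (fst v) * \<sigma> j (snd w)\<bar> \<le> Im (z $ j) * (R * R)"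
    unfolding V_def W_def Im_conj_mult_forms abs_mult using y by simp
  then show ?thesis using y by (simp add: abs_minus_commute)
qed

text \<open>A short basis at \<open>z\<close> has a determinant bounded at every place, so it is
  \<open>v0 A\<close>, \<open>w0 A\<close> for one of finitely many pairs in \<open>P\<close>. By
  invariance of the unit forms, \<open>v0\<close> and \<open>w0\<close> are short at the point A z,
  and \<open>bounded_by_two_forms\<close> confines that point. Only finitely many pairs and places
  occur, so one \<open>a\<close> serves for all.\<close>

lemma thick_part_cocompact:
  assumes "\<epsilon> > 0"
  obtains a where "a > 0"
    "\<And>z. z \<in> upper_half_space \<Longrightarrow>
      (\<And>v. v \<in> lattice \<times> lattice \<Longrightarrow> v \<noteq> 0 \<Longrightarrow> (\<Prod>j\<in>UNIV. (cmod (unit_form \<sigma> z v j))\<^sup>2) > \<epsilon>) \<Longrightarrow>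
      \<exists>A\<in>carrier (SL2 ring_of_integers).
        \<forall>j. cmod (moebius_act \<sigma> A z $ j) \<le> a \<and> 1 / a \<le> Im (moebius_act \<sigma> A z $ j)"
proof -
  obtain R where R: "R > 0" and short: "\<And>z. z \<in> upper_half_space \<Longrightarrow>
      (\<And>v. v \<in> lattice \<times> lattice \<Longrightarrow> v \<noteq> 0 \<Longrightarrow> (\<Prod>j\<in>UNIV. (cmod (unit_form \<sigma> z v j))\<^sup>2) > \<epsilon>) \<Longrightarrow>
      \<exists>v\<in>lattice \<times> lattice. \<exists>w\<in>lattice \<times> lattice. fst v * snd w \<noteq> fst w * snd v \<and>
        (\<forall>j. cmod (unit_form \<sigma> z v j) \<le> R) \<and> (\<forall>j. cmod (unit_form \<sigma> z w j) \<le> R)"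
    using ex_short_basis[OF assms] by metis
  obtain P where P: "finite P" "\<And>v w. (v, w) \<in> P \<Longrightarrow> fst v * snd w \<noteq> fst w * snd v"
    "\<And>v w. v \<in> lattice \<times> lattice \<Longrightarrow> w \<in> lattice \<times> lattice \<Longrightarrow> fst v * snd w \<noteq> fst w * snd v \<Longrightarrow>
      (\<And>j. \<bar>\<sigma> j (fst v * snd w - fst w * snd v)\<bar> \<le> R * R) \<Longrightarrow>
      \<exists>v0 w0 A. (v0, w0) \<in> P \<and> A \<in> carrier (SL2 ring_of_integers) \<and>
        act_right v0 A = v \<and> act_right w0 A = w"
    using finite_base_representatives[of "R * R"] by metis
  have "\<forall>p\<in>P \<times> UNIV. \<exists>a>0. \<forall>w. Im w > 0 \<longrightarrow>
      cmod (of_real (\<sigma> (snd p) (fst (fst (fst p)))) * w + of_real (\<sigma> (snd p) (snd (fst (fst p))))) \<le> R * sqrt (Im w) \<longrightarrow>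
      cmod (of_real (\<sigma> (snd p) (fst (snd (fst p)))) * w + of_real (\<sigma> (snd p) (snd (snd (fst p))))) \<le> R * sqrt (Im w) \<longrightarrow>
      cmod w \<le> a \<and> 1 / a \<le> Im w"
  proof
    fix p assume "p \<in> P \<times> (UNIV :: 'n set)"
    then obtain v w j where p: "p = ((v, w), j)" "(v, w) \<in> P" by auto
    have "\<sigma> j (fst v * snd w - fst w * snd v) \<noteq> 0"
      using P(2)[OF p(2)] by (subst \<sigma>_simps(10)) simp
    then have "\<sigma> j (fst v) * \<sigma> j (snd w) - \<sigma> j (fst w) * \<sigma> j (snd v) \<noteq> 0" by simp
    then show "\<exists>a>0. \<forall>w. Im w > 0 \<longrightarrow>
      cmod (of_real (\<sigma> (snd p) (fst (fst (fst p)))) * w + of_real (\<sigma> (snd p) (snd (fst (fst p))))) \<le> R * sqrt (Im w) \<longrightarrow>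
      cmod (of_real (\<sigma> (snd p) (fst (snd (fst p)))) * w + of_real (\<sigma> (snd p) (snd (snd (fst p))))) \<le> R * sqrt (Im w) \<longrightarrow>
      cmod w \<le> a \<and> 1 / a \<le> Im w"
      unfolding p(1) fst_conv snd_conv by (rule bounded_by_two_forms[OF _ R]) blast
  qed
  then obtain f where f: "\<And>p. p \<in> P \<times> UNIV \<Longrightarrow> f p > 0" "\<And>p w. p \<in> P \<times> UNIV \<Longrightarrow> Im w > 0 \<Longrightarrow>
      cmod (of_real (\<sigma> (snd p) (fst (fst (fst p)))) * w + of_real (\<sigma> (snd p) (snd (fst (fst p))))) \<le> R * sqrt (Im w) \<Longrightarrow>
      cmod (of_real (\<sigma> (snd p) (fst (snd (fst p)))) * w + of_real (\<sigma> (snd p) (snd (snd (fst p))))) \<le> R * sqrt (Im w) \<Longrightarrow>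
      cmod w \<le> f p \<and> 1 / f p \<le> Im w"
    by (metis (no_types, lifting))
  define a where "a = 1 + sum f (P \<times> UNIV)"
  have "sum f (P \<times> UNIV) \<ge> 0" using f(1) by (intro sum_nonneg) (simp add: less_imp_le)
  then have a: "a > 0" by (simp add: a_def)
  have fa: "f p \<le> a" if "p \<in> P \<times> UNIV" for p
    using member_le_sum[OF that, of f] f(1) P(1) by (simp add: a_def less_imp_le)
  show thesis
  proof (rule that[OF a])
    fix z :: "complex^'n"
    assume z: "z \<in> upper_half_space" and
      th: "\<And>v. v \<in> lattice \<times> lattice \<Longrightarrow> v \<noteq> 0 \<Longrightarrow> (\<Prod>j\<in>UNIV. (cmod (unit_form \<sigma> z v j))\<^sup>2) > \<epsilon>"
    obtain v w where vw: "v \<in> lattice \<times> lattice" "w \<in> lattice \<times> lattice" "fst v * snd w \<noteq> fst w * snd v"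
        "\<And>j. cmod (unit_form \<sigma> z v j) \<le> R" "\<And>j. cmod (unit_form \<sigma> z w j) \<le> R"
      using short[OF z th] by blast
    have "\<bar>\<sigma> j (fst v * snd w - fst w * snd v)\<bar> \<le> R * R" for j
      by (rule \<sigma>_det_le[OF z _ vw(4,5)]) (use R in simp)
    from P(3)[OF vw(1,2,3) this] obtain v0 w0 A where A: "(v0, w0) \<in> P" "A \<in> carrier (SL2 ring_of_integers)"
        "act_right v0 A = v" "act_right w0 A = w" by blast
    define \<zeta> where "\<zeta> = moebius_act \<sigma> A z"
    have y: "Im (\<zeta> $ j) > 0" for j
      using moebius_act_upper_half_space[OF A(2) z] by (simp add: \<zeta>_def upper_half_space_def)
    have b: "cmod (unit_form \<sigma> \<zeta> v0 j) \<le> R" "cmod (unit_form \<sigma> \<zeta> w0 j) \<le> R" for j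
      using vw(4,5) A(3,4) by (simp_all add: \<zeta>_def cmod_unit_form_moebius[OF A(2) z])
    have "cmod (\<zeta> $ j) \<le> a \<and> 1 / a \<le> Im (\<zeta> $ j)" for j
    proof -
      let ?p = "((v0, w0), j)"
      have p: "?p \<in> P \<times> UNIV" using A(1) by simp
      have "cmod (\<zeta> $ j) \<le> f ?p \<and> 1 / f ?p \<le> Im (\<zeta> $ j)"
        by (rule f(2)[OF p y]) (use b[of j] y[of j] in \<open>simp_all add: unit_form_def norm_divide divide_le_eq\<close>)
      moreover have "1 / a \<le> 1 / f ?p" using fa[OF p] f(1)[OF p] by (simp add: frac_le)
      ultimately show ?thesis using fa[OF p] by linarith
    qed
    then show "\<exists>A\<in>carrier (SL2 ring_of_integers).
        \<forall>j. cmod (moebius_act \<sigma> A z $ j) \<le> a \<and> 1 / a \<le> Im (moebius_act \<sigma> A z $ j)"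
      using A(2) by (intro bexI[of _ A]) (simp_all add: \<zeta>_def)
  qed
qed

end

section \<open>Boundedness of automorphic functions that are bounded at the cusps\<close>

text \<open>The inverse on determinant 1; explicit entries keep it over any subring.\<close>

definition adj2 :: "'a::field^2^2 \<Rightarrow> 'a^2^2"
  where "adj2 A = vector [vector [A $ 2 $ 2, - A $ 1 $ 2], vector [- A $ 2 $ 1, A $ 1 $ 1]]"

lemma adj2_nth [simp]:
  "adj2 A $ 1 $ 1 = A $ 2 $ 2" "adj2 A $ 1 $ 2 = - A $ 1 $ 2"
  "adj2 A $ 2 $ 1 = - A $ 2 $ 1" "adj2 A $ 2 $ 2 = A $ 1 $ 1"
  by (simp_all add: adj2_def)

lemma matrix_eq_2:
  fixes A B :: "'a^2^2"
  shows "A = B \<longleftrightarrow> A $ 1 $ 1 = B $ 1 $ 1 \<and> A $ 1 $ 2 = B $ 1 $ 2 \<and> A $ 2 $ 1 = B $ 2 $ 1 \<and> A $ 2 $ 2 = B $ 2 $ 2"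
  by (auto simp: vec_eq_iff forall_2)

lemma mult_adj2:
  assumes "A \<in> carrier (SL2 S)"
  shows "A ** adj2 A = mat 1" "adj2 A ** A = mat 1"
proof -
  have d: "A $ 1 $ 1 * A $ 2 $ 2 - A $ 1 $ 2 * A $ 2 $ 1 = 1" using assms by (simp add: SL2_iff)
  show "A ** adj2 A = mat 1" "adj2 A ** A = mat 1"
    unfolding matrix_eq_2 matrix_mult_2 adj2_nth using d by (auto simp: mat_def algebra_simps)
qed

lemma adj2_SL2:
  assumes "A \<in> carrier (SL2 S)" "\<And>x. x \<in> S \<Longrightarrow> - x \<in> S"
  shows "adj2 A \<in> carrier (SL2 S)"
  using assms by (simp add: SL2_iff forall_2 algebra_simps)

lemma mat_1_SL2: "0 \<in> S \<Longrightarrow> 1 \<in> S \<Longrightarrow> mat 1 \<in> carrier (SL2 S)"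
  by (simp add: SL2_def mat_def det_2)

lemma SL2_subset_UNIV: "A \<in> carrier (SL2 S) \<Longrightarrow> A \<in> carrier (SL2 UNIV)"
  by (simp add: SL2_iff)

text \<open>Right cosets put the factor from \<open>U\<close> on the left: there it is absorbed by
  an invariant function, or, if integral, leaves denominators unchanged. Both uses occur in
  \<open>bounded_if_bounded_at_cusps\<close>.\<close>

lemma finite_index_representatives:
  fixes U H :: "('k::field^2^2) set"
  assumes "finite_index_in (SL2 UNIV) U H" "mat 1 \<in> U"
  obtains R where "finite R" "R \<subseteq> H" "\<And>A. A \<in> H \<Longrightarrow> \<exists>u\<in>U. \<exists>r\<in>R. A = u ** r"
proof -
  define f :: "'k^2^2 \<Rightarrow> ('k^2^2) set" where "f A = (\<lambda>u. u ** A) ` U" for A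
  have "rcosets\<^bsub>SL2 UNIV\<lparr>carrier := H\<rparr>\<^esub> U = f ` H"
    by (auto simp: RCOSETS_def r_coset_def f_def SL2_def)
  then have "finite (f ` H)" using assms(1) by (simp add: finite_index_in_def)
  then obtain R where R: "finite R" "R \<subseteq> H" "\<And>x. x \<in> H \<Longrightarrow> \<exists>y\<in>R. f y = f x"
    by (rule finite_representatives) blast
  have "\<exists>u\<in>U. \<exists>r\<in>R. A = u ** r" if A: "A \<in> H" for A
  proof -
    obtain r where r: "r \<in> R" "f r = f A" using R(3)[OF A] by blast
    have "A \<in> f A" using assms(2) by (auto simp: f_def intro!: image_eqI[of _ _ "mat 1"])
    then have "A \<in> f r" using r(2) by simp
    then show ?thesis using r(1) by (auto simp: f_def)
  qed
  with R(1,2) show thesis by (rule that)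
qed

lemma compact_box:
  "compact {\<zeta> :: complex^'n. \<forall>j. cmod (\<zeta> $ j) \<le> a \<and> e \<le> Im (\<zeta> $ j)}"
proof -
  have "closed {\<zeta> :: complex^'n. \<forall>j. cmod (\<zeta> $ j) \<le> a \<and> e \<le> Im (\<zeta> $ j)}"
    by (intro closed_Collect_all closed_Collect_conj closed_Collect_le continuous_intros)
  moreover have "norm \<zeta> \<le> (\<Sum>j\<in>(UNIV::'n set). a)"
    if "\<forall>j. cmod (\<zeta> $ j) \<le> a \<and> e \<le> Im (\<zeta> $ j)" for \<zeta> :: "complex^'n"
  proof -
    have "norm \<zeta> \<le> (\<Sum>j\<in>UNIV. cmod (\<zeta> $ j))"
      unfolding norm_vec_def by (rule L2_set_le_sum) simp
    also have "\<dots> \<le> (\<Sum>j\<in>(UNIV::'n set). a)" using that by (intro sum_mono) simp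
    finally show ?thesis .
  qed
  then have "bounded {\<zeta> :: complex^'n. \<forall>j. cmod (\<zeta> $ j) \<le> a \<and> e \<le> Im (\<zeta> $ j)}"
    unfolding bounded_iff by blast
  ultimately show ?thesis by (simp add: compact_eq_bounded_closed)
qed

lemma uniform_bounds:
  assumes "finite I" "\<And>i. i \<in> I \<Longrightarrow> \<exists>N C :: real. \<forall>z. P z \<longrightarrow> f z \<ge> N \<longrightarrow> H i z \<le> C"
  obtains N C :: real where "N > 0" "\<And>i z. i \<in> I \<Longrightarrow> P z \<Longrightarrow> f z \<ge> N \<Longrightarrow> H i z \<le> C"
proof -
  have "\<exists>NC. \<forall>i\<in>I. \<forall>z. P z \<longrightarrow> f z \<ge> fst (NC i) \<longrightarrow> H i z \<le> snd (NC i)"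
    using assms(2) by (intro bchoice) auto
  then obtain NC :: "'a \<Rightarrow> real \<times> real"
    where NC: "\<And>i z. i \<in> I \<Longrightarrow> P z \<Longrightarrow> f z \<ge> fst (NC i) \<Longrightarrow> H i z \<le> snd (NC i)" by blast
  define N where "N = 1 + (\<Sum>i\<in>I. \<bar>fst (NC i)\<bar>)"
  define C where "C = (\<Sum>i\<in>I. \<bar>snd (NC i)\<bar>)"
  have "N > 0" unfolding N_def by (intro add_pos_nonneg sum_nonneg) auto
  moreover have "H i z \<le> C" if "i \<in> I" "P z" "f z \<ge> N" for i z
  proof -
    have "\<bar>fst (NC i)\<bar> \<le> (\<Sum>i\<in>I. \<bar>fst (NC i)\<bar>)" "\<bar>snd (NC i)\<bar> \<le> C"
      unfolding C_def using assms(1) that(1)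
      by (auto intro!: member_le_sum[of i I "\<lambda>i. \<bar>fst (NC i)\<bar>"] member_le_sum[of i I "\<lambda>i. \<bar>snd (NC i)\<bar>"])
    moreover have "f z \<ge> fst (NC i)" using calculation(1) that(3) unfolding N_def by linarith
    ultimately show ?thesis using NC[OF that(1,2)] by linarith
  qed
  ultimately show thesis by (rule that)
qed

context totally_real_basis
begin

lemma common_denominator:
  assumes "finite X"
  obtains m :: nat where "m > 0" "\<And>x :: 'k. x \<in> X \<Longrightarrow> algebraic_int (of_nat m * x)"
proof -
  have "\<exists>m::nat. m > 0 \<and> (\<forall>x\<in>X. algebraic_int (of_nat m * x))"
    using assms
  proof (induction X rule: finite_induct)
    case empty
    show ?case by (intro exI[of _ 1]) simp
  next
    case (insert x X)
    then obtain m :: nat where m: "m > 0" "\<forall>x\<in>X. algebraic_int (of_nat m * x)" by blast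
    obtain n :: nat where n: "n > 0" "algebraic_int (of_nat n * x)"
      by (rule ex_multiple_algebraic_int[OF span])
    have "algebraic_int (of_nat (m * n) * y)" if "y \<in> insert x X" for y
    proof (cases "y = x")
      case True
      have "of_nat (m * n) * y = of_nat m * (of_nat n * x)" using True by simp
      then show ?thesis using algebraic_int_times[OF algebraic_int_of_nat[of m] n(2)] by (simp only:)
    next
      case False
      have "of_nat (m * n) * y = of_nat n * (of_nat m * y)" by simp
      moreover have "algebraic_int (of_nat m * y)" using False m(2) that by simp
      ultimately show ?thesis using algebraic_int_times[OF algebraic_int_of_nat] by metis
    qed
    then show ?case using m(1) n(1) by (intro exI[of _ "m * n"]) simp
  qed
  then show thesis using that by blast
qed

lemma continuous_on_moebius_act:
  assumes "A \<in> carrier (SL2 S)"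
  shows "continuous_on upper_half_space (moebius_act \<sigma> A)"
  unfolding moebius_act_def
  by (intro continuous_on_vec_lambda continuous_intros ballI
      linear_form_nonzero[OF _ SL2_bottom_row[OF assms]])

lemma moebius_act_adj2:
  assumes "A \<in> carrier (SL2 S)" "z \<in> upper_half_space"
  shows "moebius_act \<sigma> A (moebius_act \<sigma> (adj2 A) z) = z"
    "moebius_act \<sigma> (adj2 A) (moebius_act \<sigma> A z) = z"
proof -
  have A: "A \<in> carrier (SL2 UNIV)" using assms(1) by (rule SL2_subset_UNIV)
  then have A': "adj2 A \<in> carrier (SL2 UNIV)" by (rule adj2_SL2) simp
  show "moebius_act \<sigma> A (moebius_act \<sigma> (adj2 A) z) = z"
    using moebius_act_mult[OF A A' assms(2)] by (simp add: mult_adj2[OF A] moebius_act_one)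
  show "moebius_act \<sigma> (adj2 A) (moebius_act \<sigma> A z) = z"
    using moebius_act_mult[OF A' A assms(2)] by (simp add: mult_adj2[OF A] moebius_act_one)
qed

text \<open>Here \<open>g\<close> takes infinity to the zero -d / c of the form, and its inverse has
  bottom row \<mu> (c, d). At each place the imaginary part of the image of \<open>z\<close> is
  therefore the inverse of |\<mu>|^2 times the squared unit form. Only the scalar \<mu> has to be
  controlled, and the denominator \<open>m\<close> bounds its norm.\<close>

lemma Norm_Im_ge_of_small_form:
  assumes z: "z \<in> upper_half_space" and g: "g \<in> carrier (SL2 UNIV)" and N: "N > 0" and m: "m > (0::nat)"
    and col: "g $ 1 $ 1 = \<mu> * d" "g $ 2 $ 1 = - (\<mu> * c)"
    and int: "algebraic_int c" "algebraic_int d"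
      "algebraic_int (of_nat m * g $ 1 $ 2)" "algebraic_int (of_nat m * g $ 2 $ 2)"
    and small: "(\<Prod>j\<in>UNIV. (cmod (unit_form \<sigma> z (c, d) j))\<^sup>2) \<le> 1 / (N * (real m ^ CARD('n))\<^sup>2)"
  shows "Norm_Im (moebius_act \<sigma> (adj2 g) z) \<ge> N"
proof -
  have g': "adj2 g \<in> carrier (SL2 UNIV)" using g by (rule adj2_SL2) simp
  \<comment> \<open>This is m / \<mu>, by the determinant of \<open>g\<close>. Being a nonzero
    algebraic integer it has norm at least 1 in absolute value, so that of \<mu> is at most
    \<open>m ^ CARD('n)\<close>.\<close>
  define \<alpha> where "\<alpha> = d * (of_nat m * g $ 2 $ 2) + c * (of_nat m * g $ 1 $ 2)"
  have "g $ 1 $ 1 * g $ 2 $ 2 - g $ 1 $ 2 * g $ 2 $ 1 = 1" using g by (simp add: SL2_iff)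
  then have one: "\<mu> * (d * g $ 2 $ 2 + c * g $ 1 $ 2) = 1" by (simp add: col algebra_simps)
  then have \<mu>\<alpha>: "\<mu> * \<alpha> = of_nat m"
  proof -
    have "\<mu> * \<alpha> = of_nat m * (\<mu> * (d * g $ 2 $ 2 + c * g $ 1 $ 2))" by (simp add: \<alpha>_def algebra_simps)
    then show ?thesis using one by simp
  qed
  have \<mu>0: "\<mu> \<noteq> 0" "\<alpha> \<noteq> 0" using \<mu>\<alpha> m by auto
  have "algebraic_int \<alpha>" unfolding \<alpha>_def by (intro algebraic_int_plus algebraic_int_times int)
  then have \<alpha>1: "(\<Prod>j\<in>UNIV. \<bar>\<sigma> j \<alpha>\<bar>) \<ge> 1" using \<mu>0(2) by (rule prod_\<sigma>_ge_1)
  have "(\<Prod>j\<in>UNIV. \<bar>\<sigma> j \<mu>\<bar>) * (\<Prod>j\<in>UNIV. \<bar>\<sigma> j \<alpha>\<bar>) = (\<Prod>j\<in>(UNIV::'n set). real m)"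
    unfolding prod.distrib[symmetric] abs_mult[symmetric] \<sigma>_simps(4)[symmetric] \<mu>\<alpha> by simp
  then have eqm: "(\<Prod>j\<in>UNIV. \<bar>\<sigma> j \<mu>\<bar>) * (\<Prod>j\<in>UNIV. \<bar>\<sigma> j \<alpha>\<bar>) = real m ^ CARD('n)" by simp
  have "(\<Prod>j\<in>UNIV. \<bar>\<sigma> j \<mu>\<bar>) * 1 \<le> real m ^ CARD('n)"
    unfolding eqm[symmetric] by (intro mult_left_mono \<alpha>1 prod_nonneg) simp
  then have \<mu>m: "(\<Prod>j\<in>UNIV. \<bar>\<sigma> j \<mu>\<bar>)\<^sup>2 \<le> (real m ^ CARD('n))\<^sup>2"
    by (intro power_mono prod_nonneg) auto
  have y: "Im (z $ j) > 0" for j using z by (simp add: upper_half_space_def)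
  define F where "F = (\<Prod>j\<in>UNIV. (cmod (unit_form \<sigma> z (c, d) j))\<^sup>2)"
  have cd: "(c, d) \<noteq> (0, 0)" using one by auto
  have uf: "cmod (unit_form \<sigma> z (c, d) j) > 0" for j
    using linear_form_nonzero[OF z cd] y[of j] by (simp add: unit_form_def)
  have F: "F > 0" unfolding F_def using uf by (intro prod_pos) simp
  have "Im (moebius_act \<sigma> (adj2 g) z $ j) = 1 / (\<bar>\<sigma> j \<mu>\<bar>\<^sup>2 * (cmod (unit_form \<sigma> z (c, d) j))\<^sup>2)" for j
  proof -
    have "aut_factor \<sigma> (adj2 g) z $ j
      = of_real (\<sigma> j \<mu>) * (of_real (\<sigma> j c) * z $ j + of_real (\<sigma> j d))"
      by (simp add: aut_factor_def col algebra_simps)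
    then have "(cmod (aut_factor \<sigma> (adj2 g) z $ j))\<^sup>2
      = \<bar>\<sigma> j \<mu>\<bar>\<^sup>2 * (Im (z $ j) * (cmod (unit_form \<sigma> z (c, d) j))\<^sup>2)"
      using y[of j] by (simp add: unit_form_def norm_mult norm_divide power_mult_distrib power_divide)
    then show ?thesis unfolding Im_moebius_act[OF g' z] using y[of j] uf[of j] \<mu>0 by (simp add: field_simps)
  qed
  then have "Norm_Im (moebius_act \<sigma> (adj2 g) z)
    = 1 / ((\<Prod>j\<in>UNIV. \<bar>\<sigma> j \<mu>\<bar>)\<^sup>2 * F)"
    by (simp add: Norm_Im_def F_def prod_dividef prod.distrib prod_power_distrib)
  moreover have "(\<Prod>j\<in>UNIV. \<bar>\<sigma> j \<mu>\<bar>)\<^sup>2 * F \<le> 1 / N"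
  proof -
    have "(\<Prod>j\<in>UNIV. \<bar>\<sigma> j \<mu>\<bar>)\<^sup>2 * F \<le> (real m ^ CARD('n))\<^sup>2 * (1 / (N * (real m ^ CARD('n))\<^sup>2))"
      using \<mu>m small F by (intro mult_mono) (auto simp: F_def)
    also have "\<dots> = 1 / N" using m by simp
    finally show ?thesis .
  qed
  moreover have "(\<Prod>j\<in>UNIV. \<bar>\<sigma> j \<mu>\<bar>)\<^sup>2 * F > 0"
    using F \<mu>0 by (intro mult_pos_pos zero_less_power prod_pos) auto
  ultimately show ?thesis using N by (simp add: le_divide_eq field_simps)
qed

text \<open>The first column of a matrix spans the image of infinity. A point of the projective line
  fixes that column only up to the scalar \<mu>.\<close>

lemma ex_cusp_column:
  fixes \<Gamma> :: "('k^2^2) set"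
  assumes cusps: "cusp_representatives \<Gamma> h c"
    and \<gamma>c: "\<And>i. i \<in> {1..h} \<Longrightarrow> proj_act (\<gamma>c i) proj_infinity = c i"
    and v: "(x, y) \<noteq> (0, 0)"
  obtains i \<gamma> \<mu> where "i \<in> {1..h}" "\<gamma> \<in> \<Gamma>"
    "(\<gamma> ** \<gamma>c i) $ 1 $ 1 = \<mu> * x" "(\<gamma> ** \<gamma>c i) $ 2 $ 1 = \<mu> * y"
proof -
  have "proj_point x y \<in> proj_line" using v unfolding proj_line_def by blast
  then obtain i \<gamma> where i: "i \<in> {1..h}" "\<gamma> \<in> \<Gamma>" "proj_act \<gamma> (c i) = proj_point x y"
    using cusps unfolding cusp_representatives_def by (metis (no_types, lifting))
  have "vector [1, 0] \<in> (proj_infinity :: ('k^2) set)"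
    unfolding proj_infinity_def proj_point_def by (rule vec.span_base) simp
  then have "\<gamma>c i *v vector [1, 0] \<in> c i"
    using \<gamma>c[OF i(1)] unfolding proj_act_def by blast
  then have "\<gamma> *v (\<gamma>c i *v vector [1, 0]) \<in> proj_point x y"
    using i(3) unfolding proj_act_def by blast
  then obtain \<mu> where "(\<gamma> ** \<gamma>c i) *v vector [1, 0] = \<mu> *s vector [x, y]"
    unfolding proj_point_def vec.span_singleton by (auto simp: matrix_vector_mul_assoc)
  then have e: "((\<gamma> ** \<gamma>c i) *v vector [1, 0]) $ k = (\<mu> *s vector [x, y]) $ k" for k by simp
  have "(\<gamma> ** \<gamma>c i) $ 1 $ 1 = \<mu> * x" "(\<gamma> ** \<gamma>c i) $ 2 $ 1 = \<mu> * y"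
    using e[of 1] e[of 2] by (simp_all add: matrix_vector_mult_def sum_2)
  then show thesis using that i(1,2) by blast
qed

text \<open>Either some lattice vector has unit forms with product at most \<epsilon>, and then
  \<open>z\<close> lies over a cusp neighbourhood where the hypothesis bounds \<open>H\<close>; or
  there is none, and an integral matrix moves \<open>z\<close> into a compact set. Commensurability
  is used once on each side: for denominators near the cusps, and for returning from integral
  matrices to \<Gamma>.\<close>

lemma bounded_if_bounded_at_cusps:
  fixes \<Gamma> :: "('k^2^2) set" and H :: "complex^'n \<Rightarrow> real"
  assumes \<Gamma>: "subgroup \<Gamma> (SL2 UNIV)"
    and comm: "commensurable (SL2 UNIV) \<Gamma> (carrier (SL2 ring_of_integers))"
    and cusps: "cusp_representatives \<Gamma> h c"
    and \<gamma>c: "\<And>i. i \<in> {1..h} \<Longrightarrow> \<gamma>c i \<in> carrier (SL2 UNIV)"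
      "\<And>i. i \<in> {1..h} \<Longrightarrow> proj_act (\<gamma>c i) proj_infinity = c i"
    and cont: "continuous_on upper_half_space H"
    and inv: "\<And>\<gamma> z. \<gamma> \<in> \<Gamma> \<Longrightarrow> z \<in> upper_half_space \<Longrightarrow> H (moebius_act \<sigma> \<gamma> z) = H z"
    and bd: "\<And>i. i \<in> {1..h} \<Longrightarrow> \<exists>N C. \<forall>z. z \<in> upper_half_space \<longrightarrow> Norm_Im z \<ge> N \<longrightarrow>
      H (moebius_act \<sigma> (\<gamma>c i) z) \<le> C"
  obtains C where "\<And>z. z \<in> upper_half_space \<Longrightarrow> H z \<le> C"
proof -
  let ?O = "carrier (SL2 (ring_of_integers :: 'k set))"
  have \<Gamma>SL: "\<gamma> \<in> carrier (SL2 UNIV)" if "\<gamma> \<in> \<Gamma>" for \<gamma>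
    using subgroup.mem_carrier[OF \<Gamma> that] .
  have "mat 1 \<in> \<Gamma>" using subgroup.one_closed[OF \<Gamma>] by (simp add: SL2_def)
  moreover have "mat 1 \<in> ?O"
    by (rule mat_1_SL2) (simp_all add: ring_of_integers_def)
  ultimately have one: "mat 1 \<in> \<Gamma> \<inter> ?O" by simp
  obtain R1 where R1: "finite R1" "R1 \<subseteq> \<Gamma>" "\<And>A. A \<in> \<Gamma> \<Longrightarrow> \<exists>u\<in>\<Gamma> \<inter> ?O. \<exists>r\<in>R1. A = u ** r"
    using comm one unfolding commensurable_def by (metis finite_index_representatives)
  obtain R2 where R2: "finite R2" "R2 \<subseteq> ?O" "\<And>A. A \<in> ?O \<Longrightarrow> \<exists>u\<in>\<Gamma> \<inter> ?O. \<exists>r\<in>R2. A = u ** r"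
    using comm one unfolding commensurable_def by (metis finite_index_representatives)
  obtain N C where N: "N > 0" and C: "\<And>i z. i \<in> {1..h} \<Longrightarrow> z \<in> upper_half_space \<Longrightarrow> Norm_Im z \<ge> N \<Longrightarrow>
      H (moebius_act \<sigma> (\<gamma>c i) z) \<le> C"
    using uniform_bounds[of "{1..h}" "\<lambda>z. z \<in> upper_half_space" Norm_Im
        "\<lambda>i z. H (moebius_act \<sigma> (\<gamma>c i) z)"] bd
    by (metis (no_types, lifting) finite_atLeastAtMost)
  define X where "X = (\<lambda>(r, i, a, b). (r ** \<gamma>c i) $ a $ b) ` (R1 \<times> {1..h} \<times> UNIV \<times> UNIV)"
  have "finite X" unfolding X_def using R1(1) by (intro finite_imageI finite_cartesian_product) auto
  then obtain m :: nat where m: "m > 0" "\<And>x. x \<in> X \<Longrightarrow> algebraic_int (of_nat m * x)"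
    by (rule common_denominator) blast
  \<comment> \<open>Each \<gamma> is an integral matrix times one of the finitely many
    \<open>r\<close>, so the \<open>m\<close> that clears the denominators of the
    \<open>r ** \<gamma>c i\<close> works for all \<gamma> at once.\<close>
  have den: "algebraic_int (of_nat m * (\<gamma> ** \<gamma>c i) $ a $ b)" if \<gamma>: "\<gamma> \<in> \<Gamma>" and i: "i \<in> {1..h}" for \<gamma> i a b
  proof -
    obtain u r where u: "u \<in> ?O" "r \<in> R1" "\<gamma> = u ** r" using R1(3)[OF \<gamma>] by blast
    have e: "of_nat m * (\<gamma> ** \<gamma>c i) $ a $ b
      = u $ a $ 1 * (of_nat m * (r ** \<gamma>c i) $ 1 $ b) + u $ a $ 2 * (of_nat m * (r ** \<gamma>c i) $ 2 $ b)"
      unfolding u(3) matrix_mul_assoc[symmetric] matrix_mult_2[of u] by (simp add: algebra_simps)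
    have mk: "algebraic_int (of_nat m * (r ** \<gamma>c i) $ k $ b)" for k
      using u(2) i by (intro m(2)) (auto simp: X_def intro!: rev_image_eqI[of "(r, i, k, b)"])
    have uk: "algebraic_int (u $ a $ k)" for k
      using u(1) by (simp add: SL2_iff ring_of_integers_def)
    show ?thesis
      unfolding e by (intro algebraic_int_plus algebraic_int_times[OF uk mk])
  qed
  define \<epsilon> where "\<epsilon> = 1 / (N * (real m ^ CARD('n))\<^sup>2)"
  have \<epsilon>: "\<epsilon> > 0" using N m(1) by (simp add: \<epsilon>_def)
  have thin: "H z \<le> C" if z: "z \<in> upper_half_space" and v: "v \<in> lattice \<times> lattice" "v \<noteq> 0"
    and small: "(\<Prod>j\<in>UNIV. (cmod (unit_form \<sigma> z v j))\<^sup>2) \<le> \<epsilon>" for z v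
  proof -
    obtain x d where xd: "v = (x, d)" by fastforce
    \<comment> \<open>[d : -x] is the cusp at which the form x z + d vanishes.\<close>
    have nz: "(d, - x) \<noteq> (0, 0)" using v(2) xd by (auto simp: zero_prod_def)
    obtain i \<gamma> \<mu> where i: "i \<in> {1..h}" "\<gamma> \<in> \<Gamma>"
        "(\<gamma> ** \<gamma>c i) $ 1 $ 1 = \<mu> * d" "(\<gamma> ** \<gamma>c i) $ 2 $ 1 = \<mu> * - x"
      by (rule ex_cusp_column[OF cusps \<gamma>c(2) nz])
    define g where "g = \<gamma> ** \<gamma>c i"
    have g: "g \<in> carrier (SL2 UNIV)"
      unfolding g_def by (intro SL2_mult \<Gamma>SL \<gamma>c(1) i)
    define w where "w = moebius_act \<sigma> (adj2 g) z"
    have w: "w \<in> upper_half_space"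
      unfolding w_def by (rule moebius_act_upper_half_space[OF adj2_SL2[OF g] z]) simp
    have "algebraic_int x" "algebraic_int d" using v(1) xd lattice_algebraic_int by auto
    then have "Norm_Im w \<ge> N"
      unfolding w_def
      by (intro Norm_Im_ge_of_small_form[OF z g N m(1), of \<mu> d x])
        (use i small den[OF i(2,1)] in \<open>simp_all add: g_def \<epsilon>_def xd\<close>)
    then have "H (moebius_act \<sigma> (\<gamma>c i) w) \<le> C" by (rule C[OF i(1) w])
    moreover have "H z = H (moebius_act \<sigma> (\<gamma>c i) w)"
    proof -
      have "z = moebius_act \<sigma> g w" unfolding w_def by (rule moebius_act_adj2(1)[OF g z, symmetric])
      also have "\<dots> = moebius_act \<sigma> \<gamma> (moebius_act \<sigma> (\<gamma>c i) w)"
        unfolding g_def by (rule moebius_act_mult[OF \<Gamma>SL[OF i(2)] \<gamma>c(1)[OF i(1)] w])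
      finally show ?thesis
        using inv[OF i(2) moebius_act_upper_half_space[OF \<gamma>c(1)[OF i(1)] w]] by simp
    qed
    ultimately show ?thesis by simp
  qed
  obtain a where a: "a > 0" and thick: "\<And>z. z \<in> upper_half_space \<Longrightarrow>
      (\<And>v. v \<in> lattice \<times> lattice \<Longrightarrow> v \<noteq> 0 \<Longrightarrow> (\<Prod>j\<in>UNIV. (cmod (unit_form \<sigma> z v j))\<^sup>2) > \<epsilon>) \<Longrightarrow>
      \<exists>A\<in>?O. \<forall>j. cmod (moebius_act \<sigma> A z $ j) \<le> a \<and> 1 / a \<le> Im (moebius_act \<sigma> A z $ j)"
    by (rule thick_part_cocompact[OF \<epsilon>]) blast
  define Q where "Q = {\<zeta> :: complex^'n. \<forall>j. cmod (\<zeta> $ j) \<le> a \<and> 1 / a \<le> Im (\<zeta> $ j)}"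
  have Q: "compact Q" unfolding Q_def by (rule compact_box)
  have "Im (\<zeta> $ j) > 0" if "\<zeta> \<in> Q" for \<zeta> j
  proof -
    have "0 < 1 / a" using a by simp
    also have "\<dots> \<le> Im (\<zeta> $ j)" using that by (simp add: Q_def)
    finally show ?thesis .
  qed
  then have Qu: "Q \<subseteq> upper_half_space" by (auto simp: upper_half_space_def)
  have R2b: "bounded ((\<lambda>\<zeta>. H (moebius_act \<sigma> r \<zeta>)) ` Q)" if r: "r \<in> R2" for r
  proof -
    have rS: "r \<in> carrier (SL2 UNIV)" using r R2(2) SL2_subset_UNIV by blast
    have "continuous_on Q (\<lambda>\<zeta>. H (moebius_act \<sigma> r \<zeta>))"
      by (rule continuous_on_compose2[OF cont continuous_on_subset[OF continuous_on_moebius_act[OF rS] Qu]])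
        (use Qu moebius_act_upper_half_space[OF rS] in auto)
    then show ?thesis
      using Q compact_continuous_image compact_imp_bounded by blast
  qed
  have "bounded (\<Union>r\<in>R2. (\<lambda>\<zeta>. H (moebius_act \<sigma> r \<zeta>)) ` Q)"
    using R2(1) R2b by (intro bounded_UN) auto
  then obtain C' where "\<And>r \<zeta>. r \<in> R2 \<Longrightarrow> \<zeta> \<in> Q \<Longrightarrow> \<bar>H (moebius_act \<sigma> r \<zeta>)\<bar> \<le> C'"
    unfolding bounded_iff by auto
  then have C': "\<And>r \<zeta>. r \<in> R2 \<Longrightarrow> \<zeta> \<in> Q \<Longrightarrow> H (moebius_act \<sigma> r \<zeta>) \<le> C'"
    by (meson abs_ge_self order_trans)
  show thesis
  proof (rule that[of "max C C'"])
    fix z :: "complex^'n" assume z: "z \<in> upper_half_space"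
    show "H z \<le> max C C'"
    proof (cases "\<exists>v\<in>lattice \<times> lattice. v \<noteq> 0 \<and> (\<Prod>j\<in>UNIV. (cmod (unit_form \<sigma> z v j))\<^sup>2) \<le> \<epsilon>")
      case True
      then show ?thesis using thin[OF z] by fastforce
    next
      case False
      then obtain A where A: "A \<in> ?O" "moebius_act \<sigma> A z \<in> Q"
        using thick[OF z] by (auto simp: Q_def not_le)
      define \<zeta> where "\<zeta> = moebius_act \<sigma> A z"
      have \<zeta>: "\<zeta> \<in> Q" "\<zeta> \<in> upper_half_space" using A(2) Qu by (auto simp: \<zeta>_def)
      \<comment> \<open>The inverse of \<open>A\<close>, not \<open>A\<close>, is decomposed:
        \<open>z\<close> is the inverse applied to \<zeta>, and the factor from \<Gamma> must act
        last to be absorbed by the invariance of \<open>H\<close>.\<close>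
      have "adj2 A \<in> ?O"
        using A(1) by (rule adj2_SL2) (auto simp: ring_of_integers_def)
      then obtain u r where u: "u \<in> \<Gamma>" "r \<in> R2" "adj2 A = u ** r" using R2(3) by blast
      have rS: "r \<in> carrier (SL2 UNIV)" using u(2) R2(2) SL2_subset_UNIV by blast
      have "z = moebius_act \<sigma> (u ** r) \<zeta>"
        unfolding \<zeta>_def u(3)[symmetric] by (rule moebius_act_adj2(2)[OF A(1) z, symmetric])
      also have "\<dots> = moebius_act \<sigma> u (moebius_act \<sigma> r \<zeta>)"
        by (rule moebius_act_mult[OF \<Gamma>SL[OF u(1)] rS \<zeta>(2)])
      finally have "H z = H (moebius_act \<sigma> r \<zeta>)"
        using inv[OF u(1) moebius_act_upper_half_space[OF rS \<zeta>(2)]] by simp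
      then show ?thesis using C'[OF u(2) \<zeta>(1)] by simp
    qed
  qed
qed

end

section \<open>A maximum principle in one variable\<close>

definition dir_deriv :: "'a::real_normed_vector \<Rightarrow> ('a \<Rightarrow> 'b::real_normed_vector) \<Rightarrow> 'a \<Rightarrow> 'b"
  where "dir_deriv e f z = vector_derivative (\<lambda>t::real. f (z + t *\<^sub>R e)) (at 0)"

text \<open>\<open>vector_derivative\<close> is total, so an equation between partial derivatives
  says nothing about their existence. This predicate supplies it: the first derivative in a full
  neighbourhood, the second at the point itself.\<close>

definition twice_dir_diff :: "'a::real_normed_vector \<Rightarrow> ('a \<Rightarrow> 'b::real_normed_vector) \<Rightarrow> 'a \<Rightarrow> bool"
  where "twice_dir_diff e f z \<longleftrightarrow>
    (\<forall>\<^sub>F w in nhds z. ((\<lambda>t. f (w + t *\<^sub>R e)) has_vector_derivative dir_deriv e f w) (at 0)) \<and>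
    ((\<lambda>t. dir_deriv e f (z + t *\<^sub>R e)) has_vector_derivative dir_deriv e (dir_deriv e f) z) (at 0)"

section \<open>Second derivatives along a line\<close>

lemma eventually_along_line:
  fixes z e :: "'a::real_normed_vector"
  assumes "\<forall>\<^sub>F w in nhds z. P w"
  shows "\<forall>\<^sub>F t in nhds (0::real). P (z + t *\<^sub>R e)"
proof -
  have "((\<lambda>t::real. z + t *\<^sub>R e) \<longlongrightarrow> z + 0 *\<^sub>R e) (nhds 0)"
    by (intro tendsto_intros filterlim_ident)
  then show ?thesis using assms unfolding filterlim_iff by simp
qed

lemma has_vector_derivative_cong_nhds:
  assumes "(f has_vector_derivative D) (at x)" "\<forall>\<^sub>F t in nhds x. f t = g t"
  shows "(g has_vector_derivative D) (at x)"
  using has_vector_derivative_cong_ev[where S = UNIV and f = f and g = g and x = x and f' = D]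
    assms eventually_nhds_x_imp_x[OF assms(2)] by simp

lemma twice_dir_diff_minus:
  assumes f: "twice_dir_diff e f z" and g: "twice_dir_diff e g z"
  shows "twice_dir_diff e (\<lambda>w. f w - g w) z"
    and "dir_deriv e (\<lambda>w. f w - g w) z = dir_deriv e f z - dir_deriv e g z"
    and "dir_deriv e (dir_deriv e (\<lambda>w. f w - g w)) z
      = dir_deriv e (dir_deriv e f) z - dir_deriv e (dir_deriv e g) z"
proof -
  let ?h = "\<lambda>w. f w - g w"
  have ev: "\<forall>\<^sub>F w in nhds z. ((\<lambda>t. ?h (w + t *\<^sub>R e)) has_vector_derivative
      dir_deriv e f w - dir_deriv e g w) (at 0)"
    using conjunct1[OF f[unfolded twice_dir_diff_def]] conjunct1[OF g[unfolded twice_dir_diff_def]]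
    by eventually_elim (rule has_vector_derivative_diff)
  then have eq: "\<forall>\<^sub>F w in nhds z. dir_deriv e ?h w = dir_deriv e f w - dir_deriv e g w"
    by eventually_elim (simp add: dir_deriv_def vector_derivative_at)
  from ev eq have ev': "\<forall>\<^sub>F w in nhds z. ((\<lambda>t. ?h (w + t *\<^sub>R e)) has_vector_derivative dir_deriv e ?h w) (at 0)"
    by eventually_elim simp
  show "dir_deriv e ?h z = dir_deriv e f z - dir_deriv e g z"
    using eq by (rule eventually_nhds_x_imp_x)
  have "((\<lambda>t. dir_deriv e f (z + t *\<^sub>R e) - dir_deriv e g (z + t *\<^sub>R e)) has_vector_derivative
      dir_deriv e (dir_deriv e f) z - dir_deriv e (dir_deriv e g) z) (at 0)"
    using f g unfolding twice_dir_diff_def by (auto intro: has_vector_derivative_diff)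
  moreover have "\<forall>\<^sub>F t in nhds (0::real). dir_deriv e f (z + t *\<^sub>R e) - dir_deriv e g (z + t *\<^sub>R e)
      = dir_deriv e ?h (z + t *\<^sub>R e)"
    using eventually_along_line[OF eq, of e] by eventually_elim simp
  ultimately have 2: "((\<lambda>t. dir_deriv e ?h (z + t *\<^sub>R e)) has_vector_derivative
      dir_deriv e (dir_deriv e f) z - dir_deriv e (dir_deriv e g) z) (at 0)"
    by (rule has_vector_derivative_cong_nhds)
  then show eq2: "dir_deriv e (dir_deriv e ?h) z
      = dir_deriv e (dir_deriv e f) z - dir_deriv e (dir_deriv e g) z"
    by (simp add: dir_deriv_def[of e "dir_deriv e ?h"] vector_derivative_at)
  show "twice_dir_diff e ?h z"
    unfolding twice_dir_diff_def eq2 using ev' 2 by blast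
qed

lemma twice_dir_diff_line:
  assumes "twice_dir_diff e f z"
  shows "\<forall>\<^sub>F t in nhds 0. ((\<lambda>t. f (z + t *\<^sub>R e)) has_vector_derivative dir_deriv e f (z + t *\<^sub>R e)) (at t)"
proof -
  have "\<forall>\<^sub>F t in nhds (0::real). ((\<lambda>u. f (z + t *\<^sub>R e + u *\<^sub>R e)) has_vector_derivative
      dir_deriv e f (z + t *\<^sub>R e)) (at 0)"
    using assms eventually_along_line unfolding twice_dir_diff_def by blast
  then show ?thesis
  proof eventually_elim
    case (elim t)
    have "((\<lambda>u. u - t) has_vector_derivative 1) (at t)" by (auto intro!: derivative_eq_intros)
    from vector_diff_chain_at[OF this, of "\<lambda>u. f (z + t *\<^sub>R e + u *\<^sub>R e)"] elim
    show ?case by (simp add: o_def scaleR_left_diff_distrib)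
  qed
qed

text \<open>At a maximum \<phi>' vanishes; were l positive, \<phi>' would be positive just to the
  right and \<phi> would increase there.\<close>

lemma second_derivative_test:
  fixes \<phi> \<phi>' :: "real \<Rightarrow> real"
  assumes ev: "\<forall>\<^sub>F t in nhds 0. (\<phi> has_real_derivative \<phi>' t) (at t)"
    and l: "(\<phi>' has_real_derivative l) (at 0)"
    and max: "\<forall>\<^sub>F t in nhds 0. \<phi> t \<le> \<phi> 0"
  shows "l \<le> 0"
proof (rule ccontr)
  assume "\<not> l \<le> 0"
  obtain d where d: "d > 0" "\<And>t. \<bar>t\<bar> < d \<Longrightarrow> (\<phi> has_real_derivative \<phi>' t) (at t)" "\<And>t. \<bar>t\<bar> < d \<Longrightarrow> \<phi> t \<le> \<phi> 0"
    using eventually_conj[OF ev max] unfolding eventually_nhds_metric by (auto simp: dist_real_def)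
  have "\<phi>' 0 = 0"
    by (rule DERIV_local_max[OF d(2)[of 0] d(1)]) (use d in auto)
  obtain d' where d': "d' > 0" "\<And>h. h > 0 \<Longrightarrow> h < d' \<Longrightarrow> \<phi>' 0 < \<phi>' (0 + h)"
    using DERIV_pos_inc_right[OF l] \<open>\<not> l \<le> 0\<close> by auto
  define h where "h = min d d' / 2"
  have h: "h > 0" "h < d" "h < d'" using d d' by (auto simp: h_def)
  have "\<phi> 0 < \<phi> h"
  proof (rule DERIV_pos_imp_increasing_open[OF h(1)])
    fix x assume "0 < x" "x < h"
    then show "\<exists>y. (\<phi> has_real_derivative y) (at x) \<and> 0 < y"
      using d(2)[of x] d'(2)[of x] h \<open>\<phi>' 0 = 0\<close> by (intro exI[of _ "\<phi>' x"]) auto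
  next
    show "continuous_on {0..h} \<phi>"
      by (rule DERIV_continuous_on[OF has_field_derivative_at_within[OF d(2)]]) (use h in auto)
  qed
  then show False using d(3)[of h] h by simp
qed

lemma cmod_square_derivatives:
  fixes \<phi> \<phi>1 :: "real \<Rightarrow> complex"
  assumes ev: "\<forall>\<^sub>F t in nhds 0. (\<phi> has_vector_derivative \<phi>1 t) (at t)"
    and 2: "(\<phi>1 has_vector_derivative \<phi>2) (at 0)"
  shows "\<forall>\<^sub>F t in nhds 0. ((\<lambda>t. (cmod (\<phi> t))\<^sup>2) has_real_derivative 2 * (\<phi> t \<bullet> \<phi>1 t)) (at t)"
    and "((\<lambda>t. 2 * (\<phi> t \<bullet> \<phi>1 t)) has_real_derivative 2 * (\<phi> 0 \<bullet> \<phi>2 + (cmod (\<phi>1 0))\<^sup>2)) (at 0)"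
proof -
  have inner: "((\<lambda>t. f t \<bullet> g t) has_real_derivative f t \<bullet> g' + f' \<bullet> g t) (at t)"
    if "(f has_vector_derivative f') (at t)" "(g has_vector_derivative g') (at t)"
    for f g :: "real \<Rightarrow> complex" and f' g' t
    using has_derivative_inner[OF that[unfolded has_vector_derivative_def]]
    unfolding has_field_derivative_def by (rule has_derivative_eq_rhs) (auto simp: algebra_simps)
  show "\<forall>\<^sub>F t in nhds 0. ((\<lambda>t. (cmod (\<phi> t))\<^sup>2) has_real_derivative 2 * (\<phi> t \<bullet> \<phi>1 t)) (at t)"
    using ev
  proof eventually_elim
    case (elim t)
    show ?case using inner[OF elim elim] by (simp add: power2_norm_eq_inner inner_commute)
  qed
  have "(\<phi> has_vector_derivative \<phi>1 0) (at 0)" using ev by (rule eventually_nhds_x_imp_x)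
  from inner[OF this 2]
  have "((\<lambda>t. \<phi> t \<bullet> \<phi>1 t) has_real_derivative \<phi> 0 \<bullet> \<phi>2 + (cmod (\<phi>1 0))\<^sup>2) (at 0)"
    by (simp add: power2_norm_eq_inner)
  then show "((\<lambda>t. 2 * (\<phi> t \<bullet> \<phi>1 t)) has_real_derivative 2 * (\<phi> 0 \<bullet> \<phi>2 + (cmod (\<phi>1 0))\<^sup>2)) (at 0)"
    by (auto intro!: derivative_eq_intros)
qed

text \<open>The left side is the second derivative of |f|^2 along \<open>e\<close>. The comparison
  function is given only along the line, since the barrier depends on a single coordinate.\<close>

lemma second_derivative_at_max:
  fixes f :: "'a::real_normed_vector \<Rightarrow> complex" and \<rho> \<rho>1 :: "real \<Rightarrow> real"
  assumes f: "twice_dir_diff e f z"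
    and \<rho>: "\<forall>\<^sub>F t in nhds 0. (\<rho> has_real_derivative \<rho>1 t) (at t)" "(\<rho>1 has_real_derivative \<rho>2) (at 0)"
    and max: "\<forall>\<^sub>F t in nhds 0. (cmod (f (z + t *\<^sub>R e)))\<^sup>2 - \<rho> t \<le> (cmod (f z))\<^sup>2 - \<rho> 0"
  shows "2 * (f z \<bullet> dir_deriv e (dir_deriv e f) z + (cmod (dir_deriv e f z))\<^sup>2) \<le> \<rho>2"
proof -
  note ev = twice_dir_diff_line[OF f]
  have d2: "((\<lambda>t. dir_deriv e f (z + t *\<^sub>R e)) has_vector_derivative dir_deriv e (dir_deriv e f) z) (at 0)"
    using f by (simp add: twice_dir_diff_def)
  have "2 * (f (z + 0 *\<^sub>R e) \<bullet> dir_deriv e (dir_deriv e f) z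
      + (cmod (dir_deriv e f (z + 0 *\<^sub>R e)))\<^sup>2) - \<rho>2 \<le> 0"
  proof (rule second_derivative_test)
    show "\<forall>\<^sub>F t in nhds 0. ((\<lambda>t. (cmod (f (z + t *\<^sub>R e)))\<^sup>2 - \<rho> t) has_real_derivative
        2 * (f (z + t *\<^sub>R e) \<bullet> dir_deriv e f (z + t *\<^sub>R e)) - \<rho>1 t) (at t)"
      using cmod_square_derivatives(1)[OF ev d2] \<rho>(1) by eventually_elim (rule DERIV_diff)
    show "((\<lambda>t. 2 * (f (z + t *\<^sub>R e) \<bullet> dir_deriv e f (z + t *\<^sub>R e)) - \<rho>1 t) has_real_derivative
        2 * (f (z + 0 *\<^sub>R e) \<bullet> dir_deriv e (dir_deriv e f) z
          + (cmod (dir_deriv e f (z + 0 *\<^sub>R e)))\<^sup>2) - \<rho>2) (at 0)"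
      by (rule DERIV_diff[OF cmod_square_derivatives(2)[OF ev d2] \<rho>(2)])
  qed (use max in simp)
  then show ?thesis by simp
qed

section \<open>Restriction to one coordinate and the barrier\<close>

definition coord_slice :: "complex^'n \<Rightarrow> 'n \<Rightarrow> complex \<Rightarrow> complex^'n"
  where "coord_slice z j w = (\<chi> i. if i = j then w else z $ i)"

lemma coord_slice_add:
  "coord_slice z j (w + t *\<^sub>R u) = coord_slice z j w + t *\<^sub>R axis j u"
  by (simp add: coord_slice_def axis_def vec_eq_iff)

lemma coord_slice_upper_half_space:
  "z \<in> upper_half_space \<Longrightarrow> Im w > 0 \<Longrightarrow> coord_slice z j w \<in> upper_half_space"
  by (simp add: coord_slice_def upper_half_space_def)

lemma laplacian_dir_deriv:
  "laplacian j k f z = - of_real ((Im (z $ j))\<^sup>2) *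
      (dir_deriv (axis j 1) (dir_deriv (axis j 1) f) z + dir_deriv (axis j \<i>) (dir_deriv (axis j \<i>) f) z)
    + \<i> * of_int k * of_real (Im (z $ j)) * dir_deriv (axis j 1) f z"
proof -
  have "partial_x j = dir_deriv (axis j 1)" "partial_y j = dir_deriv (axis j \<i>)"
    by (auto simp: partial_x_def partial_y_def dir_deriv_def fun_eq_iff)
  then show ?thesis by (simp add: laplacian_def)
qed

text \<open>The barrier is the hyperbolic cosine of the distance to \<open>\<i>\<close>, an eigenfunction of the
  hyperbolic Laplacian with eigenvalue \<open>2\<close>.\<close>

definition barrier :: "complex \<Rightarrow> real"
  where "barrier w = (1 + (cmod w)\<^sup>2) / (2 * Im w)"

lemma barrier_x_derivatives:
  assumes "Im w > 0"
  shows "\<forall>\<^sub>F t in nhds 0. ((\<lambda>t. barrier (w + t *\<^sub>R 1)) has_real_derivative (Re w + t) / Im w) (at t)"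
    and "((\<lambda>t. (Re w + t) / Im w) has_real_derivative 1 / Im w) (at 0)"
proof -
  have b: "barrier (w + t *\<^sub>R 1) = (1 + (Re w + t)\<^sup>2 + (Im w)\<^sup>2) / (2 * Im w)" for t
    by (simp add: barrier_def cmod_power2)
  show "\<forall>\<^sub>F t in nhds 0. ((\<lambda>t. barrier (w + t *\<^sub>R 1)) has_real_derivative (Re w + t) / Im w) (at t)"
    unfolding b using assms
    by (intro always_eventually allI) (auto intro!: derivative_eq_intros simp: field_simps)
  show "((\<lambda>t. (Re w + t) / Im w) has_real_derivative 1 / Im w) (at 0)"
    using assms by (auto intro!: derivative_eq_intros)
qed

lemma barrier_y_derivatives:
  assumes "Im w > 0"
  shows "\<forall>\<^sub>F t in nhds 0. ((\<lambda>t. barrier (w + t *\<^sub>R \<i>)) has_real_derivative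
      1 / 2 - (1 + (Re w)\<^sup>2) / (2 * (Im w + t)\<^sup>2)) (at t)"
    and "((\<lambda>t. 1 / 2 - (1 + (Re w)\<^sup>2) / (2 * (Im w + t)\<^sup>2)) has_real_derivative
      (1 + (Re w)\<^sup>2) / (Im w)^3) (at 0)"
proof -
  have b: "barrier (w + t *\<^sub>R \<i>) = (1 + (Re w)\<^sup>2 + (Im w + t)\<^sup>2) / (2 * (Im w + t))" for t
    by (simp add: barrier_def cmod_power2)
  have "\<forall>\<^sub>F t in nhds 0. Im w + t > 0"
    using assms by (intro eventually_nhds_in_open[of "{t. Im w + t > 0}", simplified] open_Collect_less continuous_intros) auto
  then show "\<forall>\<^sub>F t in nhds 0. ((\<lambda>t. barrier (w + t *\<^sub>R \<i>)) has_real_derivative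
      1 / 2 - (1 + (Re w)\<^sup>2) / (2 * (Im w + t)\<^sup>2)) (at t)"
  proof eventually_elim
    case (elim t)
    have alg: "(2 * s * (2 * s) - (a + s\<^sup>2) * 2) / ((2 * s) * (2 * s)) = 1 / 2 - a / (2 * s\<^sup>2)"
      if "s > 0" for a s :: real
      using that by (simp add: field_simps power2_eq_square)
    have "((\<lambda>t. (1 + (Re w)\<^sup>2 + (Im w + t)\<^sup>2) / (2 * (Im w + t))) has_real_derivative
      (2 * (Im w + t) * (2 * (Im w + t)) - (1 + (Re w)\<^sup>2 + (Im w + t)\<^sup>2) * 2)
        / ((2 * (Im w + t)) * (2 * (Im w + t)))) (at t)"
      using elim by (auto intro!: derivative_eq_intros)
    then show ?case unfolding b alg[OF elim] .
  qed
  show "((\<lambda>t. 1 / 2 - (1 + (Re w)\<^sup>2) / (2 * (Im w + t)\<^sup>2)) has_real_derivative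
      (1 + (Re w)\<^sup>2) / (Im w)^3) (at 0)"
    using assms by (auto intro!: derivative_eq_intros simp: field_simps power2_eq_square power3_eq_cube)
qed

text \<open>The square of |p| |f| - 2 |y| |g| is nonnegative. The weight 2 is chosen so that the
  cross term consumes exactly 2 y^2 |g|^2, the share of the x-derivative in y^2 times the Laplacian
  of |f|^2.\<close>

lemma first_order_term_bound:
  fixes f g :: complex and p y :: real
  shows "2 * Re (cnj f * (\<i> * of_real p * of_real y * g)) + 2 * y\<^sup>2 * (cmod g)\<^sup>2 \<ge> - (p\<^sup>2 / 2) * (cmod f)\<^sup>2"
proof -
  have "\<bar>Re (cnj f * (\<i> * of_real p * of_real y * g))\<bar> \<le> cmod (cnj f * (\<i> * of_real p * of_real y * g))"
    by (rule abs_Re_le_cmod)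
  also have "\<dots> = (\<bar>p\<bar> * cmod f) * (\<bar>y\<bar> * cmod g)" by (simp add: norm_mult)
  finally have 1: "- ((\<bar>p\<bar> * cmod f) * (\<bar>y\<bar> * cmod g)) \<le> Re (cnj f * (\<i> * of_real p * of_real y * g))"
    by linarith
  have "0 \<le> (\<bar>p\<bar> * cmod f - 2 * (\<bar>y\<bar> * cmod g))\<^sup>2" by simp
  also have "\<dots> = p\<^sup>2 * (cmod f)\<^sup>2 + 4 * (y\<^sup>2 * (cmod g)\<^sup>2) - 4 * ((\<bar>p\<bar> * cmod f) * (\<bar>y\<bar> * cmod g))"
    by (simp add: power2_diff power_mult_distrib)
  finally show ?thesis using 1 by linarith
qed

lemma eventually_upper_half_plane:
  assumes "Im w > 0"
  shows "\<forall>\<^sub>F t in nhds 0. Im (w + t *\<^sub>R u) > 0"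
proof -
  have "\<forall>\<^sub>F v in nhds w. Im v > 0"
    using assms eventually_nhds_in_open[of "{v. Im v > 0}" w] by (simp add: open_halfspace_Im_gt)
  then show ?thesis by (rule eventually_along_line)
qed

text \<open>If u - \<epsilon> barrier were positive somewhere, it would attain a positive maximum,
  because the barrier exceeds any bound for u / \<epsilon> outside a compact set. There the second
  derivatives give y^2 (u_xx + u_yy) \<le> 2 \<epsilon> barrier, whereas the eigenvalue equation
  gives at least 2 u. So u \<le> \<epsilon> barrier for every \<epsilon> > 0.\<close>

lemma bounded_eigenfunction_zero:
  fixes f :: "complex^'n \<Rightarrow> complex" and j :: 'n
  assumes z: "z \<in> upper_half_space"
    and cont: "continuous_on upper_half_space f"
    and bd: "\<And>z. z \<in> upper_half_space \<Longrightarrow> cmod (f z) \<le> C"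
    and tx: "\<And>z. z \<in> upper_half_space \<Longrightarrow> twice_dir_diff (axis j 1) f z"
    and ty: "\<And>z. z \<in> upper_half_space \<Longrightarrow> twice_dir_diff (axis j \<i>) f z"
    and eig: "\<And>z. z \<in> upper_half_space \<Longrightarrow> laplacian j k f z = l * f z"
    and l: "Re l \<le> - (1 + (of_int k)\<^sup>2 / 4)"
  shows "f z = 0"
proof -
  define u where "u w = (cmod (f (coord_slice z j w)))\<^sup>2" for w
  \<comment> \<open>The summand 1 makes \<open>B\<close> positive and the bound on \<open>u\<close>
    strict.\<close>
  define B where "B = C\<^sup>2 + 1"
  have B: "B > 0" by (simp add: B_def add_nonneg_pos)
  have uB: "u w < B" if "Im w > 0" for w
  proof -
    have "u w \<le> C\<^sup>2" unfolding u_def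
      by (intro power_mono bd coord_slice_upper_half_space z that) simp
    then show ?thesis by (simp add: B_def)
  qed
  have main: "u w \<le> \<epsilon> * barrier w" if \<epsilon>: "\<epsilon> > 0" and w: "Im w > 0" for \<epsilon> w
  proof (rule ccontr)
    assume neg: "\<not> u w \<le> \<epsilon> * barrier w"
    define M where "M = B / \<epsilon>"
    have M: "M > 0" using B \<epsilon> by (simp add: M_def)
    \<comment> \<open>The sublevel set of the barrier at \<open>M\<close>, a closed disc. Written
      without division it is visibly closed in the whole plane, and it lies in the upper half-plane
      by itself.\<close>
    define Q where "Q = {w. 1 + (cmod w)\<^sup>2 \<le> 2 * M * Im w}"
    have Qpos: "Im w > 0" if "w \<in> Q" for w
    proof (rule ccontr)
      assume "\<not> Im w > 0"
      then have "2 * M * Im w \<le> 0" using M by (simp add: mult_nonneg_nonpos)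
      moreover have "1 + (cmod w)\<^sup>2 > 0" by (simp add: add_pos_nonneg)
      ultimately show False using that by (simp add: Q_def)
    qed
    have Q_iff: "w \<in> Q \<longleftrightarrow> barrier w \<le> M" if "Im w > 0" for w
      using that by (simp add: Q_def barrier_def divide_le_eq mult_ac)
    have "closed Q" unfolding Q_def by (intro closed_Collect_le continuous_intros)
    moreover have "cmod w \<le> 2 * M" if "w \<in> Q" for w
    proof -
      have "(cmod w)\<^sup>2 \<le> 2 * M * Im w" using that by (simp add: Q_def)
      also have "\<dots> \<le> 2 * M * cmod w" using M by (intro mult_left_mono) (auto simp: abs_Im_le_cmod intro: order_trans[OF abs_ge_self])
      finally have "cmod w * cmod w \<le> 2 * M * cmod w" by (simp add: power2_eq_square)
      moreover have "cmod w > 0" using Qpos[OF that] by auto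
      ultimately show ?thesis by (rule mult_right_le_imp_le)
    qed
    then have "bounded Q" unfolding bounded_iff by blast
    ultimately have cQ: "compact Q" by (simp add: compact_eq_bounded_closed)
    have "barrier w < M"
    proof -
      have "\<epsilon> * barrier w < B" using neg uB[OF w] by simp
      then show ?thesis using \<epsilon> by (simp add: M_def field_simps)
    qed
    then have wQ: "w \<in> Q" using Q_iff[OF w] by simp
    have "continuous_on Q (\<lambda>w. u w - \<epsilon> * barrier w)"
    proof -
      have "continuous_on Q (\<lambda>w. if i = j then w else z $ i)" for i
        by (cases "i = j") (auto intro: continuous_on_id continuous_on_const)
      then have "continuous_on Q (\<lambda>w. coord_slice z j w)"
        unfolding coord_slice_def by (rule continuous_on_vec_lambda)
      then have "continuous_on Q (\<lambda>w. f (coord_slice z j w))"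
        by (rule continuous_on_compose2[OF cont]) (auto intro: coord_slice_upper_half_space z Qpos)
      then show ?thesis
        unfolding u_def barrier_def using Qpos by (intro continuous_intros) force+
    qed
    then obtain w0 where w0: "w0 \<in> Q" and w0max: "\<And>v. v \<in> Q \<Longrightarrow> u v - \<epsilon> * barrier v \<le> u w0 - \<epsilon> * barrier w0"
      using continuous_attains_sup[OF cQ, of "\<lambda>w. u w - \<epsilon> * barrier w"] wQ by blast
    have pos: "u w0 - \<epsilon> * barrier w0 > 0" using w0max[OF wQ] neg by linarith
    \<comment> \<open>Outside \<open>Q\<close> the barrier term exceeds \<open>B\<close>, so the
      difference is negative. The maximum is thus global on the half-plane, and \<open>w0\<close> is
      a local maximum even if it lies on the boundary of \<open>Q\<close>.\<close>
    have max: "u v - \<epsilon> * barrier v \<le> u w0 - \<epsilon> * barrier w0" if v: "Im v > 0" for v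
    proof (cases "v \<in> Q")
      case False
      then have "M < barrier v" using Q_iff[OF v] by simp
      then have "B < \<epsilon> * barrier v" using \<epsilon> by (simp add: M_def field_simps)
      then show ?thesis using uB[OF v] pos by linarith
    qed (rule w0max)
    have y: "Im w0 > 0" by (rule Qpos[OF w0])
    define \<zeta> where "\<zeta> = coord_slice z j w0"
    have \<zeta>: "\<zeta> \<in> upper_half_space" unfolding \<zeta>_def by (rule coord_slice_upper_half_space[OF z y])
    have Im\<zeta>: "Im (\<zeta> $ j) = Im w0" by (simp add: \<zeta>_def coord_slice_def)
    define fx fy fxx fyy where "fx = dir_deriv (axis j 1) f \<zeta>" and "fy = dir_deriv (axis j \<i>) f \<zeta>"
      and "fxx = dir_deriv (axis j 1) (dir_deriv (axis j 1) f) \<zeta>"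
      and "fyy = dir_deriv (axis j \<i>) (dir_deriv (axis j \<i>) f) \<zeta>"
    have maxline: "\<forall>\<^sub>F t in nhds 0. (cmod (f (\<zeta> + t *\<^sub>R axis j e)))\<^sup>2 - \<epsilon> * barrier (w0 + t *\<^sub>R e)
        \<le> (cmod (f \<zeta>))\<^sup>2 - \<epsilon> * barrier (w0 + 0 *\<^sub>R e)" for e
      using eventually_upper_half_plane[OF y, of e]
    proof eventually_elim
      case (elim t)
      show ?case using max[OF elim] by (simp add: u_def \<zeta>_def coord_slice_add)
    qed
    have X: "2 * (f \<zeta> \<bullet> fxx + (cmod fx)\<^sup>2) \<le> \<epsilon> * (1 / Im w0)"
      unfolding fxx_def fx_def
    proof (rule second_derivative_at_max[OF tx[OF \<zeta>] _ _ maxline])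
      show "\<forall>\<^sub>F t in nhds 0. ((\<lambda>t. \<epsilon> * barrier (w0 + t *\<^sub>R 1)) has_real_derivative
          \<epsilon> * ((Re w0 + t) / Im w0)) (at t)"
        using barrier_x_derivatives(1)[OF y] by eventually_elim (rule DERIV_cmult)
      show "((\<lambda>t. \<epsilon> * ((Re w0 + t) / Im w0)) has_real_derivative \<epsilon> * (1 / Im w0)) (at 0)"
        by (rule DERIV_cmult[OF barrier_x_derivatives(2)[OF y]])
    qed
    have Y: "2 * (f \<zeta> \<bullet> fyy + (cmod fy)\<^sup>2) \<le> \<epsilon> * ((1 + (Re w0)\<^sup>2) / (Im w0)^3)"
      unfolding fyy_def fy_def
    proof (rule second_derivative_at_max[OF ty[OF \<zeta>] _ _ maxline])
      show "\<forall>\<^sub>F t in nhds 0. ((\<lambda>t. \<epsilon> * barrier (w0 + t *\<^sub>R \<i>)) has_real_derivative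
          \<epsilon> * (1 / 2 - (1 + (Re w0)\<^sup>2) / (2 * (Im w0 + t)\<^sup>2))) (at t)"
        using barrier_y_derivatives(1)[OF y] by eventually_elim (rule DERIV_cmult)
      show "((\<lambda>t. \<epsilon> * (1 / 2 - (1 + (Re w0)\<^sup>2) / (2 * (Im w0 + t)\<^sup>2))) has_real_derivative
          \<epsilon> * ((1 + (Re w0)\<^sup>2) / (Im w0)^3)) (at 0)"
        by (rule DERIV_cmult[OF barrier_y_derivatives(2)[OF y]])
    qed
    have "(Im w0)\<^sup>2 * (2 * (f \<zeta> \<bullet> fxx + (cmod fx)\<^sup>2) + 2 * (f \<zeta> \<bullet> fyy + (cmod fy)\<^sup>2))
      \<le> (Im w0)\<^sup>2 * (\<epsilon> * (1 / Im w0) + \<epsilon> * ((1 + (Re w0)\<^sup>2) / (Im w0)^3))"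
      using X Y by (intro mult_left_mono add_mono) auto
    also have "\<dots> = 2 * (\<epsilon> * barrier w0)"
      unfolding barrier_def cmod_power2 using y
      by (simp add: field_simps power2_eq_square power3_eq_cube)
    finally have up: "(Im w0)\<^sup>2 * (2 * (f \<zeta> \<bullet> fxx + (cmod fx)\<^sup>2) + 2 * (f \<zeta> \<bullet> fyy + (cmod fy)\<^sup>2))
      \<le> 2 * (\<epsilon> * barrier w0)" .
    have inner: "a \<bullet> b = Re (cnj a * b)" for a b :: complex by (simp add: inner_complex_def)
    have E: "of_real ((Im w0)\<^sup>2) * (fxx + fyy) = \<i> * of_real (of_int k) * of_real (Im w0) * fx - l * f \<zeta>"
      using eig[OF \<zeta>] unfolding laplacian_dir_deriv Im\<zeta> fxx_def fyy_def fx_def by (simp add: algebra_simps)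
    have E': "cnj (f \<zeta>) * (of_real ((Im w0)\<^sup>2) * (fxx + fyy))
      = cnj (f \<zeta>) * (\<i> * of_real (of_int k) * of_real (Im w0) * fx) - l * (cnj (f \<zeta>) * f \<zeta>)"
      unfolding E by (simp add: algebra_simps)
    have "Re (cnj (f \<zeta>) * (of_real ((Im w0)\<^sup>2) * (fxx + fyy)))
      = Re (cnj (f \<zeta>) * (\<i> * of_real (of_int k) * of_real (Im w0) * fx)) - Re (l * (cnj (f \<zeta>) * f \<zeta>))"
      unfolding E' by (rule minus_complex.simps(1))
    also have "Re (l * (cnj (f \<zeta>) * f \<zeta>)) = Re l * (cmod (f \<zeta>))\<^sup>2"
      by (simp add: mult.commute[of "cnj (f \<zeta>)"] complex_norm_square[symmetric] flip: of_real_power)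
    finally have lap: "(Im w0)\<^sup>2 * (f \<zeta> \<bullet> fxx + f \<zeta> \<bullet> fyy)
      = Re (cnj (f \<zeta>) * (\<i> * of_real (of_int k) * of_real (Im w0) * fx)) - Re l * (cmod (f \<zeta>))\<^sup>2"
      by (simp add: inner algebra_simps)
    \<comment> \<open>The hypothesis on \<open>l\<close> enters here: it says that -k^2 / 2 - 2 Re l
      \<ge> 2. The chain continues through the Laplacian of |f|^2 to \<open>up\<close> and
      contradicts \<open>pos\<close>.\<close>
    have "2 * u w0 \<le> (- ((of_int k)\<^sup>2 / 2) - 2 * Re l) * (cmod (f \<zeta>))\<^sup>2"
      unfolding u_def \<zeta>_def using l by (intro mult_right_mono) auto
    also have "\<dots> \<le> 2 * (Re (cnj (f \<zeta>) * (\<i> * of_real (of_int k) * of_real (Im w0) * fx)) - Re l * (cmod (f \<zeta>))\<^sup>2)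
       + 2 * (Im w0)\<^sup>2 * (cmod fx)\<^sup>2"
      using first_order_term_bound[of "of_int k" "f \<zeta>" "Im w0" fx] by (simp add: algebra_simps)
    also have "\<dots> \<le> (Im w0)\<^sup>2 * (2 * (f \<zeta> \<bullet> fxx + (cmod fx)\<^sup>2) + 2 * (f \<zeta> \<bullet> fyy + (cmod fy)\<^sup>2))"
      unfolding lap[symmetric] by (simp add: algebra_simps)
    also note up
    finally show False using pos by simp
  qed
  have y: "Im (z $ j) > 0" using z by (simp add: upper_half_space_def)
  have "u (z $ j) \<le> 0"
  proof (rule ccontr)
    assume "\<not> u (z $ j) \<le> 0"
    then have u0: "u (z $ j) > 0" by simp
    have b: "barrier (z $ j) > 0" using y by (simp add: barrier_def add_pos_nonneg)
    \<comment> \<open>With \<epsilon> = u / (2 barrier) the bound reads u \<le> u / 2.\<close>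
    have "u (z $ j) \<le> (u (z $ j) / (2 * barrier (z $ j))) * barrier (z $ j)"
      by (rule main[OF _ y]) (use u0 b in simp)
    then show False using u0 b by simp
  qed
  moreover have "coord_slice z j (z $ j) = z" by (simp add: coord_slice_def vec_eq_iff)
  ultimately show ?thesis by (simp add: u_def)
qed

section \<open>Smooth functions with a holomorphic parameter\<close>

text \<open>Each point is the only point of \<open>T\<close> in some member of a countable base, and
  that member determines the point. Accumulation points outside \<open>T\<close> do no harm.\<close>

lemma countable_if_discrete:
  fixes T :: "'a::second_countable_topology set"
  assumes "discrete T"
  shows "countable T"
proof -
  obtain \<B> :: "'a set set" where \<B>: "countable \<B>" "\<And>S. open S \<Longrightarrow> \<exists>U. U \<subseteq> \<B> \<and> S = \<Union>U"
    using univ_second_countable by metis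
  have "\<exists>b. b \<in> \<B> \<and> b \<inter> T = {x}" if x: "x \<in> T" for x
  proof -
    obtain V where V: "open V" "V \<inter> T = {x}"
      by (rule isolated_inE[OF discreteD[OF assms x]])
    obtain U where U: "U \<subseteq> \<B>" "V = \<Union>U" using \<B>(2)[OF V(1)] by auto
    have "x \<in> V" using V(2) by auto
    then obtain b where b: "b \<in> U" "x \<in> b" using U(2) by auto
    have "b \<inter> T = {x}" using b U(2) V(2) x by auto
    then show ?thesis using b(1) U(1) by auto
  qed
  then obtain f where f: "\<And>x. x \<in> T \<Longrightarrow> f x \<in> \<B> \<and> f x \<inter> T = {x}" by metis
  have "inj_on f T" using f by (intro inj_onI) (metis singleton_insert_inj_eq)
  moreover have "countable (f ` T)" using f \<B>(1) by (meson countable_subset image_subsetI)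
  ultimately show ?thesis by (rule countable_image_inj_on[rotated])
qed

lemma open_diff_countable_nonempty:
  fixes V :: "'a::euclidean_space set"
  assumes "open V" "V \<noteq> {}" "countable T"
  shows "V - T \<noteq> {}"
proof
  assume "V - T = {}"
  then have "countable V" using assms(3) by (meson Diff_eq_empty_iff countable_subset)
  moreover obtain x e where "e > 0" "ball x e \<subseteq> V"
    using assms(1,2) open_contains_ball by blast
  ultimately show False using uncountable_ball countable_subset by blast
qed

lemma zero_off_countable:
  fixes f :: "'a::euclidean_space \<Rightarrow> 'b::real_normed_vector"
  assumes "open V" "continuous_on V f" "countable T" "\<And>x. x \<in> V - T \<Longrightarrow> f x = 0" "x \<in> V"
  shows "f x = 0"
proof (rule ccontr)
  assume "f x \<noteq> 0"
  have "open (V \<inter> f -` (- {0}))"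
    using assms(1,2) by (intro continuous_open_preimage) auto
  moreover have "V \<inter> f -` (- {0}) \<noteq> {}" using \<open>f x \<noteq> 0\<close> assms(5) by auto
  ultimately have "V \<inter> f -` (- {0}) - T \<noteq> {}" using assms(3) by (rule open_diff_countable_nonempty)
  then show False using assms(4) by auto
qed

lemma open_upper_half_space: "open (upper_half_space :: (complex^'n) set)"
proof -
  have "(upper_half_space :: (complex^'n) set) = (\<Inter>j\<in>UNIV. {z. Im (z $ j) > 0})"
    by (auto simp: upper_half_space_def)
  also have "open \<dots>"
    by (intro open_INT ballI open_Collect_less continuous_intros) auto
  finally show ?thesis .
qed

section \<open>From joint smoothness to each variable separately\<close>

lemma smooth_on_imp_continuous_on:
  assumes "smooth_on S f"
  shows "continuous_on S f"
  unfolding continuous_on_def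
proof
  fix x assume x: "x \<in> S"
  obtain U F where U: "open U" "x \<in> U" "\<forall>k. C_on k U F" "\<forall>y\<in>U \<inter> S. F y = f y"
    using assms x unfolding smooth_on_def by blast
  have "continuous_on U F" using U(3) C_on.simps(1) by blast
  then have "(F \<longlongrightarrow> F x) (at x)" using U(1,2) by (metis at_within_open continuous_on_def)
  then have "(F \<longlongrightarrow> f x) (at x within S)"
    using U(2,4) x by (auto intro: tendsto_within_subset)
  moreover have "\<forall>\<^sub>F y in at x within S. F y = f y"
    unfolding eventually_at_topological using U by blast
  ultimately show "(f \<longlongrightarrow> f x) (at x within S)" by (rule Lim_transform_eventually)
qed

lemma has_vector_derivative_line:
  fixes h :: "'a::real_normed_vector \<times> 'b::real_normed_vector \<Rightarrow> 'c::real_normed_vector"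
  assumes "h differentiable (at (w, s))"
  shows "((\<lambda>t. h (w + t *\<^sub>R e, s)) has_vector_derivative frechet_derivative h (at (w, s)) (e, 0)) (at 0)"
proof -
  have h: "(h has_derivative frechet_derivative h (at (w, s))) (at (w, s))"
    using assms by (simp add: frechet_derivative_works)
  have "((\<lambda>t::real. (w + t *\<^sub>R e, s)) has_derivative (\<lambda>t. (t *\<^sub>R e, 0))) (at 0)"
    by (auto intro!: derivative_eq_intros)
  moreover have "(h has_derivative frechet_derivative h (at (w, s))) (at (w + 0 *\<^sub>R e, s))"
    using h by simp
  ultimately have "((\<lambda>t::real. h (w + t *\<^sub>R e, s)) has_derivative
      (\<lambda>t. frechet_derivative h (at (w, s)) (t *\<^sub>R e, 0))) (at 0)"
    by (rule has_derivative_compose)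
  moreover have "frechet_derivative h (at (w, s)) (t *\<^sub>R e, 0) = t *\<^sub>R frechet_derivative h (at (w, s)) (e, 0)" for t
    using linear_scale[OF has_derivative_linear[OF h], of t "(e, 0)"] by simp
  ultimately show ?thesis by (simp add: has_vector_derivative_def)
qed

text \<open>The half-space is open, so for fixed \<open>s\<close> the local extension agrees with
  \<open>G\<close> on a full neighbourhood of \<open>z\<close> in the slice. The derivatives of the
  slice are those of the extension even when \<open>S\<close> is not open.\<close>

lemma smooth_on_twice_dir_diff:
  fixes G :: "(complex^'n) \<times> complex \<Rightarrow> complex"
  assumes sm: "smooth_on (upper_half_space \<times> S) G" and z: "z \<in> upper_half_space" and s: "s \<in> S"
  shows "twice_dir_diff e (\<lambda>w. G (w, s)) z"
proof -
  obtain U F where U: "open U" "(z, s) \<in> U" "\<And>k. C_on k U F"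
    "\<And>y. y \<in> U \<inter> (upper_half_space \<times> S) \<Longrightarrow> F y = G y"
    using sm z s unfolding smooth_on_def by (metis SigmaI)
  define W where "W = (\<lambda>w. (w, s)) -` U \<inter> upper_half_space"
  have W: "open W" "z \<in> W"
    unfolding W_def using U(1,2) z
    by (auto intro!: open_Int open_vimage open_upper_half_space continuous_intros)
  have FG: "F (w, s) = G (w, s)" if "w \<in> W" for w using that s U(4) by (auto simp: W_def)
  define D where "D x = frechet_derivative F (at x) (e, 0)" for x
  have F1: "F differentiable (at x)" if "x \<in> U" for x using U(3)[of "Suc 0"] that by simp
  have D1: "D differentiable (at x)" if "x \<in> U" for x
    using U(3)[of "Suc (Suc 0)"] that unfolding D_def by simp
  have WU: "(w, s) \<in> U" if "w \<in> W" for w using that by (simp add: W_def)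
  have inW: "\<forall>\<^sub>F t in nhds (0::real). w + t *\<^sub>R e \<in> W" if "w \<in> W" for w
    by (rule eventually_along_line[OF eventually_nhds_in_open[OF W(1) that]])
  have d1: "((\<lambda>t. G (w + t *\<^sub>R e, s)) has_vector_derivative D (w, s)) (at 0)" if "w \<in> W" for w
    unfolding D_def
  proof (rule has_vector_derivative_cong_nhds[OF has_vector_derivative_line[OF F1[OF WU[OF that]]]])
    show "\<forall>\<^sub>F t in nhds 0. F (w + t *\<^sub>R e, s) = G (w + t *\<^sub>R e, s)"
      using inW[OF that] by eventually_elim (rule FG)
  qed
  then have dd: "dir_deriv e (\<lambda>w. G (w, s)) w = D (w, s)" if "w \<in> W" for w
    unfolding dir_deriv_def by (rule vector_derivative_at) (rule that)
  have d2: "((\<lambda>t. dir_deriv e (\<lambda>w. G (w, s)) (z + t *\<^sub>R e)) has_vector_derivative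
      frechet_derivative D (at (z, s)) (e, 0)) (at 0)"
  proof (rule has_vector_derivative_cong_nhds[OF has_vector_derivative_line[OF D1[OF U(2)]]])
    show "\<forall>\<^sub>F t in nhds 0. D (z + t *\<^sub>R e, s) = dir_deriv e (\<lambda>w. G (w, s)) (z + t *\<^sub>R e)"
      using inW[OF W(2)] by eventually_elim (rule dd[symmetric])
  qed
  have "\<forall>\<^sub>F w in nhds z. ((\<lambda>t. G (w + t *\<^sub>R e, s)) has_vector_derivative dir_deriv e (\<lambda>w. G (w, s)) w) (at 0)"
    using eventually_nhds_in_open[OF W] by eventually_elim (use d1 dd in simp)
  moreover have "dir_deriv e (dir_deriv e (\<lambda>w. G (w, s))) z = frechet_derivative D (at (z, s)) (e, 0)"
    using vector_derivative_at[OF d2] unfolding dir_deriv_def[of e "dir_deriv e (\<lambda>w. G (w, s))"] .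
  ultimately show ?thesis unfolding twice_dir_diff_def using d2 by simp
qed

text \<open>\<open>P - T\<close> need not be open; the Cauchy-Riemann equations pass from its points to a
  neighbourhood by density.\<close>

lemma smooth_holomorphic_extension:
  fixes G :: "'a::real_normed_vector \<times> complex \<Rightarrow> complex"
  assumes sm: "smooth_on (X \<times> (P - T)) G" and z: "z \<in> X" and P: "open P" and T: "countable T"
    and hol: "(\<lambda>s. G (z, s)) holomorphic_on (P - T)" and s0: "s0 \<in> P - T"
  obtains V f where "open V" "s0 \<in> V" "V \<subseteq> P" "f holomorphic_on V" "\<And>s. s \<in> V - T \<Longrightarrow> f s = G (z, s)"
proof -
  obtain U F where U: "open U" "(z, s0) \<in> U" "\<And>k. C_on k U F"
    "\<And>y. y \<in> U \<inter> (X \<times> (P - T)) \<Longrightarrow> F y = G y"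
    using sm z s0 unfolding smooth_on_def by (metis SigmaI)
  define V where "V = (\<lambda>s. (z, s)) -` U \<inter> P"
  have V: "open V" "s0 \<in> V" "V \<subseteq> P"
    unfolding V_def using U(1,2) s0 P by (auto intro!: open_Int open_vimage continuous_intros)
  define f where "f s = F (z, s)" for s
  have fG: "f s = G (z, s)" if "s \<in> V - T" for s
    using that z U(4) by (auto simp: V_def f_def)
  define D where "D s v = frechet_derivative F (at (z, s)) (0, v)" for s v
  have fD: "(f has_derivative D s) (at s)" if "s \<in> V" for s
  proof -
    have "F differentiable (at (z, s))" using U(3)[of "Suc 0"] that by (simp add: V_def)
    then have F: "(F has_derivative frechet_derivative F (at (z, s))) (at (z, s))"
      by (simp add: frechet_derivative_works)
    have "((\<lambda>s. (z, s)) has_derivative (\<lambda>v. (0, v))) (at s)" by (auto intro!: derivative_eq_intros)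
    from has_derivative_compose[OF this F] show ?thesis unfolding f_def D_def .
  qed
  have D_cont: "continuous_on V (\<lambda>s. D s v)" for v
  proof -
    have "continuous_on U (\<lambda>x. frechet_derivative F (at x) (0, v))" using U(3)[of "Suc 0"] by simp
    then show ?thesis unfolding D_def
      by (rule continuous_on_compose2) (auto simp: V_def intro!: continuous_intros)
  qed
  \<comment> \<open>The complex derivative and the real one are compared within
    \<open>V - T\<close>. They coincide because arbitrarily short segments in each coordinate
    direction are uncountable and so contain points off \<open>T\<close>.\<close>
  have CR: "D s \<i> - \<i> * D s 1 = 0" if s: "s \<in> V - T" for s
  proof -
    obtain d where "((\<lambda>s. G (z, s)) has_field_derivative d) (at s within P - T)"
      using hol s V(3) by (auto simp: holomorphic_on_def field_differentiable_def)
    then have "((\<lambda>s. G (z, s)) has_derivative (*) d) (at s within V - T)"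
      unfolding has_field_derivative_def by (rule has_derivative_subset) (use V(3) in auto)
    then have fd: "(f has_derivative (*) d) (at s within V - T)"
      by (rule has_derivative_transform[rotated 2]) (use s fG in auto)
    have "s \<in> V" using s by simp
    have "(*) d = D s"
    proof (rule frechet_derivative_unique_within[OF fd has_derivative_at_withinI[OF fD[OF \<open>s \<in> V\<close>]]])
      fix i :: complex and e :: real
      assume i: "i \<in> Basis" and e: "e > 0"
      obtain r where r: "r > 0" "ball s r \<subseteq> V" using V(1) s open_contains_ball by blast
      have "norm i = 1" using i by simp
      have "uncountable {0<..<min e r}" using e r by (simp add: uncountable_open_interval)
      moreover have "countable ((\<lambda>t. s + t *\<^sub>R i) -` T \<inter> {0<..<min e r})"
      proof -
        have "inj_on (\<lambda>t::real. s + t *\<^sub>R i) ((\<lambda>t. s + t *\<^sub>R i) -` T)"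
          using \<open>norm i = 1\<close> by (auto simp: inj_on_def)
        moreover have "countable ((\<lambda>t::real. s + t *\<^sub>R i) ` ((\<lambda>t. s + t *\<^sub>R i) -` T))"
          using T by (rule countable_subset[rotated]) auto
        ultimately have "countable ((\<lambda>t::real. s + t *\<^sub>R i) -` T)"
          using countable_image_inj_on by blast
        then show ?thesis by blast
      qed
      ultimately obtain t where t: "t \<in> {0<..<min e r}" "s + t *\<^sub>R i \<notin> T"
        by (metis Int_absorb1 subsetI vimageI2)
      moreover have "s + t *\<^sub>R i \<in> V"
        using t(1) r(2) \<open>norm i = 1\<close> by (auto simp: dist_norm subset_iff)
      ultimately show "\<exists>t. 0 < \<bar>t\<bar> \<and> \<bar>t\<bar> < e \<and> s + t *\<^sub>R i \<in> V - T"
        by (intro exI[of _ t]) auto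
    qed
    from fun_cong[OF this, of \<i>] fun_cong[OF this, of 1] show ?thesis
      by (simp add: mult.commute)
  qed
  have CR': "D s \<i> = \<i> * D s 1" if "s \<in> V" for s
  proof -
    have "D s \<i> - \<i> * D s 1 = 0"
      by (rule zero_off_countable[of V "\<lambda>s. D s \<i> - \<i> * D s 1" T])
        (use V T CR that in \<open>auto intro!: continuous_intros D_cont\<close>)
    then show ?thesis by simp
  qed
  have "(f has_field_derivative D s 1) (at s)" if "s \<in> V" for s
  proof -
    note lin = has_derivative_linear[OF fD[OF that]]
    have "D s v = D s 1 * v" for v
    proof -
      have "v = Re v *\<^sub>R 1 + Im v *\<^sub>R \<i>" by (simp add: complex_eq_iff)
      then have "D s v = D s (Re v *\<^sub>R 1 + Im v *\<^sub>R \<i>)" by (rule arg_cong)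
      also have "\<dots> = Re v *\<^sub>R D s 1 + Im v *\<^sub>R D s \<i>"
        by (simp only: linear_add[OF lin] linear_scale[OF lin])
      also have "\<dots> = D s 1 * (of_real (Re v) + \<i> * of_real (Im v))"
        by (simp add: CR'[OF that] scaleR_conv_of_real algebra_simps)
      finally show ?thesis by (simp add: complex_eq[symmetric])
    qed
    then have "D s = (*) (D s 1)" by (rule ext)
    then show ?thesis using fD[OF that] unfolding has_field_derivative_def by metis
  qed
  then have "f holomorphic_on V"
    unfolding holomorphic_on_def field_differentiable_def
    by (blast intro: has_field_derivative_at_within)
  then show thesis using that V fG by blast
qed

text \<open>\<open>P - T\<close> is connected because \<open>T\<close> is countable. It is covered
  by two open sets: \<open>A\<close>, near whose points \<open>g\<close> vanishes off
  \<open>T\<close>, and \<open>B\<close>, near whose points \<open>g\<close> vanishes on no nonempty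
  open piece. Disjointness is built into the definitions; covering is the identity theorem on a ball
  for a local holomorphic extension.\<close>

lemma identity_theorem_off_countable:
  fixes g :: "complex \<Rightarrow> complex"
  assumes P: "open P" "connected P" and T: "countable T"
    and loc: "\<And>s. s \<in> P - T \<Longrightarrow> \<exists>V f. open V \<and> s \<in> V \<and> f holomorphic_on V \<and> (\<forall>x\<in>V - T. f x = g x)"
    and W: "open W" "W \<noteq> {}" "W \<subseteq> P" "\<And>s. s \<in> W - T \<Longrightarrow> g s = 0"
    and s: "s \<in> P - T"
  shows "g s = 0"
proof -
  define A where "A = \<Union>{V. open V \<and> (\<forall>x\<in>V - T. g x = 0)}"
  define B where "B = \<Union>{V. open V \<and> (\<forall>V'. open V' \<longrightarrow> V' \<subseteq> V \<longrightarrow> V' \<noteq> {} \<longrightarrow> (\<exists>x\<in>V' - T. g x \<noteq> 0))}"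
  have "open A" "open B" unfolding A_def B_def by (auto intro!: open_Union)
  moreover have "A \<inter> B \<inter> (P - T) = {}"
  proof (rule ccontr)
    assume "A \<inter> B \<inter> (P - T) \<noteq> {}"
    then obtain x V1 V2 where "x \<in> V1" "x \<in> V2" "open V1" "open V2" "\<forall>x\<in>V1 - T. g x = 0"
      "\<forall>V'. open V' \<longrightarrow> V' \<subseteq> V2 \<longrightarrow> V' \<noteq> {} \<longrightarrow> (\<exists>x\<in>V' - T. g x \<noteq> 0)"
      unfolding A_def B_def by blast
    moreover from this have "\<exists>x\<in>(V1 \<inter> V2) - T. g x \<noteq> 0" by blast
    ultimately show False by blast
  qed
  moreover have "P - T \<subseteq> A \<union> B"
  proof
    fix x assume x: "x \<in> P - T"
    obtain V f where V: "open V" "x \<in> V" "f holomorphic_on V" "\<forall>y\<in>V - T. f y = g y" using loc[OF x] by blast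
    obtain r where r: "r > 0" "ball x r \<subseteq> V" using V(1,2) open_contains_ball by blast
    show "x \<in> A \<union> B"
    proof (cases "\<forall>y\<in>ball x r. f y = 0")
      case True
      then have "\<forall>y\<in>ball x r - T. g y = 0" using V(4) r(2) by (metis Diff_iff subset_iff)
      then show ?thesis unfolding A_def using r(1) by (auto intro!: exI[of _ "ball x r"])
    next
      case False
      have "\<exists>y\<in>V' - T. g y \<noteq> 0" if V': "open V'" "V' \<subseteq> ball x r" "V' \<noteq> {}" for V'
      proof (rule ccontr)
        assume "\<not> ?thesis"
        then have "f y = 0" if "y \<in> V' - T" for y using that V(4) V'(2) r(2) by auto
        moreover have "continuous_on V' f"
          using V(3) V'(2) r(2) by (meson continuous_on_subset holomorphic_on_imp_continuous_on order_trans)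
        ultimately have "f y = 0" if "y \<in> V'" for y
          using zero_off_countable[OF V'(1) _ T] that by blast
        then have "f y = 0" if "y \<in> ball x r" for y
          using analytic_continuation_open[OF V'(1) open_ball V'(3) connected_ball V'(2)
              holomorphic_on_subset[OF V(3) r(2)] holomorphic_on_const[of 0]] that by blast
        then show False using False by blast
      qed
      then show ?thesis unfolding B_def using r(1) by (auto intro!: exI[of _ "ball x r"])
    qed
  qed
  moreover have "connected (P - T)"
    using P T by (intro connected_open_diff_countable) auto
  ultimately have "A \<inter> (P - T) = {} \<or> B \<inter> (P - T) = {}"
    unfolding connected_def by blast
  moreover obtain x where "x \<in> W - T" using open_diff_countable_nonempty[OF W(1,2) T] by blast
  then have "x \<in> A \<inter> (P - T)" using W unfolding A_def by blast
  ultimately have "P - T \<subseteq> A" using \<open>P - T \<subseteq> A \<union> B\<close> by blast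
  then show ?thesis using s unfolding A_def by blast
qed

section \<open>Uniqueness\<close>

lemma cmod_unitary_char:
  assumes "\<And>j. w $ j \<noteq> 0"
  shows "cmod (unitary_char p w) = 1"
proof -
  have "cmod ((w $ j / of_real (cmod (w $ j))) powi (p $ j)) = 1" for j
    using assms[of j] by (simp add: norm_power_int norm_divide)
  then show ?thesis by (simp add: unitary_char_def prod_norm[symmetric])
qed

text \<open>As Re s > 1, the comparison function has modulus at most 1 once the norm is at least
  1.\<close>

lemma bounded_near_Norm_infinity:
  assumes "f \<in> O[Norm_to_infinity](\<lambda>z. of_real (Norm_Im z) powr (1 - s))" "Re s > 1"
  obtains N C :: real where "\<And>z. z \<in> upper_half_space \<Longrightarrow> Norm_Im z \<ge> N \<Longrightarrow> cmod (f z) \<le> C"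
proof -
  obtain c where c: "c > 0" "\<forall>\<^sub>F z in Norm_to_infinity. cmod (f z) \<le> c * cmod (of_real (Norm_Im z) powr (1 - s))"
    using landau_o.bigE[OF assms(1)] by blast
  obtain Q where Q: "eventually Q at_top" "\<And>z. Q (Norm_Im z) \<Longrightarrow> z \<in> upper_half_space \<Longrightarrow>
      cmod (f z) \<le> c * cmod (of_real (Norm_Im z) powr (1 - s))"
    using c(2) unfolding Norm_to_infinity_def eventually_inf_principal eventually_filtercomap by blast
  obtain N where N: "\<And>n. n \<ge> N \<Longrightarrow> Q n" using Q(1) unfolding eventually_at_top_linorder by blast
  show thesis
  proof (rule that[of "max N 1" c])
    fix z :: "complex^'a" assume z: "z \<in> upper_half_space" "Norm_Im z \<ge> max N 1"
    have "cmod (of_real (Norm_Im z) powr (1 - s)) = Norm_Im z powr (1 - Re s)"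
      using z(2) by (subst norm_powr_real_powr) auto
    also have "\<dots> \<le> Norm_Im z powr 0" using z(2) assms(2) by (intro powr_mono) auto
    also have "\<dots> \<le> 1" by simp
    finally have "c * cmod (of_real (Norm_Im z) powr (1 - s)) \<le> c * 1" using c(1) by (intro mult_left_mono) auto
    then show "cmod (f z) \<le> c" using Q(2)[OF N z(1)] z(2) by fastforce
  qed
qed

text \<open>The weight is unitary: the automorphy factor has modulus 1, so |f| transforms with
  weight zero.\<close>

lemma (in totally_real_basis) cmod_slash:
  assumes "A \<in> carrier (SL2 UNIV)" "z \<in> upper_half_space"
  shows "cmod (slash \<sigma> p A f z) = cmod (f (moebius_act \<sigma> A z))"
  unfolding slash_def norm_mult norm_inverse
  by (subst cmod_unitary_char) (use aut_factor_nonzero[OF assms] in auto)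

lemma slash_diff: "slash \<sigma> p A (\<lambda>w. f w - g w) z = slash \<sigma> p A f z - slash \<sigma> p A g z"
  by (simp add: slash_def algebra_simps)

text \<open>Linearity requires that the derivatives exist, as \<open>laplacian\<close> is built from
  the total operator \<open>vector_derivative\<close>.\<close>

lemma laplacian_diff:
  assumes "\<And>e. twice_dir_diff e f z" "\<And>e. twice_dir_diff e g z"
  shows "laplacian j k (\<lambda>w. f w - g w) z = laplacian j k f z - laplacian j k g z"
  unfolding laplacian_dir_deriv twice_dir_diff_minus(2,3)[OF assms] by (simp add: algebra_simps)

text \<open>Since Re (s (1 - s)) = (Im s)^2 - Re s (Re s - 1), the imaginary part works against the
  bound and is kept below 1, while Re s exceeds a constant depending on the weight. An open
  half-strip is enough for analytic continuation.\<close>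

lemma Re_eigenvalue_le:
  assumes "Re s > 2 + \<bar>k\<bar>" "\<bar>Im s\<bar> < 1"
  shows "Re (s * (1 - s)) \<le> - (1 + k\<^sup>2 / 4)"
proof -
  have "(Im s)\<^sup>2 \<le> 1" using assms(2) by (simp add: abs_square_le_1)
  moreover have "(2 + \<bar>k\<bar>) * (1 + \<bar>k\<bar>) \<le> Re s * (Re s - 1)"
    using assms(1) by (intro mult_mono) auto
  moreover have "(2 + \<bar>k\<bar>) * (1 + \<bar>k\<bar>) = 2 + 3 * \<bar>k\<bar> + k\<^sup>2"
    by (simp add: algebra_simps power2_eq_square)
  moreover have "Re (s * (1 - s)) = (Im s)\<^sup>2 - Re s * (Re s - 1)"
    by (simp add: algebra_simps power2_eq_square)
  moreover have "k\<^sup>2 / 4 \<le> k\<^sup>2" by simp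
  ultimately show ?thesis by linarith
qed

theorem mainTheorem1:
  fixes \<sigma> :: "'n::finite \<Rightarrow> 'k::field_char_0 \<Rightarrow> real"
    and \<Gamma> :: "('k^2^2) set"
    and h :: nat
    and c :: "nat \<Rightarrow> ('k^2) set"
    and T :: "complex set"
    and A :: "nat \<Rightarrow> complex \<Rightarrow> complex"
    and \<gamma>c :: "nat \<Rightarrow> 'k^2^2"
    and p :: "int^'n"
  assumes "number_field TYPE('k)" and "totally_real TYPE('k)"
    and "field_degree TYPE('k) = CARD('n)"
    and "bij_betw \<sigma> UNIV {\<tau>. field_embedding \<tau>}"
    and "subgroup \<Gamma> (SL2 UNIV)"
    and "commensurable (SL2 UNIV) \<Gamma> (carrier (SL2 ring_of_integers))"
    and "cusp_representatives \<Gamma> h c"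
    and "T \<subseteq> Pi_1" and "discrete T"
    and "\<And>i. i \<in> {1..h} \<Longrightarrow> A i holomorphic_on (Pi_1 - T)"
    and "\<And>i. i \<in> {1..h} \<Longrightarrow> \<gamma>c i \<in> carrier (SL2 UNIV)"
    and "\<And>i. i \<in> {1..h} \<Longrightarrow> proj_act (\<gamma>c i) proj_infinity = c i"
  shows "\<exists>\<^sub>\<le>\<^sub>1 G. G \<in> (upper_half_space \<times> (Pi_1 - T)) \<rightarrow>\<^sub>E (UNIV :: complex set) \<and>
    smooth_on (upper_half_space \<times> (Pi_1 - T)) G \<and>
    (\<forall>z\<in>upper_half_space. (\<lambda>s. G (z, s)) holomorphic_on (Pi_1 - T)) \<and>
    (\<forall>s\<in>Pi_1 - T. \<forall>\<gamma>\<in>\<Gamma>. \<forall>z\<in>upper_half_space.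
       slash \<sigma> p \<gamma> (\<lambda>w. G (w, s)) z = G (z, s)) \<and>
    (\<forall>j. \<forall>s\<in>Pi_1 - T. \<forall>z\<in>upper_half_space.
       laplacian j (p $ j) (\<lambda>w. G (w, s)) z = s * (1 - s) * G (z, s)) \<and>
    (\<forall>i\<in>{1..h}. \<forall>s\<in>Pi_1 - T.
       (\<lambda>z. slash \<sigma> p (\<gamma>c i) (\<lambda>w. G (w, s)) z - A i s * of_real (Norm_Im z) powr s)
         \<in> O[Norm_to_infinity](\<lambda>z. of_real (Norm_Im z) powr (1 - s)))"
    (is "\<exists>\<^sub>\<le>\<^sub>1 G. ?ext G \<and> ?smooth G \<and> ?hol G \<and> ?mod G \<and> ?lap G \<and> ?cusp G")
proof -
  obtain b :: "'n \<Rightarrow> 'k" where b: "\<And>x. \<exists>q :: 'n \<Rightarrow> rat. x = (\<Sum>i\<in>UNIV. of_rat (q i) * b i)"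
      "\<And>i. algebraic_int (b i)"
    using number_field_integral_basis[OF assms(1,3)] by metis
  have "field_embedding (\<sigma> j)" for j using assms(4) by (auto simp: bij_betw_def)
  moreover have "inj \<sigma>" using assms(4) by (simp add: bij_betw_def)
  ultimately interpret totally_real_basis \<sigma> b using b by unfold_locales
  have T: "countable T" using assms(9) by (rule countable_if_discrete)
  have P: "open Pi_1" "connected Pi_1"
    unfolding Pi_1_def by (simp_all add: open_halfspace_Re_gt convex_halfspace_Re_gt convex_connected)
  have SL: "\<gamma> \<in> carrier (SL2 UNIV)" if "\<gamma> \<in> \<Gamma>" for \<gamma> using subgroup.mem_carrier[OF assms(5) that] .
  have eq: "G1 (z, s) = G2 (z, s)"
    if 1: "?smooth G1" "?hol G1" "?mod G1" "?lap G1" "?cusp G1"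
      and 2: "?smooth G2" "?hol G2" "?mod G2" "?lap G2" "?cusp G2"
      and z: "z \<in> upper_half_space" and s: "s \<in> Pi_1 - T" for G1 G2 z s
  proof -
    define F where "F s w = G1 (w, s) - G2 (w, s)" for s w
    \<comment> \<open>Vanishing in one variable suffices. \<open>undefined\<close> names some place;
      the index type is nonempty.\<close>
    define k where "k = p $ (undefined :: 'n)"
    have zero: "F s z = 0" if s: "s \<in> Pi_1 - T" "Re s > 2 + \<bar>of_int k\<bar>" "\<bar>Im s\<bar> < 1" for s
    proof -
      have tw: "twice_dir_diff e (\<lambda>w. G1 (w, s)) z" "twice_dir_diff e (\<lambda>w. G2 (w, s)) z"
        if "z \<in> upper_half_space" for e z
        using smooth_on_twice_dir_diff[OF 1(1) that s(1)] smooth_on_twice_dir_diff[OF 2(1) that s(1)] .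
      have cont: "continuous_on upper_half_space (F s)"
      proof -
        have "continuous_on upper_half_space (\<lambda>w. (w, s))" by (intro continuous_intros)
        then have "continuous_on upper_half_space (\<lambda>w. G (w, s))" if "?smooth G" for G :: "(complex^'n) \<times> complex \<Rightarrow> complex"
          by (rule continuous_on_compose2[OF smooth_on_imp_continuous_on[OF that]]) (use s in auto)
        then show ?thesis unfolding F_def using 1(1) 2(1) by (intro continuous_on_diff) auto
      qed
      have slashF: "slash \<sigma> p \<gamma> (F s) w = slash \<sigma> p \<gamma> (\<lambda>w. G1 (w, s)) w - slash \<sigma> p \<gamma> (\<lambda>w. G2 (w, s)) w" for \<gamma> w
        using slash_diff[of \<sigma> p \<gamma> "\<lambda>w. G1 (w, s)" "\<lambda>w. G2 (w, s)" w] by (simp add: F_def[abs_def])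
      obtain C where C: "\<And>w. w \<in> upper_half_space \<Longrightarrow> cmod (F s w) \<le> C"
      proof (rule bounded_if_bounded_at_cusps[OF assms(5,6,7,11,12), of "\<lambda>w. cmod (F s w)"])
        show "continuous_on upper_half_space (\<lambda>w. cmod (F s w))" by (intro continuous_intros cont)
        show "cmod (F s (moebius_act \<sigma> \<gamma> w)) = cmod (F s w)" if "\<gamma> \<in> \<Gamma>" "w \<in> upper_half_space" for \<gamma> w
        proof -
          have "slash \<sigma> p \<gamma> (F s) w = F s w"
            unfolding slashF using 1(3) 2(3) s(1) that by (simp add: F_def)
          then show ?thesis using cmod_slash[OF SL[OF that(1)] that(2), of p "F s"] by simp
        qed
        show "\<exists>N C. \<forall>w. w \<in> upper_half_space \<longrightarrow> N \<le> Norm_Im w \<longrightarrow> cmod (F s (moebius_act \<sigma> (\<gamma>c i) w)) \<le> C"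
          if i: "i \<in> {1..h}" for i
        proof -
          have "(\<lambda>w. (slash \<sigma> p (\<gamma>c i) (\<lambda>w. G1 (w, s)) w - A i s * of_real (Norm_Im w) powr s)
              - (slash \<sigma> p (\<gamma>c i) (\<lambda>w. G2 (w, s)) w - A i s * of_real (Norm_Im w) powr s))
            \<in> O[Norm_to_infinity](\<lambda>w. of_real (Norm_Im w) powr (1 - s))"
            by (rule sum_in_bigo(2)[OF bspec[OF bspec[OF 1(5) i] s(1)] bspec[OF bspec[OF 2(5) i] s(1)]])
          then have "(\<lambda>w. slash \<sigma> p (\<gamma>c i) (F s) w) \<in> O[Norm_to_infinity](\<lambda>w. of_real (Norm_Im w) powr (1 - s))"
            unfolding slashF by simp
          then obtain N C where "\<And>w. w \<in> upper_half_space \<Longrightarrow> Norm_Im w \<ge> N \<Longrightarrow> cmod (slash \<sigma> p (\<gamma>c i) (F s) w) \<le> C"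
            by (rule bounded_near_Norm_infinity) (use s(1) in \<open>auto simp: Pi_1_def\<close>)
          then show ?thesis
            using cmod_slash[OF assms(11)[OF i], of _ p "F s"] by (metis (no_types, lifting))
        qed
      next
        fix C assume "\<And>w. w \<in> upper_half_space \<Longrightarrow> cmod (F s w) \<le> C"
        then show thesis by (rule that)
      qed
      show ?thesis
      proof (rule bounded_eigenfunction_zero[OF z cont C])
        have "twice_dir_diff (axis undefined u) (F s) w" if "w \<in> upper_half_space" for u w
          unfolding F_def by (rule twice_dir_diff_minus(1)[OF tw[OF that]])
        then show "twice_dir_diff (axis undefined 1) (F s) w" "twice_dir_diff (axis undefined \<i>) (F s) w"
          if "w \<in> upper_half_space" for w using that by blast+
        show "laplacian undefined k (F s) w = s * (1 - s) * F s w" if w: "w \<in> upper_half_space" for w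
          unfolding F_def laplacian_diff[OF tw[OF w]] using 1(4) 2(4) s(1) w
          by (simp add: k_def algebra_simps)
        show "Re (s * (1 - s)) \<le> - (1 + (of_int k)\<^sup>2 / 4)" by (rule Re_eigenvalue_le[OF s(2,3)])
      qed
    qed
    have "F s z = 0"
    proof (rule identity_theorem_off_countable[OF P T, of "\<lambda>s. F s z"])
      let ?W = "{s. Re s > 2 + \<bar>of_int k\<bar>} \<inter> {s. Im s < 1} \<inter> {s. Im s > - 1}"
      show "open ?W" by (intro open_Int open_halfspace_Re_gt open_halfspace_Im_lt open_halfspace_Im_gt)
      have "of_real (3 + \<bar>of_int k\<bar>) \<in> ?W" by simp
      then show "?W \<noteq> {}" by blast
      show W: "?W \<subseteq> Pi_1" by (auto simp: Pi_1_def)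
      show "F s z = 0" if "s \<in> ?W - T" for s
        using that W by (intro zero) auto
      show "s \<in> Pi_1 - T" by (rule s)
      show "\<exists>V f. open V \<and> s \<in> V \<and> f holomorphic_on V \<and> (\<forall>x\<in>V - T. f x = F x z)" if s: "s \<in> Pi_1 - T" for s
      proof -
        obtain V1 f1 where V1: "open V1" "s \<in> V1" "f1 holomorphic_on V1" "\<And>x. x \<in> V1 - T \<Longrightarrow> f1 x = G1 (z, x)"
          by (rule smooth_holomorphic_extension[OF 1(1) z P(1) T _ s]) (use 1(2) z in auto)
        obtain V2 f2 where V2: "open V2" "s \<in> V2" "f2 holomorphic_on V2" "\<And>x. x \<in> V2 - T \<Longrightarrow> f2 x = G2 (z, x)"
          by (rule smooth_holomorphic_extension[OF 2(1) z P(1) T _ s]) (use 2(2) z in auto)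
        have "(\<lambda>x. f1 x - f2 x) holomorphic_on V1 \<inter> V2"
          using V1(3) V2(3) by (intro holomorphic_on_diff) (auto intro: holomorphic_on_subset)
        then show ?thesis
          using V1 V2 by (intro exI[of _ "V1 \<inter> V2"] exI[of _ "\<lambda>x. f1 x - f2 x"]) (auto simp: F_def)
      qed
    qed
    then show ?thesis by (simp add: F_def)
  qed
  show ?thesis
  proof (rule Uniq_I)
    fix G1 G2
    assume 1: "?ext G1 \<and> ?smooth G1 \<and> ?hol G1 \<and> ?mod G1 \<and> ?lap G1 \<and> ?cusp G1"
      and 2: "?ext G2 \<and> ?smooth G2 \<and> ?hol G2 \<and> ?mod G2 \<and> ?lap G2 \<and> ?cusp G2"
    \<comment> \<open>Membership in the extensional function space fixes the values off the domain,
      so agreement on the domain is equality.\<close>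
    have "?ext G1" "?ext G2" using 1 2 by blast+
    then show "G1 = G2"
    proof (rule PiE_ext)
      fix x :: "(complex^'n) \<times> complex" assume "x \<in> upper_half_space \<times> (Pi_1 - T)"
      then obtain z s where x: "x = (z, s)" "z \<in> upper_half_space" "s \<in> Pi_1 - T" by auto
      show "G1 x = G2 x" unfolding x(1)
        by (rule eq[of G1 G2 z s]) (insert 1 2 x(2,3), (elim conjE, assumption)+)
    qed
  qed
qed

end
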